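(* Let $\mu,\mu'\in\mathcal{V}_d$. Assume that the kernel $k$ is $C_0$-universal, that its reproducing kernel Hilbert space $W$ is continuously embedded in $C_0^1(\mathbb{R}^n\times\widetilde{G}^n_d)$, and that $\mathrm{supp}(\mu)\subset K$ for some compact subset $K$ of $\mathbb{R}^n\times\widetilde{G}^n_d$. Then there exists $(v,\alpha)\in L^2([0,1],V)\times L^2(|\mu|)$ achieving the infimum $$\inf\left\{\frac12\int_0^1\|v_t\|_V^2\,dt+\frac\gamma2\int_{\mathbb{R}^n}(\alpha(x)-1)^2\,d|\mu|(x)+\frac\lambda2\left\|(\varphi_1^v)_\#(\alpha\mu)-\mu'\right\|_{W^*}^2\right\}$$ over all $v\in L^2([0,1],V)$ and all weight rescaling functions $\alpha\in L^2(|\mu|)$, $\alpha\ge0$.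
   Context: Let $n\ge 2$, $0\le d\le n$. $\widetilde{G}^n_d$ is the oriented Grassmannian of $d$-dimensional oriented linear subspaces of $\mathbb{R}^n$. An (oriented) $d$-varifold is a nonnegative finite Radon measure on $\mathbb{R}^n\times\widetilde{G}^n_d$; $\mathcal{V}_d$ is the set of all of them. The weight $|\mu|$ of $\mu\in\mathcal{V}_d$ is the measure on $\mathbb{R}^n$ with $|\mu|(A)=\mu(A\times\widetilde{G}^n_d)$. For a $C^1$-diffeomorphism $\varphi$ of $\mathbb{R}^n$, the pushforward is defined by $(\varphi_\#\mu|\omega)=\int \omega(\varphi(x),d_x\varphi\cdot U)\,J_U\varphi(x)\,d\mu(x,U)$ for $\omega\in C_0(\mathbb{R}^n\times\widetilde{G}^n_d)$, where $d_x\varphi\cdot U$ is the oriented image of $U$ under $d_x\varphi$ and $J_U\varphi(x)=\sqrt{\det(d_x\varphi(u_i)\cdot d_x\varphi(u_j))_{i,j}}$ for any orthonormal frame $(u_1,\dots,u_d)$ of $U$. For a nonnegative function $\alpha$ on $\mathbb{R}^n$, $(\alpha\mu|\omega)=\int\alpha(x)\omega(x,U)\,d\mu(x,U)$. $V$ is a Hilbert space of vector fields $\mathbb{R}^n\to\mathbb{R}^n$ continuously embedded in $C^2_0(\mathbb{R}^n,\mathbb{R}^n)$ ($C^2$ vector fields vanishing at infinity together with their first and second order derivatives). For $v\in L^2([0,1],V)$, $\varphi^v_t$ is the flow: $\varphi_0^v=\mathrm{Id}$, $\partial_t\varphi_t^v=v_t\circ\varphi_t^v$. The parameters $\gamma,\lambda>0$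 are fixed. The kernel is $k(x,U,x',U')=k^{pos}(x,x')k^G(U,U')$ with $k^{pos}$, $k^G$ continuous positive definite kernels on $\mathbb{R}^n$ and $\widetilde{G}^n_d$, and $k^{pos}(x,\cdot)\in C_0(\mathbb{R}^n)$ for every $x$; $W$ is its reproducing kernel Hilbert space, which is continuously embedded in $C_0(\mathbb{R}^n\times\widetilde{G}^n_d)$. $k$ is called $C_0$-universal if $W$ is dense in $C_0(\mathbb{R}^n\times\widetilde{G}^n_d)$. Varifolds act as linear forms on $W$ by integration and $\|\mu-\mu'\|_{W^*}=\sup_{\|\omega\|_W\le1}(\mu-\mu'|\omega)$. $C_0^1(\mathbb{R}^n\times\widetilde{G}^n_d)$ is the space of $C^1$ functions vanishing at infinity together with their first derivatives. *)

theory Defs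
  imports "HOL-Analysis.Analysis" "Jordan_Normal_Form.Determinant"
begin

hide_const (open) Matrix.vec Matrix.mat Determinant.det
hide_type (open) Matrix.vec

section \<open>Function spaces\<close>

definition C0_on :: "'a::metric_space set \<Rightarrow> ('a \<Rightarrow> 'b::real_normed_vector) \<Rightarrow> bool" where
  "C0_on S f \<longleftrightarrow> continuous_on S f \<and>
     (\<forall>e>0. \<exists>K. compact K \<and> K \<subseteq> S \<and> (\<forall>z\<in>S - K. norm (f z) < e))"

text \<open>In the application of the next definition \<open>S\<close> is a closed embedded submanifold of a
  Euclidean space. The field \<open>f'\<close> is then determined by \<open>f\<close> only on tangent vectors of \<open>S\<close>, where it
  is the differential of \<open>f\<close>; its values on normal vectors are free, and setting them to zero
  gives the least possible norm, namely that of the differential. Hence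
  \<open>\<exists>f'. C1_0_on S f f'\<close> says that \<open>f\<close> is \<open>C\<^sup>1\<close> on the manifold \<open>S\<close> and vanishes at
  infinity together with its differential, and the uniform norm of the differential is the least
  uniform norm of such a field \<open>f'\<close>.\<close>

definition C1_0_on ::
  "'a::euclidean_space set \<Rightarrow> ('a \<Rightarrow> real) \<Rightarrow> ('a \<Rightarrow> 'a \<Rightarrow>\<^sub>L real) \<Rightarrow> bool" where
  "C1_0_on S f f' \<longleftrightarrow> C0_on S f \<and> C0_on S f' \<and>
     (\<forall>z\<in>S. (f has_derivative blinfun_apply (f' z)) (at z within S))"

definition C2_0 ::
  "('a::euclidean_space \<Rightarrow> 'a) \<Rightarrow> ('a \<Rightarrow> 'a \<Rightarrow>\<^sub>L 'a) \<Rightarrow> ('a \<Rightarrow> 'a \<Rightarrow>\<^sub>L 'a \<Rightarrow>\<^sub>L 'a) \<Rightarrow> bool" where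
  "C2_0 f f' f'' \<longleftrightarrow> C0_on UNIV f \<and> C0_on UNIV f' \<and> C0_on UNIV f'' \<and>
     (\<forall>x. (f has_derivative blinfun_apply (f' x)) (at x)) \<and>
     (\<forall>x. (f' has_derivative blinfun_apply (f'' x)) (at x))"

text \<open>Square integrable functions, as representatives rather than classes. For values in a
  separable Hilbert space Borel measurability is the same as strong measurability; a Hilbert
  space of vector fields continuously embedded in \<open>C\<^sup>2\<^sub>0\<close> is separable.\<close>

definition L2 :: "'a measure \<Rightarrow> ('a \<Rightarrow> 'b::real_normed_vector) \<Rightarrow> bool" where
  "L2 M f \<longleftrightarrow> f \<in> borel_measurable M \<and> integrable M (\<lambda>x. (norm (f x))\<^sup>2)"

section \<open>The oriented Grassmannian and varifolds\<close>

text \<open>An oriented \<open>d\<close>-dimensional subspace with oriented orthonormal basis \<open>u 0, \<dots>, u (d - 1)\<close> is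
  represented by the unit simple \<open>d\<close>-vector \<open>u 0 \<and> \<dots> \<and> u (d - 1)\<close>, which does not depend on the
  choice of the basis and determines the oriented subspace (Pluecker embedding). The coordinates
  of a \<open>d\<close>-vector in the basis \<open>e\<^sub>I\<close> are indexed by sets \<open>I\<close> of size \<open>d\<close>; in \<open>e\<^sub>I\<close> the elements
  of \<open>I\<close> are taken in the order given by \<open>from_nat_into I\<close>, so that no order on the
  index type is needed (another order changes only the sign of \<open>e\<^sub>I\<close>).\<close>

definition wedge :: "nat \<Rightarrow> (nat \<Rightarrow> real^'n) \<Rightarrow> real^('n::finite set)" where
  "wedge d u = (\<chi> I. if card I = d
     then Determinant.det (Matrix.mat d d (\<lambda>(i, j). vec_nth (u j) (from_nat_into I i))) else 0)"

definition orthonormal_frame :: "nat \<Rightarrow> (nat \<Rightarrow> 'a::real_inner) \<Rightarrow> bool" where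
  "orthonormal_frame d u \<longleftrightarrow> (\<forall>i<d. \<forall>j<d. inner (u i) (u j) = (if i = j then 1 else 0))"

text \<open>The sign \<open>s\<close> matters only for \<open>d = 0\<close>: the null space has the two orientations \<open>\<plusminus>1\<close>,
  but only one (empty) basis.\<close>

definition orient_frame :: "nat \<Rightarrow> real^('n::finite set) \<Rightarrow> real \<times> (nat \<Rightarrow> real^'n) \<Rightarrow> bool" where
  "orient_frame d U = (\<lambda>(s, u). s \<in> {1, -1} \<and> orthonormal_frame d u \<and> U = s *\<^sub>R wedge d u)"

definition ograss :: "nat \<Rightarrow> (real^('n::finite set)) set" where
  "ograss d = {U. \<exists>p. orient_frame d U p}"

text \<open>The next two notions do not depend on the frame chosen.\<close>

definition orient_image ::
  "nat \<Rightarrow> (real^'n \<Rightarrow> real^'n) \<Rightarrow> real^('n::finite set) \<Rightarrow> real^('n set)" where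
  "orient_image d L U = (case SOME p. orient_frame d U p of (s, u) \<Rightarrow>
     s *\<^sub>R sgn (wedge d (\<lambda>i. L (u i))))"

definition jac :: "nat \<Rightarrow> (real^'n \<Rightarrow> real^'n) \<Rightarrow> real^('n::finite set) \<Rightarrow> real" where
  "jac d L U = (case SOME p. orient_frame d U p of (s, u) \<Rightarrow>
     sqrt (Determinant.det (Matrix.mat d d (\<lambda>(i, j). inner (L (u i)) (L (u j))))))"

type_synonym 'n opoint = "(real^'n) \<times> (real^('n set))"

definition obundle :: "nat \<Rightarrow> ('n::finite opoint) set" where
  "obundle d = UNIV \<times> ograss d"

definition obundle_borel :: "nat \<Rightarrow> ('n::finite opoint) measure" where
  "obundle_borel d = restrict_space borel (obundle d)"

text \<open>Finite Borel measures on this locally compact, second countable space are Radon.\<close>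

definition varifold :: "nat \<Rightarrow> ('n::finite opoint) measure \<Rightarrow> bool" where
  "varifold d \<mu> \<longleftrightarrow> sets \<mu> = sets (obundle_borel d) \<and> finite_measure \<mu>"

definition weight :: "('n::finite opoint) measure \<Rightarrow> (real^'n) measure" where
  "weight \<mu> = distr \<mu> borel fst"

definition msupp :: "('a::topological_space) measure \<Rightarrow> 'a set" where
  "msupp \<mu> = {z \<in> space \<mu>. \<forall>T. open T \<and> z \<in> T \<longrightarrow> emeasure \<mu> (T \<inter> space \<mu>) > 0}"

definition rescale :: "(real^'n \<Rightarrow> real) \<Rightarrow> ('n::finite opoint) measure \<Rightarrow> ('n opoint) measure" where
  "rescale \<alpha> \<mu> = density \<mu> (\<lambda>(x, U). ennreal (\<alpha> x))"

definition push_map ::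
  "nat \<Rightarrow> (real^'n \<Rightarrow> real^'n) \<Rightarrow> 'n::finite opoint \<Rightarrow> 'n opoint" where
  "push_map d \<phi> = (\<lambda>(x, U). (\<phi> x, orient_image d (frechet_derivative \<phi> (at x)) U))"

definition push_jac :: "nat \<Rightarrow> (real^'n \<Rightarrow> real^'n) \<Rightarrow> 'n::finite opoint \<Rightarrow> real" where
  "push_jac d \<phi> = (\<lambda>(x, U). jac d (frechet_derivative \<phi> (at x)) U)"

definition pushforward ::
  "nat \<Rightarrow> (real^'n \<Rightarrow> real^'n) \<Rightarrow> ('n::finite opoint) measure \<Rightarrow> ('n opoint) measure" where
  "pushforward d \<phi> \<mu> =
     distr (density \<mu> (\<lambda>z. ennreal (push_jac d \<phi> z))) (obundle_borel d) (push_map d \<phi>)"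

text \<open>The measurability and sign assumptions hold for every \<open>C\<^sup>1\<close>-diffeomorphism \<open>\<phi>\<close>.\<close>

lemma integral_pushforward:
  fixes \<mu> :: "('n::finite opoint) measure" and \<omega> :: "'n opoint \<Rightarrow> real"
  assumes "push_map d \<phi> \<in> measurable \<mu> (obundle_borel d)"
    and "push_jac d \<phi> \<in> borel_measurable \<mu>" and "\<And>z. z \<in> space \<mu> \<Longrightarrow> 0 \<le> push_jac d \<phi> z"
    and "\<omega> \<in> borel_measurable (obundle_borel d)"
  shows "(\<integral>z. \<omega> z \<partial>pushforward d \<phi> \<mu>) = (\<integral>z. \<omega> (push_map d \<phi> z) * push_jac d \<phi> z \<partial>\<mu>)"
proof -
  have m: "(\<lambda>z. \<omega> (push_map d \<phi> z)) \<in> borel_measurable \<mu>"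
    using measurable_compose[OF assms(1,4)] .
  have "(\<integral>z. \<omega> z \<partial>pushforward d \<phi> \<mu>)
      = (\<integral>z. \<omega> (push_map d \<phi> z) \<partial>density \<mu> (\<lambda>z. ennreal (push_jac d \<phi> z)))"
    unfolding pushforward_def using assms(1,4) by (intro integral_distr) simp_all
  also have "\<dots> = (\<integral>z. push_jac d \<phi> z *\<^sub>R \<omega> (push_map d \<phi> z) \<partial>\<mu>)"
    using assms(2,3) m by (intro integral_density) (auto intro!: AE_I2)
  finally show ?thesis by (simp add: mult.commute)
qed

section \<open>Kernels\<close>

definition pos_def_kernel :: "'a set \<Rightarrow> ('a \<Rightarrow> 'a \<Rightarrow> real) \<Rightarrow> bool" where
  "pos_def_kernel S k \<longleftrightarrow> (\<forall>x\<in>S. \<forall>y\<in>S. k x y = k y x) \<and>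
     (\<forall>X c. finite X \<and> X \<subseteq> S \<longrightarrow> (\<Sum>x\<in>X. \<Sum>y\<in>X. c x * c y * k x y) \<ge> 0)"

definition prod_kernel ::
  "('a \<Rightarrow> 'a \<Rightarrow> real) \<Rightarrow> ('b \<Rightarrow> 'b \<Rightarrow> real) \<Rightarrow> 'a \<times> 'b \<Rightarrow> 'a \<times> 'b \<Rightarrow> real" where
  "prod_kernel k1 k2 = (\<lambda>(x, U) (x', U'). k1 x x' * k2 U U')"

text \<open>A Hilbert space of functions is given by a Hilbert space type with a linear map \<open>ev\<close> sending
  its elements injectively to functions; here only the values on \<open>S\<close> count.\<close>

definition rkhs :: "'a set \<Rightarrow> ('a \<Rightarrow> 'a \<Rightarrow> real) \<Rightarrow>
    ('w::{real_inner,complete_space} \<Rightarrow> 'a \<Rightarrow> real) \<Rightarrow> bool" where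
  "rkhs S k ev \<longleftrightarrow> (\<forall>z\<in>S. linear (\<lambda>w. ev w z)) \<and>
     (\<forall>w. (\<forall>z\<in>S. ev w z = 0) \<longrightarrow> w = 0) \<and>
     (\<forall>z\<in>S. \<exists>kz. (\<forall>z'\<in>S. ev kz z' = k z z') \<and> (\<forall>w. ev w z = inner w kz))"

definition C0_universal :: "'a::metric_space set \<Rightarrow> ('w \<Rightarrow> 'a \<Rightarrow> real) \<Rightarrow> bool" where
  "C0_universal S ev \<longleftrightarrow> (\<forall>f::'a \<Rightarrow> real. C0_on S f \<longrightarrow>
     (\<forall>e>0. \<exists>w. \<forall>z\<in>S. \<bar>f z - ev w z\<bar> < e))"

definition C1_0_embedded ::
  "'a::euclidean_space set \<Rightarrow> ('w::real_normed_vector \<Rightarrow> 'a \<Rightarrow> real) \<Rightarrow> bool" where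
  "C1_0_embedded S ev \<longleftrightarrow> (\<exists>C. \<forall>w. \<exists>f'. C1_0_on S (ev w) f' \<and>
     (\<forall>z\<in>S. \<bar>ev w z\<bar> \<le> C * norm w \<and> norm (f' z) \<le> C * norm w))"

definition dual_dist :: "('w::real_normed_vector \<Rightarrow> 'a \<Rightarrow> real) \<Rightarrow> 'a measure \<Rightarrow> 'a measure \<Rightarrow> real" where
  "dual_dist ev \<mu> \<mu>' =
     (SUP w\<in>{w. norm w \<le> 1}. (\<integral>z. ev w z \<partial>\<mu>) - (\<integral>z. ev w z \<partial>\<mu>'))"

section \<open>Vector fields, flows and the energy\<close>

definition C2_0_embedded ::
  "('v::{real_inner,complete_space} \<Rightarrow> 'a::euclidean_space \<Rightarrow> 'a) \<Rightarrow> bool" where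
  "C2_0_embedded \<iota> \<longleftrightarrow> (\<forall>x. linear (\<lambda>v. \<iota> v x)) \<and> inj \<iota> \<and>
     (\<exists>C. \<forall>v. \<exists>f' f''. C2_0 (\<iota> v) f' f'' \<and>
        (\<forall>x. norm (\<iota> v x) \<le> C * norm v \<and> norm (f' x) \<le> C * norm v \<and> norm (f'' x) \<le> C * norm v))"

text \<open>Since \<open>v\<close> is only square integrable in time, the flow equation is understood in integral
  form (equivalently, for absolutely continuous curves and almost every time). It includes the
  initial condition.\<close>

definition flow_curve ::
  "('v \<Rightarrow> 'a::euclidean_space \<Rightarrow> 'a) \<Rightarrow> (real \<Rightarrow> 'v) \<Rightarrow> 'a \<Rightarrow> (real \<Rightarrow> 'a) \<Rightarrow> bool" where
  "flow_curve \<iota> v x c \<longleftrightarrow>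
     (\<forall>t\<in>{0..1}. ((\<lambda>s. \<iota> (v s) (c s)) has_integral (c t - x)) {0..t})"

definition flow ::
  "('v \<Rightarrow> 'a::euclidean_space \<Rightarrow> 'a) \<Rightarrow> (real \<Rightarrow> 'v) \<Rightarrow> real \<Rightarrow> 'a \<Rightarrow> 'a" where
  "flow \<iota> v t x = (THE y. \<exists>c. flow_curve \<iota> v x c \<and> c t = y)"

definition admissible ::
  "('n::finite opoint) measure \<Rightarrow> (real \<Rightarrow> 'v::real_normed_vector) \<Rightarrow> (real^'n \<Rightarrow> real) \<Rightarrow> bool" where
  "admissible \<mu> v \<alpha> \<longleftrightarrow>
     L2 (lebesgue_on {0..1}) v \<and> L2 (weight \<mu>) \<alpha> \<and> (AE x in weight \<mu>. 0 \<le> \<alpha> x)"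

definition energy :: "nat \<Rightarrow> real \<Rightarrow> real \<Rightarrow>
    ('v::real_normed_vector \<Rightarrow> real^'n \<Rightarrow> real^'n) \<Rightarrow> ('w::real_normed_vector \<Rightarrow> 'n opoint \<Rightarrow> real) \<Rightarrow>
    ('n::finite opoint) measure \<Rightarrow> ('n opoint) measure \<Rightarrow>
    (real \<Rightarrow> 'v) \<Rightarrow> (real^'n \<Rightarrow> real) \<Rightarrow> real" where
  "energy d \<gamma> lam \<iota> ev \<mu> \<mu>' v \<alpha> =
     1/2 * (\<integral>t. (norm (v t))\<^sup>2 \<partial>lebesgue_on {0..1})
     + \<gamma>/2 * (\<integral>x. (\<alpha> x - 1)\<^sup>2 \<partial>weight \<mu>)
     + lam/2 * (dual_dist ev (pushforward d (flow \<iota> v 1) (rescale \<alpha> \<mu>)) \<mu>')\<^sup>2"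

end

theory Submission
  imports Defs "HOL-Library.Diagonal_Subsequence"
begin

text \<open>The direct method. Along a minimizing sequence \<open>(v\<^sub>n, \<alpha>\<^sub>n)\<close> the energies bound \<open>v\<^sub>n\<close> in
  \<open>L\<^sup>2([0,1], V)\<close> and \<open>\<alpha>\<^sub>n - 1\<close> in \<open>L\<^sup>2(|\<mu>|)\<close>, so both have weakly convergent subsequences. Weak
  convergence of \<open>v\<^sub>n\<close> makes the flows at time \<open>1\<close> and their differentials converge pointwise (by
  Gronwall's inequality), hence \<open>\<omega>(\<phi>\<^sub>n x, d\<phi>\<^sub>n U) J\<^sub>U\<phi>\<^sub>n(x)\<close> converges boundedly and pointwise for every
  test function \<open>\<omega>\<close>. Its integral against the weakly convergent \<open>\<alpha>\<^sub>n\<close> therefore converges, so the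
  push-forwards converge weakly in \<open>W\<^sup>*\<close>, and all three terms of the energy are weakly lower
  semicontinuous. By the Cauchy-Binet formula the oriented image and the Jacobian of \<open>L\<close> on \<open>U\<close> are the
  direction and the length of \<open>\<Lambda>\<^sup>dL U\<close>, which gives their measurability and continuity.\<close>

section \<open>Weak compactness in Hilbert spaces\<close>

text \<open>Two obstacles shape the proof. The value type \<open>'v\<close> carries no second
  countability, so sums and inner products of Borel functions need not be measurable a priori.
  Separability of \<open>V\<close> is therefore derived from injectivity and continuity of its
  evaluations, and a countable dense set accompanies the \<open>L2\<close> theory. Moreover the flow
  depends nonlinearly on \<open>v\<close>, whereas weak convergence acts through linear functionals
  only. The way out is to keep the limit flow line \<open>c\<close> fixed: the integral of
  \<open>\<iota> (V n s) (c s)\<close> is linear in \<open>V n\<close>, so \<open>c\<close> is an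
  approximate solution of the equation of \<open>V n\<close> with vanishing defect, and stability
  constants that depend only on the energy bound bring the true flow line close to \<open>c\<close>.
  Oriented subspaces are handled through \<open>d\<close>-vectors because the minors of a matrix
  depend polynomially on it, whereas a chosen frame need not vary continuously.\<close>

text \<open>Square integrable functions are representatives, not classes, and functions carry no
  vector space class. Hence a Hilbert space is given here by a carrier with a binary linear
  combination \<open>lc a x b y\<close> (for \<open>a x + b y\<close>) and a positive semidefinite form.\<close>

locale semi_hilbert =
  fixes H :: "'a set" and lc :: "real \<Rightarrow> 'a \<Rightarrow> real \<Rightarrow> 'a \<Rightarrow> 'a" and ip :: "'a \<Rightarrow> 'a \<Rightarrow> real"
  assumes ne: "H \<noteq> {}"
    and lc_in: "\<And>a x b y. x \<in> H \<Longrightarrow> y \<in> H \<Longrightarrow> lc a x b y \<in> H"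
    and ip_lc: "\<And>a x b y z. x \<in> H \<Longrightarrow> y \<in> H \<Longrightarrow> z \<in> H \<Longrightarrow> ip (lc a x b y) z = a * ip x z + b * ip y z"
    and ip_sym: "\<And>x y. x \<in> H \<Longrightarrow> y \<in> H \<Longrightarrow> ip x y = ip y x"
    and ip_nonneg: "\<And>x. x \<in> H \<Longrightarrow> 0 \<le> ip x x"
    and complete: "\<And>X. (\<And>n::nat. X n \<in> H) \<Longrightarrow>
      (\<And>e. 0 < e \<Longrightarrow> \<exists>N. \<forall>m\<ge>N. \<forall>n\<ge>N. ip (lc 1 (X m) (-1) (X n)) (lc 1 (X m) (-1) (X n)) < e) \<Longrightarrow>
      \<exists>x\<in>H. (\<lambda>n. ip (lc 1 (X n) (-1) x) (lc 1 (X n) (-1) x)) \<longlonglongrightarrow> 0"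
begin

abbreviation "dist_sq x y \<equiv> ip (lc 1 x (-1) y) (lc 1 x (-1) y)"

lemma ip_lc_right:
  "x \<in> H \<Longrightarrow> y \<in> H \<Longrightarrow> z \<in> H \<Longrightarrow> ip z (lc a x b y) = a * ip z x + b * ip z y"
  by (metis ip_lc ip_sym lc_in)

lemma ip_lc_lc:
  assumes "x \<in> H" "y \<in> H"
  shows "ip (lc a x b y) (lc a x b y) = a\<^sup>2 * ip x x + 2 * a * b * ip x y + b\<^sup>2 * ip y y"
  using assms by (simp add: ip_lc ip_lc_right lc_in ip_sym[of y x] power2_eq_square algebra_simps)

text \<open>A null vector of the form need not be zero, hence the case distinction. If
  \<open>ip y y = 0\<close>, the form at \<open>x + t y\<close> is affine in \<open>t\<close> and
  nonnegative, which forces \<open>ip x y = 0\<close>. Otherwise it is evaluated at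
  \<open>ip y y * x - ip x y * y\<close>.\<close>

lemma Cauchy_Schwarz:
  assumes "x \<in> H" "y \<in> H"
  shows "(ip x y)\<^sup>2 \<le> ip x x * ip y y"
proof (cases "ip y y = 0")
  case True
  have "0 \<le> ip x x + 2 * t * ip x y" for t
    using ip_nonneg[OF lc_in[OF assms, of 1 t]] ip_lc_lc[OF assms, of 1 t] True by simp
  \<comment> \<open>At this \<open>t\<close> the affine function would take the value
    \<open>-1\<close> if \<open>ip x y\<close> were not zero.\<close>
  from this[of "- (ip x x + 1) / (2 * ip x y)"] have "ip x y = 0"
    by (cases "ip x y = 0") (simp_all add: field_simps)
  then show ?thesis using True by simp
next
  case False
  then have pos: "ip y y > 0" using ip_nonneg[OF assms(2)] by simp
  have "0 \<le> (ip y y)\<^sup>2 * ip x x - ip y y * (ip x y)\<^sup>2"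
    using ip_nonneg[OF lc_in[OF assms, of "ip y y" "- ip x y"]]
      ip_lc_lc[OF assms, of "ip y y" "- ip x y"]
    by (simp add: power2_eq_square algebra_simps)
  also have "\<dots> = ip y y * (ip x x * ip y y - (ip x y)\<^sup>2)" by (simp add: power2_eq_square algebra_simps)
  finally show ?thesis using pos by (simp add: zero_le_mult_iff)
qed

text \<open>The bound by \<open>ip x x\<close> makes a functional vanish on null vectors, so it is
  really one on the Hilbert space of classes; squares avoid introducing the seminorm.\<close>

definition functional :: "('a \<Rightarrow> real) \<Rightarrow> bool" where
  "functional F \<longleftrightarrow> (\<forall>a b. \<forall>x\<in>H. \<forall>y\<in>H. F (lc a x b y) = a * F x + b * F y) \<and>
     (\<exists>K\<ge>0. \<forall>x\<in>H. (F x)\<^sup>2 \<le> K * ip x x)"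

lemma functional_ip: "z \<in> H \<Longrightarrow> functional (ip z)"
  unfolding functional_def using ip_lc_right Cauchy_Schwarz ip_nonneg by blast

lemma functional_tendsto:
  assumes F: "functional F" and X: "\<And>n. X n \<in> H" and x: "x \<in> H"
    and lim: "(\<lambda>n::nat. dist_sq (X n) x) \<longlonglongrightarrow> 0"
  shows "(\<lambda>n. F (X n)) \<longlonglongrightarrow> F x"
proof -
  obtain K where K: "\<forall>x\<in>H. (F x)\<^sup>2 \<le> K * ip x x" using F unfolding functional_def by blast
  have "(\<lambda>n. (F (X n) - F x)\<^sup>2) \<longlonglongrightarrow> 0"
  proof (rule tendsto_sandwich[OF _ _ tendsto_const])
    have "F (lc 1 (X n) (-1) x) = F (X n) - F x" for n
      using F X x unfolding functional_def by simp
    then have "(F (X n) - F x)\<^sup>2 \<le> K * dist_sq (X n) x" for n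
      using K[rule_format, OF lc_in[OF X x, of 1 n "-1"]] by simp
    then show "\<forall>\<^sub>F n in sequentially. (F (X n) - F x)\<^sup>2 \<le> K * dist_sq (X n) x"
      by simp
    show "(\<lambda>n. K * dist_sq (X n) x) \<longlonglongrightarrow> 0"
      using tendsto_mult_left[OF lim, of K] by simp
  qed simp
  then have "(\<lambda>n. sqrt ((F (X n) - F x)\<^sup>2)) \<longlonglongrightarrow> sqrt 0" by (rule tendsto_real_sqrt)
  then show ?thesis by (simp add: LIM_zero_iff tendsto_rabs_zero_iff)
qed

text \<open>The representer minimizes \<open>ip g g - 2 * F g\<close>; a minimizing sequence is Cauchy by the
  parallelogram identity.\<close>

lemma Riesz:
  assumes F: "functional F"
  shows "\<exists>f\<in>H. \<forall>g\<in>H. F g = ip f g"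
proof -
  define Q where "Q g = ip g g - 2 * F g" for g
  obtain K where K0: "0 \<le> K" and K: "\<forall>x\<in>H. (F x)\<^sup>2 \<le> K * ip x x"
    using F unfolding functional_def by blast
  have F_lc: "F (lc a x b y) = a * F x + b * F y" if "x \<in> H" "y \<in> H" for a b x y
    using F that unfolding functional_def by simp
  \<comment> \<open>Arithmetic-geometric mean: \<open>(2 * F g)\<^sup>2 \<le> 4 * K * ip g g \<le>
    (K + ip g g)\<^sup>2\<close>.\<close>
  have lower: "- K \<le> Q g" if "g \<in> H" for g
  proof -
    have "(F g)\<^sup>2 \<le> K * ip g g" using K that by blast
    moreover have "0 \<le> (K - ip g g)\<^sup>2" by simp
    ultimately have "(2 * F g)\<^sup>2 \<le> (K + ip g g)\<^sup>2" by (simp add: power2_eq_square algebra_simps)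
    moreover have "0 \<le> K + ip g g" using K0 ip_nonneg[OF that] by simp
    ultimately have "2 * F g \<le> K + ip g g" by (meson power2_le_imp_le)
    then show ?thesis by (simp add: Q_def)
  qed
  define I where "I = Inf (Q ` H)"
  have bdd: "bdd_below (Q ` H)" using lower by (intro bdd_belowI2)
  have I_le: "I \<le> Q g" if "g \<in> H" for g unfolding I_def using bdd that by (rule cINF_lower)
  have "\<exists>g\<in>H. Q g < I + 1 / real (Suc n)" for n
    using cINF_less_iff[OF ne bdd, of "I + 1 / real (Suc n)"] unfolding I_def by simp
  then obtain X where X: "\<And>n. X n \<in> H" and QX: "\<And>n. Q (X n) < I + 1 / real (Suc n)" by metis
  have "\<exists>f\<in>H. (\<lambda>n. dist_sq (X n) f) \<longlonglongrightarrow> 0"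
  proof (rule complete[OF X])
    fix e :: real assume "0 < e"
    then obtain N where N: "1 / real (Suc N) < e / 4" using nat_approx_posE[of "e/4"] by auto
    have "dist_sq (X m) (X n) < e" if "m \<ge> N" "n \<ge> N" for m n
    proof -
      have "dist_sq (X m) (X n)
        = 2 * Q (X m) + 2 * Q (X n) - 4 * Q (lc (1/2) (X m) (1/2) (X n))"
        unfolding Q_def by (simp add: ip_lc_lc X F_lc field_simps power2_eq_square)
      moreover have "I \<le> Q (lc (1/2) (X m) (1/2) (X n))" by (intro I_le lc_in X)
      moreover have "1 / real (Suc m) \<le> 1 / real (Suc N)" "1 / real (Suc n) \<le> 1 / real (Suc N)"
        using that by (auto intro!: divide_left_mono)
      ultimately show ?thesis using QX[of m] QX[of n] N by linarith
    qed
    then show "\<exists>N. \<forall>m\<ge>N. \<forall>n\<ge>N. dist_sq (X m) (X n) < e" by blast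
  qed
  then obtain f where f: "f \<in> H" and lim: "(\<lambda>n. dist_sq (X n) f) \<longlonglongrightarrow> 0"
    by blast
  have "F g = ip f g" if g: "g \<in> H" for g
  proof -
    define D where "D = ip g f - F g"
    \<comment> \<open>First variation along the minimizing sequence:
      \<open>Q (X n + t g) - Q (X n)\<close> is at least \<open>- 1 / real (Suc n)\<close>, and only
      its part linear in \<open>t\<close> depends on \<open>n\<close>.\<close>
    have *: "0 \<le> t\<^sup>2 * ip g g + 2 * t * D" for t
    proof (rule LIMSEQ_le_const)
      show "(\<lambda>n. 1 / real (Suc n) + (t\<^sup>2 * ip g g + 2 * t * (ip g (X n) - F g)))
          \<longlonglongrightarrow> t\<^sup>2 * ip g g + 2 * t * D"
        using tendsto_add[OF LIMSEQ_Suc[OF lim_1_over_n]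
            tendsto_add[OF tendsto_const[of "t\<^sup>2 * ip g g"] tendsto_mult[OF tendsto_const[of "2*t"]
            tendsto_diff[OF functional_tendsto[OF functional_ip[OF g] X f lim] tendsto_const[of "F g"]]]]]
        unfolding D_def by simp
      have "0 \<le> 1 / real (Suc n) + (t\<^sup>2 * ip g g + 2 * t * (ip g (X n) - F g))" for n
      proof -
        have "Q (lc 1 (X n) t g) = Q (X n) + (t\<^sup>2 * ip g g + 2 * t * (ip g (X n) - F g))"
          unfolding Q_def by (simp add: ip_lc_lc F_lc X g ip_sym[OF g X] algebra_simps)
        then show ?thesis using I_le[OF lc_in[OF X g, of 1 n t]] QX[of n] by linarith
      qed
      then show "\<exists>N. \<forall>n\<ge>N. 0 \<le> 1 / real (Suc n) + (t\<^sup>2 * ip g g + 2 * t * (ip g (X n) - F g))"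
        by blast
    qed
    have q: "0 \<le> ip g g" using ip_nonneg[OF g] .
    \<comment> \<open>Almost the minimizing \<open>t\<close>; the \<open>1\<close> in the
      denominator covers a null vector \<open>g\<close>, for which the value is negative as well
      unless \<open>D = 0\<close>.\<close>
    have "0 \<le> (- D / (ip g g + 1))\<^sup>2 * ip g g + 2 * (- D / (ip g g + 1)) * D" by (rule *)
    also have "\<dots> = - (D\<^sup>2 * (ip g g + 2)) / (ip g g + 1)\<^sup>2"
      using q by (simp add: field_simps power2_eq_square add_nonneg_eq_0_iff)
    finally have "D\<^sup>2 * (ip g g + 2) \<le> 0" using q by (simp add: divide_le_0_iff)
    then have "D = 0" using q by (simp add: mult_le_0_iff)
    then show ?thesis using ip_sym[OF f g] by (simp add: D_def)
  qed
  then show ?thesis using f by blast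
qed

text \<open>\<open>H\<close> may be nonseparable. A diagonal subsequence is made to converge only
  against each member \<open>X m\<close> of the sequence; the set \<open>G\<close> of all vectors
  against which it converges is a closed subspace, and Riesz inside \<open>G\<close> extends the
  convergence to every vector of \<open>H\<close>. The limits form a bounded functional, whose
  representer is the weak limit.\<close>

lemma weakly_compact:
  assumes X: "\<And>n. X n \<in> H" and B: "\<And>n. ip (X n) (X n) \<le> B"
  shows "\<exists>f\<in>H. \<exists>r. strict_mono (r::nat\<Rightarrow>nat) \<and> (\<forall>F. functional F \<longrightarrow> (\<lambda>n. F (X (r n))) \<longlonglongrightarrow> F f)"
proof -
  have bnd: "\<bar>ip z (X n)\<bar> \<le> sqrt (ip z z * B)" if "z \<in> H" for z n
  proof -
    have "(ip z (X n))\<^sup>2 \<le> ip z z * B"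
      using Cauchy_Schwarz[OF that X[of n]] mult_left_mono[OF B[of n] ip_nonneg[OF that]] by linarith
    then show ?thesis using real_le_rsqrt by fastforce
  qed
  have "\<exists>r. strict_mono (r::nat\<Rightarrow>nat) \<and> (\<forall>m. convergent (\<lambda>n. ip (X m) (X (r n))))"
  proof -
    interpret subseqs "\<lambda>m (s::nat\<Rightarrow>nat). convergent (\<lambda>n. ip (X m) (X (s n)))"
    proof
      fix m and s :: "nat \<Rightarrow> nat" assume "strict_mono s"
      have "bounded (range (\<lambda>n. ip (X m) (X (s n))))"
        unfolding bounded_iff using bnd[OF X] by auto
      then obtain l r where "strict_mono (r::nat\<Rightarrow>nat)" "((\<lambda>n. ip (X m) (X (s n))) \<circ> r) \<longlonglongrightarrow> l"
        using bounded_imp_convergent_subsequence by blast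
      then show "\<exists>r. strict_mono r \<and> convergent (\<lambda>n. ip (X m) (X ((s \<circ> r) n)))"
        by (auto simp: convergent_def o_def)
    qed
    have "convergent (\<lambda>n. ip (X m) (X (diagseq n)))" for m
    proof -
      have "convergent (\<lambda>n. ip (X m) (X ((diagseq \<circ> (+) (Suc m)) n)))"
        by (rule diagseq_holds) (auto simp: convergent_def o_def intro: LIMSEQ_subseq_LIMSEQ[unfolded o_def])
      then show ?thesis
        using convergent_ignore_initial_segment[of "\<lambda>n. ip (X m) (X (diagseq n))" "Suc m"]
        by (simp add: o_def add.commute)
    qed
    then show ?thesis using subseq_diagseq by blast
  qed
  then obtain r where r: "strict_mono (r::nat\<Rightarrow>nat)" and conv: "\<And>m. convergent (\<lambda>n. ip (X m) (X (r n)))"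
    by blast
  define G where "G = {g\<in>H. convergent (\<lambda>n. ip g (X (r n)))}"
  have GH: "g \<in> H" if "g \<in> G" for g using that G_def by simp
  have XG: "X m \<in> G" for m using X conv unfolding G_def by simp
  have G_lc: "lc a x b y \<in> G" if "x \<in> G" "y \<in> G" for a x b y
    using that X unfolding G_def
    by (auto simp: ip_lc lc_in intro!: convergent_add convergent_mult convergent_const)
  interpret G: semi_hilbert G lc ip
  proof
    show "G \<noteq> {}" using XG by blast
    fix Y assume Y: "\<And>n::nat. Y n \<in> G" and "\<And>e. 0 < e \<Longrightarrow>
      \<exists>N. \<forall>m\<ge>N. \<forall>n\<ge>N. dist_sq (Y m) (Y n) < e"
    then obtain g where g: "g \<in> H" and lim: "(\<lambda>n. dist_sq (Y n) g) \<longlonglongrightarrow> 0"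
      using complete[of Y] GH by blast
    have "Cauchy (\<lambda>n. ip g (X (r n)))"
    proof (rule metric_CauchyI)
      fix e :: real assume e: "0 < e"
      have "(\<lambda>n. sqrt (dist_sq (Y n) g * B)) \<longlonglongrightarrow> sqrt (0 * B)"
        by (intro tendsto_intros lim)
      then have "\<forall>\<^sub>F n in sequentially. sqrt (dist_sq (Y n) g * B) < e / 4"
        using e by (intro order_tendstoD(2)) auto
      then obtain k where k: "sqrt (dist_sq (Y k) g * B) < e / 4"
        using eventually_happens by force
      have Yk: "Y k \<in> H" using Y GH by blast
      \<comment> \<open>Uniform in \<open>n\<close> because the sequence is bounded; so the Cauchy
        property passes from \<open>Y k\<close> to the nearby \<open>g\<close>.\<close>
      have close: "\<bar>ip (Y k) (X n) - ip g (X n)\<bar> < e / 4" for n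
        using bnd[OF lc_in[OF Yk g, of 1 "-1"], of n] k by (simp add: ip_lc Yk g X)
      have "Cauchy (\<lambda>n. ip (Y k) (X (r n)))"
        using Y unfolding G_def by (simp add: convergent_Cauchy)
      then obtain N where N: "\<And>m n. m \<ge> N \<Longrightarrow> n \<ge> N \<Longrightarrow> dist (ip (Y k) (X (r m))) (ip (Y k) (X (r n))) < e / 2"
        using e unfolding Cauchy_def by (meson half_gt_zero)
      have "dist (ip g (X (r m))) (ip g (X (r n))) < e" if "m \<ge> N" "n \<ge> N" for m n
        using N[OF that] close[of "r m"] close[of "r n"] unfolding dist_real_def by linarith
      then show "\<exists>N. \<forall>m\<ge>N. \<forall>n\<ge>N. dist (ip g (X (r m))) (ip g (X (r n))) < e" by blast
    qed
    then have "g \<in> G" using g by (simp add: G_def Cauchy_convergent_iff)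
    then show "\<exists>g\<in>G. (\<lambda>n. dist_sq (Y n) g) \<longlonglongrightarrow> 0" using lim by blast
  qed (auto simp: G_lc GH ip_lc ip_nonneg intro: ip_sym)
  have all: "convergent (\<lambda>n. ip h (X (r n)))" if h: "h \<in> H" for h
  proof -
    \<comment> \<open>On \<open>G\<close>, which contains the whole sequence, \<open>ip h\<close>
      agrees with \<open>ip p\<close> for some \<open>p\<close> in \<open>G\<close>; this
      \<open>p\<close> stands in for the orthogonal projection of \<open>h\<close>.\<close>
    have "G.functional (ip h)"
      using functional_ip[OF h] GH unfolding functional_def G.functional_def by blast
    then obtain p where "p \<in> G" "\<forall>g\<in>G. ip h g = ip p g" using G.Riesz by blast
    then show ?thesis using XG by (simp add: G_def)
  qed
  define l where "l h = lim (\<lambda>n. ip h (X (r n)))" for h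
  have l: "(\<lambda>n. ip h (X (r n))) \<longlonglongrightarrow> l h" if "h \<in> H" for h
    unfolding l_def using all[OF that] by (simp add: convergent_LIMSEQ_iff)
  have "functional l"
    unfolding functional_def
  proof (intro conjI allI ballI)
    fix a b x y assume "x \<in> H" "y \<in> H"
    then have "(\<lambda>n. ip (lc a x b y) (X (r n))) \<longlonglongrightarrow> a * l x + b * l y"
      using X by (auto simp: ip_lc intro!: tendsto_intros l)
    then show "l (lc a x b y) = a * l x + b * l y"
      using l[OF lc_in] \<open>x \<in> H\<close> \<open>y \<in> H\<close> LIMSEQ_unique by blast
  next
    have "(l h)\<^sup>2 \<le> B * ip h h" if h: "h \<in> H" for h
    proof (rule LIMSEQ_le_const2)
      show "(\<lambda>n. (ip h (X (r n)))\<^sup>2) \<longlonglongrightarrow> (l h)\<^sup>2" by (intro tendsto_intros l h)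
      show "\<exists>N. \<forall>n\<ge>N. (ip h (X (r n)))\<^sup>2 \<le> B * ip h h"
        using Cauchy_Schwarz[OF h X] mult_left_mono[OF B ip_nonneg[OF h]]
        by (metis mult.commute order_trans)
    qed
    moreover have "0 \<le> B" using B[of 0] ip_nonneg[OF X[of 0]] by simp
    ultimately show "\<exists>K\<ge>0. \<forall>x\<in>H. (l x)\<^sup>2 \<le> K * ip x x" by blast
  qed
  then obtain f where f: "f \<in> H" and lf: "\<forall>g\<in>H. l g = ip f g" using Riesz by blast
  have "(\<lambda>n. F (X (r n))) \<longlonglongrightarrow> F f" if "functional F" for F
  proof -
    obtain z where z: "z \<in> H" "\<forall>g\<in>H. F g = ip z g" using Riesz[OF \<open>functional F\<close>] by blast
    then show ?thesis using l[OF z(1)] lf f X ip_sym by simp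
  qed
  then show ?thesis using f r by blast
qed

text \<open>Nonnegativity of the squared distance gives
  \<open>2 * ip f (X n) - ip f f \<le> ip (X n) (X n)\<close>. The squared norms are assumed to
  converge because the subsequence is later chosen that way.\<close>

lemma weak_lsc:
  assumes X: "\<And>n. X n \<in> H" and f: "f \<in> H" and lim: "(\<lambda>n::nat. ip f (X n)) \<longlonglongrightarrow> ip f f"
    and b: "(\<lambda>n. ip (X n) (X n)) \<longlonglongrightarrow> b"
  shows "ip f f \<le> b"
proof (rule LIMSEQ_le)
  show "(\<lambda>n. 2 * ip f (X n) - ip f f) \<longlonglongrightarrow> ip f f"
    using tendsto_diff[OF tendsto_mult_left[OF lim, of 2] tendsto_const[of "ip f f"]] by simp
  have "2 * ip f (X n) - ip f f \<le> ip (X n) (X n)" for n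
    using ip_nonneg[OF lc_in[OF f X, of 1 "-1" n]] ip_lc_lc[OF f X, of 1 "-1" n] by simp
  then show "\<exists>N. \<forall>n\<ge>N. 2 * ip f (X n) - ip f f \<le> ip (X n) (X n)" by blast
qed fact

end

lemma semi_hilbert_UNIV:
  "semi_hilbert (UNIV :: 'a::{real_inner,complete_space} set) (\<lambda>a x b y. a *\<^sub>R x + b *\<^sub>R y) inner"
proof
  fix X :: "nat \<Rightarrow> 'a"
  assume *: "\<And>e. 0 < e \<Longrightarrow> \<exists>N. \<forall>m\<ge>N. \<forall>n\<ge>N.
    inner (1 *\<^sub>R X m + (-1) *\<^sub>R X n) (1 *\<^sub>R X m + (-1) *\<^sub>R X n) < e"
  have "Cauchy X"
  proof (rule metric_CauchyI)
    fix e :: real assume "0 < e"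
    then obtain N where "\<forall>m\<ge>N. \<forall>n\<ge>N. (norm (X m - X n))\<^sup>2 < e\<^sup>2"
      using *[of "e\<^sup>2"] by (auto simp: power2_norm_eq_inner)
    then show "\<exists>N. \<forall>m\<ge>N. \<forall>n\<ge>N. dist (X m) (X n) < e"
      using \<open>0 < e\<close> unfolding dist_norm by (meson less_imp_le power2_less_imp_less)
  qed
  then obtain x where "X \<longlonglongrightarrow> x" by (auto simp: Cauchy_convergent_iff convergent_def)
  then have "(\<lambda>n. (norm (X n - x))\<^sup>2) \<longlonglongrightarrow> 0"
    using tendsto_power[OF tendsto_norm_zero[OF LIM_zero], of X x sequentially 2] by simp
  then show "\<exists>x\<in>UNIV. (\<lambda>n. inner (1 *\<^sub>R X n + (-1) *\<^sub>R x) (1 *\<^sub>R X n + (-1) *\<^sub>R x)) \<longlonglongrightarrow> 0"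
    by (auto simp: power2_norm_eq_inner)
qed (auto simp: inner_left_distrib intro: inner_commute)

section \<open>Square integrable functions with values in a separable space\<close>

abbreviation L2_sq :: "'a measure \<Rightarrow> ('a \<Rightarrow> 'b::real_normed_vector) \<Rightarrow> real" where
  "L2_sq M f \<equiv> \<integral>x. (norm (f x))\<^sup>2 \<partial>M"

text \<open>The type of values need not be second countable; separability is a hypothesis.
  Countably valued approximations of \<open>f\<close> reduce the claim to the separate measurability in \<open>g\<close>.\<close>

lemma borel_measurable_Caratheodory:
  fixes f :: "'m \<Rightarrow> 'a::metric_space" and g :: "'m \<Rightarrow> 'b::topological_space"
    and h :: "'a \<Rightarrow> 'b \<Rightarrow> 'c::metric_space"
  assumes D: "countable D" "closure D = (UNIV :: 'a set)"
    and f: "f \<in> borel_measurable M" and g: "g \<in> borel_measurable M"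
    and h1: "\<And>y. continuous_on UNIV (\<lambda>x. h x y)" and h2: "\<And>x. continuous_on UNIV (h x)"
  shows "(\<lambda>z. h (f z) (g z)) \<in> borel_measurable M"
proof -
  have "D \<noteq> {}" using D(2) by auto
  define d where "d = from_nat_into D"
  have ex: "\<exists>k. dist (d k) y < 1 / real (Suc n)" for y n
  proof -
    have "y \<in> closure D" using D(2) by simp
    then obtain q where q: "q \<in> D" "dist q y < 1 / real (Suc n)"
      unfolding closure_approachable by (meson of_nat_0_less_iff zero_less_Suc zero_less_divide_1_iff)
    then show ?thesis using from_nat_into_surj[OF D(1) q(1)] unfolding d_def by auto
  qed
  define N where "N n z = (LEAST k. dist (d k) (f z) < 1 / real (Suc n))" for n z
  have N: "dist (d (N n z)) (f z) < 1 / real (Suc n)" for n z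
    unfolding N_def by (rule LeastI_ex[OF ex])
  have Nm: "N n \<in> measurable M (count_space UNIV)" for n
    unfolding N_def
  proof (rule measurable_Least)
    fix k
    have "(\<lambda>z. dist (d k) (f z)) \<in> borel_measurable M"
      by (rule borel_measurable_continuous_on[OF _ f, where f="dist (d k)"]) (intro continuous_intros)
    then show "Measurable.pred M (\<lambda>z. dist (d k) (f z) < 1 / real (Suc n))" by measurable
  qed
  show ?thesis
  proof (rule borel_measurable_LIMSEQ_metric)
    show "(\<lambda>z. h (d (N n z)) (g z)) \<in> borel_measurable M" for n
      by (rule measurable_compose_countable[OF _ Nm]) (rule borel_measurable_continuous_on[OF h2 g])
    fix z
    have "(\<lambda>n. dist (d (N n z)) (f z)) \<longlonglongrightarrow> 0"
      by (rule tendsto_sandwich[OF _ _ tendsto_const LIMSEQ_Suc[OF lim_1_over_n]])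
        (simp_all add: less_imp_le[OF N] del: of_nat_Suc)
    then have "(\<lambda>n. d (N n z)) \<longlonglongrightarrow> f z" by (rule tendsto_dist_iff[THEN iffD2])
    then show "(\<lambda>n. h (d (N n z)) (g z)) \<longlonglongrightarrow> h (f z) (g z)"
      by (rule continuous_on_tendsto_compose[OF h1]) simp_all
  qed
qed

text \<open>Cauchy-Schwarz against the constant \<open>1\<close>, from the nonnegative integral of
  \<open>(m * f x - a)\<^sup>2\<close> with \<open>m\<close> the total mass and \<open>a\<close> the
  integral of \<open>f\<close>. This yields \<open>m\<close> times the claim, so mass zero is
  treated apart.\<close>

lemma (in finite_measure) square_integral_le:
  fixes f :: "'a \<Rightarrow> real"
  assumes f: "f \<in> borel_measurable M" and f2: "integrable M (\<lambda>x. (f x)\<^sup>2)"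
  shows "integrable M f" "(\<integral>x. f x \<partial>M)\<^sup>2 \<le> measure M (space M) * (\<integral>x. (f x)\<^sup>2 \<partial>M)"
proof -
  show i: "integrable M f"
  proof (rule Bochner_Integration.integrable_bound[OF _ f])
    show "integrable M (\<lambda>x. 1 + (f x)\<^sup>2)" using f2 by simp
    show "AE x in M. norm (f x) \<le> norm (1 + (f x)\<^sup>2)"
    proof (rule AE_I2)
      fix x
      have "0 \<le> (\<bar>f x\<bar> - 1)\<^sup>2" by simp
      then have "2 * \<bar>f x\<bar> \<le> 1 + (f x)\<^sup>2" by (simp add: power2_eq_square algebra_simps)
      then have "\<bar>f x\<bar> \<le> 1 + (f x)\<^sup>2" by (smt (verit) zero_le_power2)
      then show "norm (f x) \<le> norm (1 + (f x)\<^sup>2)" by simp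
    qed
  qed
  define m where "m = measure M (space M)"
  define a where "a = (\<integral>x. f x \<partial>M)"
  have "0 \<le> (\<integral>x. (m * f x - a)\<^sup>2 \<partial>M)" by simp
  also have "\<dots> = (\<integral>x. m\<^sup>2 * (f x)\<^sup>2 - 2 * m * a * f x + a\<^sup>2 \<partial>M)"
    by (simp add: power2_eq_square algebra_simps)
  also have "\<dots> = m\<^sup>2 * (\<integral>x. (f x)\<^sup>2 \<partial>M) - 2 * m * a * a + m * a\<^sup>2"
    using i f2 by (simp add: a_def m_def)
  finally have "0 \<le> m * (m * (\<integral>x. (f x)\<^sup>2 \<partial>M) - a\<^sup>2)" by (simp add: power2_eq_square algebra_simps)
  moreover have "a = 0" if "m = 0"
  proof -
    have "AE x in M. f x = 0"
      using that by (intro AE_I[of _ _ "space M"]) (auto simp: m_def emeasure_eq_measure)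
    then show ?thesis unfolding a_def using integral_eq_zero_AE by blast
  qed
  moreover have "0 \<le> m" by (simp add: m_def)
  ultimately show "(\<integral>x. f x \<partial>M)\<^sup>2 \<le> measure M (space M) * (\<integral>x. (f x)\<^sup>2 \<partial>M)"
    unfolding a_def[symmetric] m_def[symmetric] by (cases "m = 0") (auto simp: zero_le_mult_iff)
qed

section \<open>Inner products, linear combinations and completeness in L2\<close>

lemma inner_le_sum_squares: "\<bar>inner x y\<bar> \<le> (norm x)\<^sup>2 + (norm (y::'a::real_inner))\<^sup>2"
proof -
  have "\<bar>inner x y\<bar> \<le> norm x * norm y" by (rule Cauchy_Schwarz_ineq2)
  moreover have "0 \<le> (norm x - norm y)\<^sup>2" "0 \<le> (norm x)\<^sup>2" "0 \<le> (norm y)\<^sup>2" by simp_all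
  ultimately show ?thesis unfolding power2_diff by linarith
qed

lemma norm_sum_squares: "(norm (x + y))\<^sup>2 \<le> 2 * (norm x)\<^sup>2 + 2 * (norm (y::'a::real_inner))\<^sup>2"
proof -
  have "0 \<le> (norm (x - y))\<^sup>2" by simp
  then show ?thesis by (simp add: power2_norm_eq_inner inner_simps inner_commute)
qed

lemma L2_D: "L2 M f \<Longrightarrow> f \<in> borel_measurable M"
  by (simp add: L2_def)

lemma convergent_if_summable_norm:
  fixes y :: "nat \<Rightarrow> 'a::{real_normed_vector,complete_space}"
  assumes "summable (\<lambda>k. norm (y (Suc k) - y k))"
  shows "convergent y"
proof -
  have le: "norm (y (m + j) - y m) \<le> (\<Sum>k=m..<m+j. norm (y (Suc k) - y k))" for m j
  proof (induction j)
    case (Suc j)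
    have "norm (y (m + Suc j) - y m) \<le> norm (y (Suc (m + j)) - y (m + j)) + norm (y (m + j) - y m)"
      using norm_triangle_ineq[of "y (Suc (m + j)) - y (m + j)" "y (m + j) - y m"] by simp
    then show ?case using Suc by simp
  qed simp
  have "Cauchy y"
    unfolding Cauchy_altdef2
  proof (intro allI impI)
    fix e :: real assume "0 < e"
    then obtain N where N: "\<And>m n. m \<ge> N \<Longrightarrow> norm (\<Sum>k=m..<n. norm (y (Suc k) - y k)) < e"
      using assms unfolding summable_Cauchy by blast
    have "dist (y n) (y N) < e" if "n \<ge> N" for n
      using le[of N "n - N"] N[of N n] that by (auto simp: dist_norm)
    then show "\<exists>N. \<forall>n\<ge>N. dist (y n) (y N) < e" by blast
  qed
  then show ?thesis by (simp add: Cauchy_convergent_iff)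
qed

context finite_measure begin

context
  fixes D :: "'b::{real_inner,complete_space} set"
  assumes D: "countable D" "closure D = (UNIV :: 'b set)"
begin

text \<open>Measurability is where \<open>D\<close> enters: without separability, the Borel sets of
  the product of \<open>'b\<close> with itself may not be generated by rectangles.\<close>

lemma L2_inner_integrable:
  assumes "L2 M f" "L2 M (g :: 'a \<Rightarrow> 'b)"
  shows "integrable M (\<lambda>x. inner (f x) (g x))"
proof (rule Bochner_Integration.integrable_bound)
  show "integrable M (\<lambda>x. (norm (f x))\<^sup>2 + (norm (g x))\<^sup>2)" using assms by (simp add: L2_def)
  show "(\<lambda>x. inner (f x) (g x)) \<in> borel_measurable M"
    by (rule borel_measurable_Caratheodory[OF D L2_D[OF assms(1)] L2_D[OF assms(2)], where h="inner"])
      (intro continuous_intros)+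
  show "AE x in M. norm (inner (f x) (g x)) \<le> norm ((norm (f x))\<^sup>2 + (norm (g x))\<^sup>2)"
    using inner_le_sum_squares by (intro AE_I2) auto
qed

lemma L2_lincomb:
  assumes "L2 M f" "L2 M (g :: 'a \<Rightarrow> 'b)"
  shows "L2 M (\<lambda>x. a *\<^sub>R f x + b *\<^sub>R g x)"
  unfolding L2_def
proof
  show m: "(\<lambda>x. a *\<^sub>R f x + b *\<^sub>R g x) \<in> borel_measurable M"
    by (rule borel_measurable_Caratheodory[OF D L2_D[OF assms(1)] L2_D[OF assms(2)], where h="\<lambda>x y. a *\<^sub>R x + b *\<^sub>R y"])
      (intro continuous_intros)+
  show "integrable M (\<lambda>x. (norm (a *\<^sub>R f x + b *\<^sub>R g x))\<^sup>2)"
  proof (rule Bochner_Integration.integrable_bound)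
    show "integrable M (\<lambda>x. 2 * a\<^sup>2 * (norm (f x))\<^sup>2 + 2 * b\<^sup>2 * (norm (g x))\<^sup>2)"
      using assms by (simp add: L2_def)
    show "(\<lambda>x. (norm (a *\<^sub>R f x + b *\<^sub>R g x))\<^sup>2) \<in> borel_measurable M"
      by (rule borel_measurable_continuous_on[OF _ m]) (intro continuous_intros)
    show "AE x in M. norm ((norm (a *\<^sub>R f x + b *\<^sub>R g x))\<^sup>2)
        \<le> norm (2 * a\<^sup>2 * (norm (f x))\<^sup>2 + 2 * b\<^sup>2 * (norm (g x))\<^sup>2)"
      using norm_sum_squares[of "a *\<^sub>R f x" "b *\<^sub>R g x" for x]
      by (intro AE_I2) (simp add: power_mult_distrib mult_ac)
  qed
qed

text \<open>Riesz-Fischer. Along a subsequence the squared distances of neighbours fall below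
  \<open>(1/4)^k\<close>; on a finite measure the integrals of their norms are then summable, and
  the subsequence converges almost everywhere. Fatou's lemma transfers the Cauchy rate of the whole
  sequence to the limit.\<close>

lemma L2_complete:
  assumes X: "\<And>n::nat. L2 M (X n :: 'a \<Rightarrow> 'b)"
    and cau: "\<And>e. 0 < e \<Longrightarrow> \<exists>N. \<forall>m\<ge>N. \<forall>n\<ge>N. (\<integral>x. (norm (X m x - X n x))\<^sup>2 \<partial>M) < e"
  shows "\<exists>f. L2 M f \<and> (\<lambda>n. \<integral>x. (norm (X n x - f x))\<^sup>2 \<partial>M) \<longlonglongrightarrow> 0"
proof -
  have dL: "L2 M (\<lambda>x. X m x - X n x)" for m n using L2_lincomb[OF X[of m] X[of n], of 1 "-1"] by simp
  have dm: "(\<lambda>x. norm (X m x - X n x)) \<in> borel_measurable M" for m n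
    by (rule borel_measurable_continuous_on[OF _ L2_D[OF dL]]) (intro continuous_intros)
  have d2: "integrable M (\<lambda>x. (norm (X m x - X n x))\<^sup>2)" for m n using dL[of m n] by (simp add: L2_def)
  define c where "c = measure M (space M)"
  have c: "0 \<le> c" by (simp add: c_def)
  have "\<exists>N. \<forall>m\<ge>N. \<forall>n\<ge>N. (\<integral>x. (norm (X m x - X n x))\<^sup>2 \<partial>M) < (1/4)^k" for k :: nat
    by (rule cau) simp
  then obtain N where N: "\<And>k m n. m \<ge> N k \<Longrightarrow> n \<ge> N k \<Longrightarrow>
      (\<integral>x. (norm (X m x - X n x))\<^sup>2 \<partial>M) < (1/4)^(k::nat)" by metis
  \<comment> \<open>Partial sums dominate every \<open>N i\<close> with \<open>i \<le> k\<close>, so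
    the thresholds \<open>N\<close> may be chosen without monotonicity.\<close>
  define r where "r k = (\<Sum>i\<le>k. N i)" for k
  have rN: "N k \<le> r k" "N k \<le> r (Suc k)" for k unfolding r_def by (auto intro!: member_le_sum trans_le_add1)
  define Y where "Y k = X (r k)" for k
  let ?s = "\<lambda>k x. norm (Y (Suc k) x - Y k x)"
  have step: "(\<integral>x. ?s k x \<partial>M) \<le> sqrt c * (1/2)^k" for k
  proof -
    have "(\<integral>x. ?s k x \<partial>M)\<^sup>2 \<le> c * (\<integral>x. (?s k x)\<^sup>2 \<partial>M)"
      unfolding c_def Y_def by (rule square_integral_le(2)[OF dm]) (simp add: d2)
    also have "\<dots> \<le> c * (1/4)^k"
      unfolding Y_def by (rule mult_left_mono[OF less_imp_le[OF N[OF rN(2) rN(1)]] c])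
    also have "\<dots> = (sqrt c * (1/2)^k)\<^sup>2"
      using c by (simp add: power_mult_distrib) (simp add: power2_eq_square flip: power_mult_distrib)
    finally show ?thesis by (rule power2_le_imp_le) (use c in simp)
  qed
  have Yint: "integrable M (\<lambda>x. ?s k x)" for k
    unfolding Y_def by (rule square_integral_le(1)[OF dm]) (simp add: d2)
  have "AE x in M. summable (\<lambda>k. ?s k x)"
  proof -
    have "(\<integral>\<^sup>+x. (\<Sum>k. ennreal (?s k x)) \<partial>M)
        = (\<Sum>k. \<integral>\<^sup>+x. ennreal (?s k x) \<partial>M)"
      unfolding Y_def by (intro nn_integral_suminf measurable_compose[OF dm]) simp
    also have "\<dots> = (\<Sum>k. ennreal (\<integral>x. ?s k x \<partial>M))"
      by (intro suminf_cong nn_integral_eq_integral Yint) simp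
    also have "\<dots> \<le> (\<Sum>k. ennreal (sqrt c * (1/2)^k))"
      by (intro suminf_le ennreal_leI step) auto
    also have "\<dots> = ennreal (\<Sum>k. sqrt c * (1/2)^k)"
      using c by (intro suminf_ennreal2 summable_mult summable_geometric) auto
    also have "\<dots> < \<infinity>" by simp
    finally have "AE x in M. (\<Sum>k. ennreal (?s k x)) \<noteq> \<infinity>"
      unfolding Y_def using dm by (intro nn_integral_PInf_AE) (auto intro!: borel_measurable_suminf_order measurable_compose[OF dm])
    then show ?thesis
      by eventually_elim (auto intro!: summable_suminf_not_top)
  qed
  then have AEY: "AE x in M. convergent (\<lambda>k. Y k x)"
    by eventually_elim (rule convergent_if_summable_norm)
  \<comment> \<open>\<open>M\<close> may be incomplete, so the exceptional set is enlarged to a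
    measurable null set before the limit is replaced by \<open>0\<close> there; this makes
    \<open>f\<close> Borel.\<close>
  then obtain Z where Z: "Z \<in> null_sets M" "{x\<in>space M. \<not> convergent (\<lambda>k. Y k x)} \<subseteq> Z"
    by (auto elim!: AE_E3 simp: eventually_ae_filter)
  define f where "f x = (if x \<in> Z then 0 else lim (\<lambda>k. Y k x))" for x
  have Zs: "Z \<in> sets M" using Z(1) by auto
  have Ym: "Y k \<in> borel_measurable M" for k using X by (simp add: Y_def L2_def)
  have fm: "f \<in> borel_measurable M"
  proof (rule borel_measurable_LIMSEQ_metric)
    show "(\<lambda>x. if x \<in> Z then 0 else Y k x) \<in> borel_measurable M" for k
      by (rule measurable_If_set) (use Zs Ym in auto)
    show "(\<lambda>k. if x \<in> Z then 0 else Y k x) \<longlonglongrightarrow> f x" if "x \<in> space M" for x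
      using Z(2) that by (auto simp: f_def convergent_LIMSEQ_iff)
  qed
  have AElim: "AE x in M. (\<lambda>k. Y k x) \<longlonglongrightarrow> f x"
  proof (rule AE_I'[OF Z(1)])
    show "{x\<in>space M. \<not> (\<lambda>k. Y k x) \<longlonglongrightarrow> f x} \<subseteq> Z"
      using Z(2) by (auto simp: f_def convergent_LIMSEQ_iff)
  qed
  have Xf: "(\<lambda>x. X n x - f x) \<in> borel_measurable M" for n
      by (rule borel_measurable_Caratheodory[OF D L2_D[OF X] fm, where h="\<lambda>x y. x - y"]) (intro continuous_intros)+
  have fin: "(\<lambda>x. (norm (X n x - f x))\<^sup>2) \<in> borel_measurable M" for n
    by (rule borel_measurable_continuous_on[OF _ Xf]) (intro continuous_intros)
  let ?e = "\<lambda>n. \<integral>x. (norm (X n x - f x))\<^sup>2 \<partial>M" and ?q = "\<lambda>n. \<integral>\<^sup>+x. ennreal ((norm (X n x - f x))\<^sup>2) \<partial>M"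
    and ?p = "\<lambda>n j. \<integral>\<^sup>+x. ennreal ((norm (X n x - Y j x))\<^sup>2) \<partial>M"
  have close: "integrable M (\<lambda>x. (norm (X n x - f x))\<^sup>2) \<and> ?e n \<le> (1/4)^k"
    if n: "n \<ge> N k" for n k
  proof -
    have "?q n
        \<le> (\<integral>\<^sup>+x. liminf (\<lambda>j. ennreal ((norm (X n x - Y j x))\<^sup>2)) \<partial>M)"
    proof (rule nn_integral_mono_AE, use AElim in eventually_elim)
      fix x assume "(\<lambda>k. Y k x) \<longlonglongrightarrow> f x"
      then have "(\<lambda>j. ennreal ((norm (X n x - Y j x))\<^sup>2)) \<longlonglongrightarrow> ennreal ((norm (X n x - f x))\<^sup>2)"
        by (intro tendsto_intros) auto
      then show "ennreal ((norm (X n x - f x))\<^sup>2) \<le> liminf (\<lambda>j. ennreal ((norm (X n x - Y j x))\<^sup>2))"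
        using lim_imp_Liminf[OF sequentially_bot] by fastforce
    qed
    also have "\<dots> \<le> liminf (\<lambda>j. ?p n j)"
      unfolding Y_def using d2 by (intro nn_integral_liminf) auto
    also have "\<dots> \<le> ennreal ((1/4)^k)"
    proof (rule Liminf_le)
      show "\<forall>\<^sub>F j in sequentially. ?p n j \<le> ennreal ((1/4)^k)"
      proof (rule eventually_sequentiallyI)
        fix j assume "k \<le> j"
        then have "N k \<le> r j" unfolding r_def by (intro member_le_sum) auto
        then show "?p n j \<le> ennreal ((1/4)^k)"
          unfolding Y_def using N[OF n] by (subst nn_integral_eq_integral[OF d2]) (auto intro!: ennreal_leI less_imp_le)
      qed
    qed simp
    finally have le: "?q n \<le> ennreal ((1/4)^k)" .
    have "integrable M (\<lambda>x. (norm (X n x - f x))\<^sup>2)"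
      using fin le by (intro integrableI_bounded) (auto intro: le_less_trans)
    moreover from nn_integral_eq_integral[OF this] le have "?e n \<le> (1/4)^k"
      by simp
    ultimately show ?thesis by simp
  qed
  have "L2 M f"
    unfolding L2_def
  proof
    have "L2 M (\<lambda>x. X (N 0) x - f x)"
      unfolding L2_def using close[of 0 "N 0"] Xf by simp
    from L2_lincomb[OF X[of "N 0"] this, of 1 "-1"] have "L2 M f" by simp
    then show "integrable M (\<lambda>x. (norm (f x))\<^sup>2)" by (simp add: L2_def)
  qed fact
  moreover have "(\<lambda>n. ?e n) \<longlonglongrightarrow> 0"
  proof (rule LIMSEQ_I)
    fix e :: real assume "0 < e"
    then obtain k where "(1/4::real)^k < e" using real_arch_pow_inv[of e "1/4"] by auto
    then show "\<exists>n0. \<forall>n\<ge>n0. norm (?e n - 0) < e"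
      using close[of k] by (intro exI[of _ "N k"]) fastforce
  qed
  ultimately show ?thesis by blast
qed

lemma semi_hilbert_L2:
  "semi_hilbert {f :: 'a \<Rightarrow> 'b. L2 M f} (\<lambda>a f b g x. a *\<^sub>R f x + b *\<^sub>R g x) (\<lambda>f g. \<integral>x. inner (f x) (g x) \<partial>M)"
proof
  show "{f :: 'a \<Rightarrow> 'b. L2 M f} \<noteq> {}" by (auto simp: L2_def intro!: exI[of _ "\<lambda>_. 0"])
next
  fix X :: "nat \<Rightarrow> 'a \<Rightarrow> 'b"
  assume "\<And>n. X n \<in> {f. L2 M f}" and "\<And>e. 0 < e \<Longrightarrow> \<exists>N. \<forall>m\<ge>N. \<forall>n\<ge>N.
      (\<integral>x. inner (1 *\<^sub>R X m x + (-1) *\<^sub>R X n x) (1 *\<^sub>R X m x + (-1) *\<^sub>R X n x) \<partial>M) < e"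
  then show "\<exists>f\<in>{f. L2 M f}. (\<lambda>n. \<integral>x. inner (1 *\<^sub>R X n x + (-1) *\<^sub>R f x) (1 *\<^sub>R X n x + (-1) *\<^sub>R f x) \<partial>M) \<longlonglongrightarrow> 0"
    using L2_complete[of X] by (simp add: power2_norm_eq_inner)
qed (auto simp: L2_lincomb L2_inner_integrable inner_left_distrib intro!: Bochner_Integration.integral_cong inner_commute)

end
end

section \<open>Separability of a Hilbert space of vector fields\<close>

lemma separable_if_countable_total:
  fixes S :: "'a::{real_inner,complete_space} set"
  assumes S: "countable S" and total: "\<And>v. (\<And>e. e \<in> S \<Longrightarrow> inner v e = 0) \<Longrightarrow> v = 0"
  shows "\<exists>D :: 'a set. countable D \<and> closure D = UNIV"
proof -
  define comb where "comb l = (\<Sum>(q, e)\<leftarrow>l. of_rat q *\<^sub>R e)" for l :: "(rat \<times> 'a) list"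
  define D where "D = comb ` lists (UNIV \<times> S)"
  have D_add: "x + y \<in> D" if xy: "x \<in> D" "y \<in> D" for x y
  proof -
    obtain l l' where l: "l \<in> lists (UNIV \<times> S)" "l' \<in> lists (UNIV \<times> S)" "x = comb l" "y = comb l'"
      using xy unfolding D_def by blast
    then have "x + y = comb (l @ l')" "l @ l' \<in> lists (UNIV \<times> S)" by (simp_all add: comb_def)
    then show ?thesis unfolding D_def by blast
  qed
  have D_rat: "of_rat q *\<^sub>R x \<in> D" if "x \<in> D" for q x
  proof -
    from that obtain l where l: "l \<in> lists (UNIV \<times> S)" "x = comb l" unfolding D_def by blast
    have "of_rat q *\<^sub>R comb l = comb (map (\<lambda>(p, e). (q * p, e)) l)"
      unfolding comb_def by (induction l) (auto simp: scaleR_add_right of_rat_mult)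
    moreover have "map (\<lambda>(p, e). (q * p, e)) l \<in> lists (UNIV \<times> S)"
      using l(1) by (induction l) auto
    ultimately show ?thesis using l(2) unfolding D_def by auto
  qed
  \<comment> \<open>\<open>E\<close> is the closed linear span of \<open>S\<close>, reached through
    rational combinations to keep \<open>D\<close> countable.\<close>
  define E where "E = closure D"
  have E_add: "x + y \<in> E" if xy: "x \<in> E" "y \<in> E" for x y
  proof -
    obtain f g where "\<forall>n. f n \<in> D" "f \<longlonglongrightarrow> x" "\<forall>n. g n \<in> D" "g \<longlonglongrightarrow> y"
      using xy unfolding E_def closure_sequential by blast
    then show ?thesis unfolding E_def closure_sequential
      by (intro exI[of _ "\<lambda>n. f n + g n"]) (simp add: D_add tendsto_add)
  qed
  have E_rat: "of_rat q *\<^sub>R x \<in> E" if x: "x \<in> E" for q x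
  proof -
    obtain f where "\<forall>n. f n \<in> D" "f \<longlonglongrightarrow> x"
      using x unfolding E_def closure_sequential by blast
    then show ?thesis unfolding E_def closure_sequential
      by (intro exI[of _ "\<lambda>n. of_rat q *\<^sub>R f n"]) (simp add: D_rat tendsto_scaleR)
  qed
  have E_scale: "c *\<^sub>R x \<in> E" if x: "x \<in> E" for c x
  proof -
    have "\<exists>q. \<bar>c - of_rat q\<bar> < 1 / real (Suc n)" for n
    proof -
      obtain q where "c < of_rat q" "of_rat q < c + 1 / real (Suc n)"
        using of_rat_dense[of c "c + 1 / real (Suc n)"] by auto
      then show ?thesis by (intro exI[of _ q]) linarith
    qed
    then obtain q where q: "\<And>n. \<bar>c - of_rat (q n)\<bar> < 1 / real (Suc n)" by metis
    have "(\<lambda>n. c - of_rat (q n)) \<longlonglongrightarrow> 0"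
      by (rule tendsto_rabs_zero_cancel, rule tendsto_sandwich[OF _ _ tendsto_const LIMSEQ_Suc[OF lim_1_over_n]])
        (simp_all add: less_imp_le[OF q] del: of_nat_Suc)
    from tendsto_diff[OF tendsto_const[of c] this] have "(\<lambda>n. of_rat (q n) :: real) \<longlonglongrightarrow> c" by simp
    then have "(\<lambda>n. of_rat (q n) *\<^sub>R x) \<longlonglongrightarrow> c *\<^sub>R x" by (intro tendsto_scaleR tendsto_const)
    then show ?thesis using closed_sequentially[of E "\<lambda>n. of_rat (q n) *\<^sub>R x"] E_rat[OF x]
      unfolding E_def by blast
  qed
  interpret U: semi_hilbert "UNIV :: 'a set" "\<lambda>a x b y. a *\<^sub>R x + b *\<^sub>R y" inner
    by (rule semi_hilbert_UNIV)
  have D0: "0 \<in> D" unfolding D_def by (rule image_eqI[of _ _ "[]"]) (auto simp: comb_def)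
  have DE: "D \<subseteq> E" unfolding E_def by (rule closure_subset)
  interpret E: semi_hilbert E "\<lambda>a x b y. a *\<^sub>R x + b *\<^sub>R y" inner
  proof
    show "E \<noteq> {}" using D0 DE by blast
    fix X assume X: "\<And>n::nat. X n \<in> E" and "\<And>e. 0 < e \<Longrightarrow> \<exists>N. \<forall>m\<ge>N. \<forall>n\<ge>N.
      inner (1 *\<^sub>R X m + (-1) *\<^sub>R X n) (1 *\<^sub>R X m + (-1) *\<^sub>R X n) < e"
    then obtain x where lim: "(\<lambda>n. inner (1 *\<^sub>R X n + (-1) *\<^sub>R x) (1 *\<^sub>R X n + (-1) *\<^sub>R x)) \<longlonglongrightarrow> 0"
      using U.complete[of X] by blast
    then have "(\<lambda>n. sqrt ((norm (X n - x))\<^sup>2)) \<longlonglongrightarrow> sqrt 0"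
      by (intro tendsto_real_sqrt) (simp add: power2_norm_eq_inner)
    then have "X \<longlonglongrightarrow> x" by (simp add: tendsto_norm_zero_iff LIM_zero_iff)
    then have "x \<in> E" using X closed_sequentially unfolding E_def by blast
    then show "\<exists>x\<in>E. (\<lambda>n. inner (1 *\<^sub>R X n + (-1) *\<^sub>R x) (1 *\<^sub>R X n + (-1) *\<^sub>R x)) \<longlonglongrightarrow> 0"
      using lim by blast
  qed (auto simp: E_add E_scale inner_left_distrib intro: inner_commute)
  have "v \<in> E" for v
  proof -
    \<comment> \<open>The representer \<open>f\<close> in \<open>E\<close> is the orthogonal
      projection of \<open>v\<close>; since \<open>v - f\<close> is orthogonal to \<open>S\<close>,
      it is zero by totality.\<close>
    have "E.functional (inner v)"
      using U.functional_ip[of v] unfolding U.functional_def E.functional_def by blast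
    then obtain f where f: "f \<in> E" "\<forall>g\<in>E. inner v g = inner f g" using E.Riesz by blast
    have "v - f = 0"
    proof (rule total)
      fix e assume "e \<in> S"
      then have "e \<in> D" unfolding D_def by (intro image_eqI[of _ _ "[(1, e)]"]) (auto simp: comb_def)
      then show "inner (v - f) e = 0" using f(2) DE by (auto simp: inner_diff_left)
    qed
    then show ?thesis using f(1) by simp
  qed
  moreover have "countable D" unfolding D_def using S by (intro countable_image countable_lists) auto
  ultimately show ?thesis unfolding E_def by blast
qed

lemma countable_dense_closure:
  obtains Q :: "'a::{metric_space,second_countable_topology} set" where "countable Q" "closure Q = UNIV"
proof -
  obtain Q :: "'a set" where Q: "countable Q" "\<And>X. open X \<Longrightarrow> X \<noteq> {} \<Longrightarrow> \<exists>q\<in>Q. q \<in> X"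
    by (rule countable_dense_setE) blast
  have "x \<in> closure Q" for x
    unfolding closure_approachable
  proof (intro allI impI)
    fix e :: real assume "0 < e"
    then show "\<exists>y\<in>Q. dist y x < e" using Q(2)[of "ball x e"] by (auto simp: dist_commute)
  qed
  then show ?thesis using that Q(1) by blast
qed

text \<open>Each scalar evaluation \<open>inner (\<iota> v x) b\<close> is bounded in
  \<open>v\<close> and hence represented by some \<open>k x b\<close>. If \<open>v\<close> is
  orthogonal to these representers for \<open>x\<close> in a countable dense set and
  \<open>b\<close> in the basis, its field vanishes there, then everywhere by continuity, and
  \<open>v = 0\<close> by injectivity. So countably many vectors are total.\<close>

lemma separable_if_evaluations_continuous:
  fixes \<iota> :: "'v::{real_inner,complete_space} \<Rightarrow> 'a::euclidean_space \<Rightarrow> 'b::euclidean_space"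
  assumes lin: "\<And>x. linear (\<lambda>v. \<iota> v x)" and inj: "inj \<iota>"
    and bnd: "\<And>v x. norm (\<iota> v x) \<le> C * norm v" and cont: "\<And>v. continuous_on UNIV (\<iota> v)"
  shows "\<exists>D :: 'v set. countable D \<and> closure D = UNIV"
proof -
  interpret U: semi_hilbert "UNIV :: 'v set" "\<lambda>a x b y. a *\<^sub>R x + b *\<^sub>R y" inner
    by (rule semi_hilbert_UNIV)
  have "U.functional (\<lambda>v. inner (\<iota> v x) b)" for x b
    unfolding U.functional_def
  proof (intro conjI allI ballI exI[of _ "(C * norm b)\<^sup>2"])
    show "inner (\<iota> (a *\<^sub>R v + c *\<^sub>R w) x) b = a * inner (\<iota> v x) b + c * inner (\<iota> w x) b" for a c v w
      by (simp add: linear_add[OF lin] linear_scale[OF lin] inner_left_distrib)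
    show "(inner (\<iota> v x) b)\<^sup>2 \<le> (C * norm b)\<^sup>2 * inner v v" for v
    proof -
      have "\<bar>inner (\<iota> v x) b\<bar> \<le> C * norm v * norm b"
        using Cauchy_Schwarz_ineq2[of "\<iota> v x" b] mult_right_mono[OF bnd[of v x] norm_ge_zero[of b]] by linarith
      then have "\<bar>inner (\<iota> v x) b\<bar>\<^sup>2 \<le> (C * norm v * norm b)\<^sup>2" by (intro power_mono) simp_all
      then show ?thesis by (simp add: power_mult_distrib power2_norm_eq_inner mult_ac)
    qed
  qed simp
  then have "\<exists>k. \<forall>v. inner (\<iota> v x) b = inner k v" for x b using U.Riesz by blast
  then obtain k where k: "\<And>x b v. inner (\<iota> v x) b = inner (k x b) v" by metis
  obtain Q :: "'a set" where Q: "countable Q" "closure Q = UNIV" by (rule countable_dense_closure)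
  show ?thesis
  proof (rule separable_if_countable_total)
    show "countable ((\<lambda>(x, b). k x b) ` (Q \<times> Basis))"
      using Q(1) by (intro countable_image countable_SIGMA) (auto intro: countable_finite)
    fix v assume *: "\<And>e. e \<in> (\<lambda>(x, b). k x b) ` (Q \<times> Basis) \<Longrightarrow> inner v e = 0"
    have "\<iota> v x = 0" if "x \<in> Q" for x
      using * that k[of v x] by (intro euclidean_eqI[of _ 0]) (force simp: inner_commute)
    then have "\<iota> v x = 0" for x
      using continuous_constant_on_closure[of Q "\<iota> v" 0 x] cont Q(2) by auto
    then have "\<iota> v = \<iota> 0" using linear_0[OF lin] by (auto simp: fun_eq_iff)
    then show "v = 0" using inj by (simp add: inj_eq)
  qed
qed

section \<open>Weak convergence of square integrable functions\<close>

definition L2_functional :: "'a measure \<Rightarrow> (('a \<Rightarrow> 'b::real_normed_vector) \<Rightarrow> real) \<Rightarrow> bool" where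
  "L2_functional M F \<longleftrightarrow>
     (\<forall>a b f g. L2 M f \<longrightarrow> L2 M g \<longrightarrow> F (\<lambda>x. a *\<^sub>R f x + b *\<^sub>R g x) = a * F f + b * F g) \<and>
     (\<exists>K\<ge>0. \<forall>f. L2 M f \<longrightarrow> (F f)\<^sup>2 \<le> K * (L2_sq M f))"

definition weakly_L2 :: "'a measure \<Rightarrow> (nat \<Rightarrow> 'a \<Rightarrow> 'b::real_normed_vector) \<Rightarrow> ('a \<Rightarrow> 'b) \<Rightarrow> bool" where
  "weakly_L2 M X f \<longleftrightarrow> (\<forall>F. L2_functional M F \<longrightarrow> (\<lambda>n. F (X n)) \<longlonglongrightarrow> F f)"

lemma weakly_L2_D: "weakly_L2 M X f \<Longrightarrow> L2_functional M F \<Longrightarrow> (\<lambda>n. F (X n)) \<longlonglongrightarrow> F f"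
  unfolding weakly_L2_def by blast

context finite_measure begin

context
  fixes D :: "'b::{real_inner,complete_space} set"
  assumes D: "countable D" "closure D = (UNIV :: 'b set)"
begin

interpretation L: semi_hilbert "{f :: 'a \<Rightarrow> 'b. L2 M f}" "\<lambda>a f b g x. a *\<^sub>R f x + b *\<^sub>R g x"
    "\<lambda>f g. \<integral>x. inner (f x) (g x) \<partial>M"
  by (rule semi_hilbert_L2[OF D])

text \<open>\<open>L2_functional\<close> is defined without a dense set, so that weak convergence
  can be stated for every normed value type; here it is identified with the notion of the
  semi-Hilbert space.\<close>

lemma L2_functional_iff: "L2_functional M F \<longleftrightarrow> L.functional (F :: ('a \<Rightarrow> 'b) \<Rightarrow> real)"
  unfolding L2_functional_def L.functional_def by (simp add: power2_norm_eq_inner)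

lemma L2_Cauchy_Schwarz:
  assumes "L2 M f" "L2 M (g :: 'a \<Rightarrow> 'b)"
  shows "(\<integral>x. inner (f x) (g x) \<partial>M)\<^sup>2 \<le> (L2_sq M f) * (L2_sq M g)"
  using L.Cauchy_Schwarz[of f g] assms by (simp add: power2_norm_eq_inner)

lemma L2_functional_inner:
  assumes "L2 M (f :: 'a \<Rightarrow> 'b)" shows "L2_functional M (\<lambda>g. \<integral>x. inner (f x) (g x) \<partial>M)"
  using L.functional_ip[of f] assms unfolding L2_functional_iff by simp

lemma L2_weakly_compact:
  fixes X :: "nat \<Rightarrow> 'a \<Rightarrow> 'b"
  assumes "\<And>n. L2 M (X n)" and "\<And>n. (L2_sq M (X n)) \<le> B"
  shows "\<exists>f r. L2 M f \<and> strict_mono r \<and> weakly_L2 M (\<lambda>n. X (r n)) f"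
  using L.weakly_compact[of X B] assms
  unfolding weakly_L2_def L2_functional_iff by (auto simp: power2_norm_eq_inner)

lemma L2_weak_lsc:
  fixes X :: "nat \<Rightarrow> 'a \<Rightarrow> 'b"
  assumes "\<And>n. L2 M (X n)" and "L2 M f" and "weakly_L2 M X f"
    and "(\<lambda>n. \<integral>x. (norm (X n x))\<^sup>2 \<partial>M) \<longlonglongrightarrow> b"
  shows "(L2_sq M f) \<le> b"
  using L.weak_lsc[of X f b] weakly_L2_D[OF assms(3) L2_functional_inner[OF assms(2)]] assms
  by (simp add: power2_norm_eq_inner)

end
end

section \<open>Caratheodory differential equations on the unit interval\<close>

lemmas hk_integral_diff = Henstock_Kurzweil_Integration.integral_diff
  and hk_integrable_diff = Henstock_Kurzweil_Integration.integrable_diff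
  and hk_integral_combine = Henstock_Kurzweil_Integration.integral_combine
  and hk_integral_norm_bound_integral = Henstock_Kurzweil_Integration.integral_norm_bound_integral

lemma bounded_on_unit_interval:
  fixes c :: "real \<Rightarrow> 'a::real_normed_vector"
  assumes "continuous_on {0..1} c" shows "\<exists>B. \<forall>s\<in>{0..1}. norm (c s) \<le> B"
proof -
  have "bounded (c ` {0..1})" using assms by (intro compact_imp_bounded compact_continuous_image) auto
  then show ?thesis by (auto simp: bounded_iff)
qed

lemma integrable_mult_continuous:
  fixes m y :: "real \<Rightarrow> real"
  assumes m: "m integrable_on {0..1}" "\<And>s. s \<in> {0..1} \<Longrightarrow> 0 \<le> m s" and y: "continuous_on {0..1} y"
  shows "(\<lambda>s. m s * y s) integrable_on {0..1}"
proof -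
  obtain B where B: "\<And>s. s \<in> {0..1} \<Longrightarrow> norm (y s) \<le> B"
    using bounded_on_unit_interval[OF y] by blast
  show ?thesis
  proof (rule measurable_bounded_by_integrable_imp_integrable)
    show "(\<lambda>s. m s * y s) \<in> borel_measurable (lebesgue_on {0..1})"
      by (intro borel_measurable_times integrable_imp_measurable m continuous_imp_measurable_on_sets_lebesgue y) simp
    show "(\<lambda>s. m s * B) integrable_on {0..1}" using m(1) by (rule integrable_on_mult_left)
    show "norm (m s * y s) \<le> m s * B" if "s \<in> {0..1}" for s
      using mult_left_mono[OF B[OF that] m(2)[OF that]] m(2)[OF that] by (simp add: abs_mult)
  qed simp
qed

text \<open>A crude exponential: it replaces \<open>exp R\<close> in Gronwall's inequality, which is then proved by
  cutting the time interval into pieces on which the integral of the coefficient is \<open>1/2\<close>.\<close>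

definition gron :: "real \<Rightarrow> real" where
  "gron R = 2 ^ nat \<lceil>2 * R\<rceil>"

lemma gron_ge_1: "1 \<le> gron R"
  unfolding gron_def by (rule one_le_power) simp

lemma gronwall:
  fixes m y :: "real \<Rightarrow> real"
  assumes m: "m integrable_on {0..1}" "\<And>s. s \<in> {0..1} \<Longrightarrow> 0 \<le> m s" "integral {0..1} m \<le> R"
    and y: "continuous_on {0..1} y" "\<And>s. s \<in> {0..1} \<Longrightarrow> 0 \<le> y s" and a: "0 \<le> a"
    and le: "\<And>t. t \<in> {0..1} \<Longrightarrow> y t \<le> a + integral {0..t} (\<lambda>s. m s * y s)"
    and t: "t \<in> {0..1}"
  shows "y t \<le> gron R * a"
proof -
  define z where "z t = a + integral {0..t} (\<lambda>s. m s * y s)" for t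
  define M where "M t = integral {0..t} m" for t
  have my: "(\<lambda>s. m s * y s) integrable_on {0..1}" by (rule integrable_mult_continuous[OF m(1,2) y(1)])
  have sub: "f integrable_on {s..t}" if "f integrable_on {0..1}" "0 \<le> s" "t \<le> 1" for f :: "real \<Rightarrow> real" and s t
    using that by (meson atLeastatMost_subset_iff integrable_on_subinterval)
  let ?I = "\<lambda>s t. integral {s..t} (\<lambda>s. m s * y s)"
  \<comment> \<open>\<open>z\<close> is nondecreasing and dominates \<open>y\<close>, so on
    \<open>{s..t}\<close> the integrand is at most \<open>m u * z t\<close>; the increment of
    \<open>z\<close> is thereby measured by that of \<open>M\<close>.\<close>
  have z_mono: "z s \<le> z t" and z_diff: "z t - z s \<le> z t * (M t - M s)" if st: "0 \<le> s" "s \<le> t" "t \<le> 1" for s t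
  proof -
    have zd: "z t - z s = ?I s t"
      using hk_integral_combine[of 0 s t "\<lambda>s. m s * y s"] st sub[OF my] by (simp add: z_def)
    have Md: "M t - M s = integral {s..t} m"
      using hk_integral_combine[of 0 s t m] st sub[OF m(1)] by (simp add: M_def)
    have nn: "0 \<le> ?I u t" if "0 \<le> u" for u
      using that st m(2) y(2) by (intro integral_nonneg sub[OF my]) auto
    show "z s \<le> z t" using zd nn[of s] st(1) by simp
    have below: "y u \<le> z t" if u: "s \<le> u" "u \<le> t" for u
    proof -
      have "z u \<le> z t"
        using hk_integral_combine[of 0 u t "\<lambda>s. m s * y s"] st u sub[OF my, of 0 t] nn[of u] by (simp add: z_def)
      moreover have "y u \<le> z u" using le[of u] st u by (simp add: z_def)
      ultimately show ?thesis by simp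
    qed
    have "?I s t \<le> integral {s..t} (\<lambda>u. m u * z t)"
      using st m(2) below
      by (intro integral_le sub[OF my] integrable_on_mult_left sub[OF m(1)] mult_left_mono) auto
    then show "z t - z s \<le> z t * (M t - M s)" unfolding zd Md by (simp add: mult.commute)
  qed
  have Mcont: "continuous_on {0..1} M" unfolding M_def by (rule indefinite_integral_continuous_1[OF m(1)])
  have M_mono: "M s \<le> M t" if "0 \<le> s" "s \<le> t" "t \<le> 1" for s t
    unfolding M_def using that m(2) by (intro integral_subset_le sub[OF m(1)]) auto
  \<comment> \<open>An increment of \<open>M\<close> by at most \<open>1/2\<close> lets half of
    \<open>z t\<close> be absorbed on the left.\<close>
  have double: "z t \<le> 2 * z s" if "0 \<le> s" "s \<le> t" "t \<le> 1" "M t - M s \<le> 1/2" for s t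
  proof -
    have "0 \<le> z t" using z_mono[of 0 t] that a by (simp add: z_def)
    then have "z t * (M t - M s) \<le> z t * (1/2)" using that by (intro mult_left_mono)
    then show ?thesis using z_diff[of s t] that by linarith
  qed
  have key: "0 \<le> t \<Longrightarrow> t \<le> 1 \<Longrightarrow> M t \<le> real n / 2 \<Longrightarrow> z t \<le> 2 ^ n * a" for n t
  proof (induction n arbitrary: t)
    case 0
    then have "M t - M 0 \<le> 0" by (simp add: M_def)
    moreover have "0 \<le> z t" using z_mono[of 0 t] 0 a by (simp add: z_def)
    ultimately have "z t * (M t - M 0) \<le> 0" by (simp add: mult_nonneg_nonpos)
    then show ?case using z_diff[of 0 t] 0 by (simp add: z_def)
  next
    case (Suc n)
    show ?case
    proof (cases "M t \<le> real n / 2")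
      case True
      then have "z t \<le> 2 ^ n * a" using Suc by blast
      also have "\<dots> \<le> 2 ^ Suc n * a" using a by simp
      finally show ?thesis .
    next
      case False
      \<comment> \<open>The induction hypothesis covers the time up to \<open>s\<close>, and one
        doubling covers the remaining piece.\<close>
      have "\<exists>s\<ge>0. s \<le> t \<and> M s = real n / 2"
      proof (rule IVT')
        show "continuous_on {0..t} M" using Mcont Suc by (auto elim: continuous_on_subset)
      qed (use False Suc in \<open>auto simp: M_def\<close>)
      then obtain s where s: "0 \<le> s" "s \<le> t" "M s = real n / 2" by blast
      have "z t \<le> 2 * z s" using s Suc by (intro double) (auto simp: field_simps)
      also have "\<dots> \<le> 2 * (2 ^ n * a)" using Suc.IH[of s] s Suc by simp
      finally show ?thesis by simp
    qed
  qed
  have "M t \<le> real (nat \<lceil>2 * R\<rceil>) / 2"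
    using M_mono[of t 1] m(3) t real_nat_ceiling_ge[of "2 * R"] unfolding M_def by simp
  then have "z t \<le> gron R * a" unfolding gron_def using t by (intro key) auto
  then show ?thesis using le[OF t] by (simp add: z_def)
qed

section \<open>Solutions in integral form\<close>

definition solves :: "(real \<Rightarrow> 'a::euclidean_space \<Rightarrow> 'a) \<Rightarrow> 'a \<Rightarrow> (real \<Rightarrow> 'a) \<Rightarrow> bool" where
  "solves g x c \<longleftrightarrow> (\<forall>t\<in>{0..1}. ((\<lambda>s. g s (c s)) has_integral (c t - x)) {0..t})"

lemma solves_continuous:
  assumes "solves g x c" shows "continuous_on {0..1} c"
proof -
  have "(\<lambda>s. g s (c s)) integrable_on {0..1}" using assms by (auto simp: solves_def integrable_on_def)
  then have "continuous_on {0..1} (\<lambda>t. x + integral {0..t} (\<lambda>s. g s (c s)))"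
    by (intro continuous_intros indefinite_integral_continuous_1)
  then show ?thesis
  proof (rule continuous_on_eq)
    show "x + integral {0..t} (\<lambda>s. g s (c s)) = c t" if "t \<in> {0..1}" for t
      using assms that unfolding solves_def by (metis add.commute diff_add_cancel integral_unique)
  qed
qed

lemma solves_eq: "solves g x c \<Longrightarrow> t \<in> {0..1} \<Longrightarrow> c t = x + integral {0..t} (\<lambda>s. g s (c s))"
  unfolding solves_def by (metis add.commute diff_add_cancel integral_unique)

lemma solves_start: "solves g x c \<Longrightarrow> c 0 = x"
  using solves_eq[of g x c 0] by simp

text \<open>Serves both the flow equation and its linearization. The function \<open>m\<close> is at
  once Lipschitz constant in space and bound at the origin, and the stability constants depend on it
  only through \<open>R\<close>; for fields of bounded energy they are therefore uniform.
  Measurability is asked along continuous curves, such as the Picard iterates.\<close>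

locale caratheodory =
  fixes g :: "real \<Rightarrow> 'a::euclidean_space \<Rightarrow> 'a" and m :: "real \<Rightarrow> real" and R :: real
  assumes m: "m integrable_on {0..1}" "\<And>s. s \<in> {0..1} \<Longrightarrow> 0 \<le> m s" "integral {0..1} m \<le> R"
    and meas: "\<And>c. continuous_on {0..1} c \<Longrightarrow> (\<lambda>s. g s (c s)) \<in> borel_measurable (lebesgue_on {0..1})"
    and lipschitz: "\<And>s y z. s \<in> {0..1} \<Longrightarrow> norm (g s y - g s z) \<le> m s * norm (y - z)"
    and zero_le: "\<And>s. s \<in> {0..1} \<Longrightarrow> norm (g s 0) \<le> m s"
begin

lemma R_nonneg: "0 \<le> R"
  using integral_nonneg[OF m(1,2)] m(3) by linarith

lemma norm_le: "s \<in> {0..1} \<Longrightarrow> norm (g s y) \<le> m s * (1 + norm y)"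
  using lipschitz[of s y 0] zero_le[of s] norm_triangle_ineq[of "g s y - g s 0" "g s 0"]
  by (simp add: algebra_simps)

lemma m_sub: "0 \<le> s \<Longrightarrow> t \<le> 1 \<Longrightarrow> m integrable_on {s..t}"
  using m(1) by (meson atLeastatMost_subset_iff integrable_on_subinterval)

lemma m_integral_le: "t \<in> {0..1} \<Longrightarrow> integral {0..t} m \<le> R"
  using integral_subset_le[of "{0..t}" "{0..1}" m] m m_sub[of 0 t] by force

lemma g_integrable:
  assumes c: "continuous_on {0..1} c" and "0 \<le> s" "t \<le> 1"
  shows "(\<lambda>s. g s (c s)) integrable_on {s..t}"
proof -
  obtain B where B: "\<And>s. s \<in> {0..1} \<Longrightarrow> norm (c s) \<le> B"
    using bounded_on_unit_interval[OF c] by blast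
  have "(\<lambda>s. g s (c s)) integrable_on {0..1}"
  proof (rule measurable_bounded_by_integrable_imp_integrable[OF meas[OF c]])
    show "(\<lambda>s. m s * (1 + B)) integrable_on {0..1}" using m(1) by (rule integrable_on_mult_left)
    show "norm (g s (c s)) \<le> m s * (1 + B)" if "s \<in> {0..1}" for s
    proof -
      have "m s * (1 + norm (c s)) \<le> m s * (1 + B)"
        by (intro mult_left_mono add_left_mono B[rule_format] m(2) that)
      then show ?thesis using norm_le[OF that, of "c s"] by linarith
    qed
  qed simp
  then show ?thesis using assms(2,3) by (meson atLeastatMost_subset_iff integrable_on_subinterval)
qed

lemma diff_integral_le:
  assumes c: "continuous_on {0..1} c" and c': "continuous_on {0..1} c'" and t: "t \<in> {0..1}"
  shows "norm (integral {0..t} (\<lambda>s. g s (c s)) - integral {0..t} (\<lambda>s. g s (c' s)))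
    \<le> integral {0..t} (\<lambda>s. m s * norm (c s - c' s))"
proof -
  let ?I = "\<lambda>c. integral {0..t} (\<lambda>s. g s (c s))"
  have cont: "continuous_on {0..1} (\<lambda>s. norm (c s - c' s))" by (intro continuous_intros c c')
  have i: "(\<lambda>s. m s * norm (c s - c' s)) integrable_on {0..t}"
    using integrable_mult_continuous[OF m(1,2) cont] t
    by (rule_tac integrable_on_subinterval) auto
  have "?I c - ?I c'
      = integral {0..t} (\<lambda>s. g s (c s) - g s (c' s))"
    using t by (intro hk_integral_diff[symmetric] g_integrable c c') auto
  also have "norm \<dots> \<le> integral {0..t} (\<lambda>s. m s * norm (c s - c' s))"
    using t
    by (intro hk_integral_norm_bound_integral i lipschitz
        hk_integrable_diff g_integrable c c') auto
  finally show ?thesis .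
qed

text \<open>An approximate solution with uniform defect \<open>e\<close> stays \<open>gron R * e\<close> close to the solution.
  Uniqueness, dependence on the initial point, differentiability and stability of flows
  are all instances.\<close>

lemma stability:
  assumes c: "solves g x c" and c': "continuous_on {0..1} c'" and e: "0 \<le> e"
    and defect: "\<And>t. t \<in> {0..1} \<Longrightarrow> norm (c' t - x - integral {0..t} (\<lambda>s. g s (c' s))) \<le> e"
    and t: "t \<in> {0..1}"
  shows "norm (c' t - c t) \<le> gron R * e"
proof (rule gronwall[OF m _ _ e _ t])
  have cc: "continuous_on {0..1} c" by (rule solves_continuous[OF c])
  show "continuous_on {0..1} (\<lambda>t. norm (c' t - c t))" by (intro continuous_intros c' cc)
  fix t :: real assume t: "t \<in> {0..1}"
  have eq: "c' t - c t = (c' t - x - integral {0..t} (\<lambda>s. g s (c' s)))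
      + (integral {0..t} (\<lambda>s. g s (c' s)) - integral {0..t} (\<lambda>s. g s (c s)))"
    using solves_eq[OF c t] by simp
  show "norm (c' t - c t) \<le> e + integral {0..t} (\<lambda>s. m s * norm (c' s - c s))"
    by (subst eq) (rule norm_triangle_mono[OF defect[OF t] diff_integral_le[OF c' cc t]])
qed auto

lemma stability_start:
  assumes c: "solves g x c" and c': "solves g y c'" and t: "t \<in> {0..1}"
  shows "norm (c' t - c t) \<le> gron R * norm (y - x)"
  by (rule stability[OF c solves_continuous[OF c'] _ _ t]) (use solves_eq[OF c'] in auto)

lemma unique: "solves g x c \<Longrightarrow> solves g x c' \<Longrightarrow> t \<in> {0..1} \<Longrightarrow> c' t = c t"
  using stability_start[of x c x c' t] by simp

text \<open>Gronwall's inequality bounds the partial sums of the distances of Picard iterates.\<close>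

lemma solution_exists: "\<exists>c. solves g x c"
proof -
  define P where "P c t = x + integral {0..t} (\<lambda>s. g s (c s))" for c t
  define c where "c k = (P ^^ k) (\<lambda>_. x)" for k
  have cS: "c (Suc k) t = x + integral {0..t} (\<lambda>s. g s (c k s))" for k t by (simp add: c_def P_def)
  have cc: "continuous_on {0..1} (c k)" for k
  proof (induction k)
    case (Suc k)
    then show ?case unfolding cS
      by (intro continuous_intros indefinite_integral_continuous_1 g_integrable) auto
  qed (simp add: c_def)
  define S where "S n t = (\<Sum>k<n. norm (c (Suc k) t - c k t))" for n t
  have S_cont: "continuous_on {0..1} (S n)" for n
    unfolding S_def by (intro continuous_intros cc)
  have S_nonneg: "0 \<le> S n t" for n t unfolding S_def by (intro sum_nonneg) simp
  define a where "a = R * (1 + norm x)"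
  have a: "0 \<le> a" using R_nonneg by (simp add: a_def)
  have S0: "norm (c 1 t - c 0 t) \<le> a" if t: "t \<in> {0..1}" for t
  proof -
    have "norm (integral {0..t} (\<lambda>s. g s x)) \<le> integral {0..t} (\<lambda>s. m s * (1 + norm x))"
      using t by (intro hk_integral_norm_bound_integral norm_le
          integrable_on_mult_left m_sub g_integrable) auto
    also have "\<dots> \<le> a" unfolding a_def using m_integral_le[OF t] by (simp add: mult_right_mono)
    finally show ?thesis using cS[of 0 t] by (simp add: c_def)
  qed
  have S_step: "S n t \<le> a + integral {0..t} (\<lambda>s. m s * S n s)" if t: "t \<in> {0..1}" for n t
  proof -
    have int: "(\<lambda>s. m s * norm (c (Suc k) s - c k s)) integrable_on {0..t}" for k
    proof (rule integrable_on_subinterval)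
      show "(\<lambda>s. m s * norm (c (Suc k) s - c k s)) integrable_on {0..1}"
        by (rule integrable_mult_continuous[OF m(1,2)]) (auto intro!: continuous_intros cc)
    qed (use t in auto)
    have step: "norm (c (Suc (Suc k)) t - c (Suc k) t) \<le> integral {0..t} (\<lambda>s. m s * norm (c (Suc k) s - c k s))" for k
      using diff_integral_le[OF cc[of "Suc k"] cc[of k] t] by (simp only: cS add_diff_cancel_left)
    \<comment> \<open>One term is added and the first split off; the shifted remainder is bounded by
      the integral with the same \<open>S n\<close>, which gives the form required by Gronwall's
      inequality.\<close>
    have "S n t \<le> S (Suc n) t" unfolding S_def by simp
    also have "\<dots> = norm (c 1 t - c 0 t) + (\<Sum>k<n. norm (c (Suc (Suc k)) t - c (Suc k) t))"
      unfolding S_def by (simp add: sum.lessThan_Suc_shift del: sum.lessThan_Suc)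
    also have "\<dots> \<le> a + (\<Sum>k<n. integral {0..t} (\<lambda>s. m s * norm (c (Suc k) s - c k s)))"
      by (intro add_mono S0 t sum_mono step)
    also have "(\<Sum>k<n. integral {0..t} (\<lambda>s. m s * norm (c (Suc k) s - c k s))) = integral {0..t} (\<lambda>s. m s * S n s)"
      unfolding S_def sum_distrib_left by (rule integral_sum[symmetric]) (auto intro: int)
    finally show ?thesis .
  qed
  have S_le: "S n t \<le> gron R * a" if "t \<in> {0..1}" for n t
    by (rule gronwall[OF m S_cont S_nonneg a S_step that]) auto
  have c_le: "norm (c n t) \<le> norm x + gron R * a" if "t \<in> {0..1}" for n t
  proof -
    have eq: "c n t = x + (\<Sum>k<n. c (Suc k) t - c k t)"
      by (simp add: sum_lessThan_telescope[of "\<lambda>k. c k t"]) (simp add: c_def)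
    have "norm (c n t) \<le> norm x + norm (\<Sum>k<n. c (Suc k) t - c k t)"
      unfolding eq by (rule norm_triangle_ineq)
    moreover have "norm (\<Sum>k<n. c (Suc k) t - c k t) \<le> S n t" unfolding S_def by (rule norm_sum)
    ultimately show ?thesis using S_le[OF that, of n] by linarith
  qed
  have "convergent (\<lambda>n. c n t)" if "t \<in> {0..1}" for t
  proof (rule convergent_if_summable_norm)
    show "summable (\<lambda>k. norm (c (Suc k) t - c k t))"
      using S_le[OF that] unfolding S_def by (intro summableI_nonneg_bounded[of _ "gron R * a"]) auto
  qed
  then obtain d where d: "\<And>t. t \<in> {0..1} \<Longrightarrow> (\<lambda>n. c n t) \<longlonglongrightarrow> d t"
    unfolding convergent_def by metis
  have "((\<lambda>s. g s (d s)) has_integral (d t - x)) {0..t}" if t: "t \<in> {0..1}" for t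
  proof -
    have le: "norm (g s (c k s)) \<le> m s * (1 + (norm x + gron R * a))" if "s \<in> {0..t}" for k s
    proof -
      have s: "s \<in> {0..1}" using that t by auto
      have "m s * (1 + norm (c k s)) \<le> m s * (1 + (norm x + gron R * a))"
        by (intro mult_left_mono add_left_mono c_le m(2) s)
      then show ?thesis using norm_le[OF s, of "c k s"] by linarith
    qed
    have conv: "(\<lambda>k. g s (c k s)) \<longlonglongrightarrow> g s (d s)" if "s \<in> {0..t}" for s
    proof -
      have s: "s \<in> {0..1}" using that t by auto
      have "(\<lambda>k. m s * norm (c k s - d s)) \<longlonglongrightarrow> m s * 0"
        by (intro tendsto_mult tendsto_const tendsto_norm_zero LIM_zero d s)
      then have "(\<lambda>k. g s (c k s) - g s (d s)) \<longlonglongrightarrow> 0"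
        by (rule_tac Lim_null_comparison) (auto intro!: always_eventually lipschitz s)
      then show ?thesis by (simp add: LIM_zero_iff)
    qed
    have gi: "(\<lambda>s. g s (c k s)) integrable_on {0..t}" for k using t by (intro g_integrable cc) auto
    have hi: "(\<lambda>s. m s * (1 + (norm x + gron R * a))) integrable_on {0..t}"
      using t by (intro integrable_on_mult_left m_sub) auto
    \<comment> \<open>The bound on the iterates makes a multiple of \<open>m\<close> a common
      majorant, so the integral equation survives the limit in \<open>k\<close>.\<close>
    note dc = dominated_convergence[OF gi hi le conv]
    have "(\<lambda>k. c (Suc k) t) \<longlonglongrightarrow> x + integral {0..t} (\<lambda>s. g s (d s))"
      unfolding cS by (intro tendsto_add tendsto_const dc(2)) auto
    moreover have "(\<lambda>k. c (Suc k) t) \<longlonglongrightarrow> d t" using d[OF t] by (rule LIMSEQ_Suc)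
    ultimately have "d t = x + integral {0..t} (\<lambda>s. g s (d s))" using LIMSEQ_unique by blast
    then show ?thesis using integrable_integral[OF dc(1)] by simp
  qed
  then show ?thesis unfolding solves_def by blast
qed

end

section \<open>Flows of square integrable curves of vector fields\<close>

text \<open>Gronwall's inequality run backwards in time from the vanishing end value, with the
  reflected coefficient. It gives injectivity of the differential of a flow without constructing the
  inverse flow.\<close>

lemma solves_injective:
  fixes m :: "real \<Rightarrow> real"
  assumes m: "m integrable_on {0..1}" "\<And>s. s \<in> {0..1} \<Longrightarrow> 0 \<le> m s"
    and lin: "\<And>s y. s \<in> {0..1} \<Longrightarrow> norm (g s y) \<le> m s * norm y"
    and y: "solves g h y" and end0: "y 1 = 0"
  shows "h = 0"
proof -
  have cont: "continuous_on {0..1} y" by (rule solves_continuous[OF y])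
  have gi: "(\<lambda>s. g s (y s)) integrable_on {0..1}"
    using y by (auto simp: solves_def integrable_on_def)
  have my: "(\<lambda>s. m s * norm (y s)) integrable_on {0..1}"
    by (rule integrable_mult_continuous[OF m]) (auto intro!: continuous_intros cont)
  have reflect: "((\<lambda>s. f (1 - s)) has_integral integral {1-t..1} f) {0..t}"
    if "f integrable_on {0..1}" "t \<in> {0..1}" for f :: "real \<Rightarrow> real" and t
  proof -
    have "f integrable_on {1-t..1}" using that by (auto intro: integrable_on_subinterval)
    then have "((\<lambda>s. f (- s)) has_integral integral {1-t..1} f) {-1..-(1-t)}"
      by (subst has_integral_reflect_real) (rule integrable_integral)
    from has_integral_shift_real_ivl[OF this, of "-1"] show ?thesis by (simp add: algebra_simps)
  qed
  have "norm (y (1 - 1)) \<le> gron (integral {0..1} (\<lambda>s. m (1 - s))) * 0"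
  proof (rule gronwall[where m="\<lambda>s. m (1 - s)" and y="\<lambda>s. norm (y (1 - s))"])
    show "(\<lambda>s. m (1 - s)) integrable_on {0..1}" using reflect[OF m(1), of 1] by (auto simp: integrable_on_def)
    show "continuous_on {0..1} (\<lambda>s. norm (y (1 - s)))"
      by (intro continuous_intros continuous_on_compose2[OF cont]) auto
    fix t :: real assume t: "t \<in> {0..1}"
    then have u: "1 - t \<in> {0..1}" by auto
    have sub: "f integrable_on {1-t..1}" if "f integrable_on {0..1}" for f :: "real \<Rightarrow> 'c::euclidean_space"
      using integrable_on_subinterval[OF that, of "1-t" 1] t by auto
    have "integral {0..1-t} (\<lambda>s. g s (y s)) + integral {1-t..1} (\<lambda>s. g s (y s)) = integral {0..1} (\<lambda>s. g s (y s))"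
      using u gi by (intro hk_integral_combine) auto
    then have "y (1 - t) = - integral {1-t..1} (\<lambda>s. g s (y s))"
      using solves_eq[OF y u] solves_eq[OF y, of 1] end0 by (simp add: algebra_simps eq_neg_iff_add_eq_0)
    then have "norm (y (1 - t)) = norm (integral {1-t..1} (\<lambda>s. g s (y s)))" by simp
    also have "\<dots> \<le> integral {1-t..1} (\<lambda>s. m s * norm (y s))"
      using t by (intro hk_integral_norm_bound_integral sub gi my lin) auto
    also have "\<dots> = integral {0..t} (\<lambda>s. m (1 - s) * norm (y (1 - s)))"
      using reflect[OF my t] by (simp add: integral_unique)
    finally show "norm (y (1 - t)) \<le> 0 + integral {0..t} (\<lambda>s. m (1 - s) * norm (y (1 - s)))" by simp
  qed (use m(2) in auto)
  then show ?thesis using solves_start[OF y] by simp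
qed

text \<open>Finitely many grid points of mesh below \<open>\<delta>\<close> are eventually
  controlled at once; every other time is compared with the grid point to its left.\<close>

lemma equicontinuous_uniform_null:
  fixes e :: "nat \<Rightarrow> real \<Rightarrow> 'a::real_normed_vector"
  assumes equi: "\<And>\<epsilon>. 0 < \<epsilon> \<Longrightarrow> \<exists>\<delta>>0. \<forall>n s t. 0 \<le> s \<longrightarrow> s \<le> t \<longrightarrow> t \<le> 1 \<longrightarrow> t - s < \<delta> \<longrightarrow> norm (e n t - e n s) < \<epsilon>"
    and lim: "\<And>t. t \<in> {0..1} \<Longrightarrow> (\<lambda>n. e n t) \<longlonglongrightarrow> 0"
    and \<epsilon>: "0 < \<epsilon>"
  shows "\<forall>\<^sub>F n in sequentially. \<forall>t\<in>{0..1}. norm (e n t) < \<epsilon>"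
proof -
  obtain \<delta> where \<delta>: "0 < \<delta>" and close: "\<And>n s t. 0 \<le> s \<Longrightarrow> s \<le> t \<Longrightarrow> t \<le> 1 \<Longrightarrow> t - s < \<delta> \<Longrightarrow> norm (e n t - e n s) < \<epsilon>/2"
    using equi[of "\<epsilon>/2"] \<epsilon> by (auto simp: field_simps)
  obtain k :: nat where k: "1 / real (Suc k) < \<delta>" using nat_approx_posE[OF \<delta>] by auto
  define N where "N = real (Suc k)"
  have N: "0 < N" by (simp add: N_def)
  have "\<forall>\<^sub>F n in sequentially. \<forall>i\<in>{..Suc k}. norm (e n (real i / N)) < \<epsilon>/2"
  proof (rule eventually_ball_finite)
    show "\<forall>i\<in>{..Suc k}. \<forall>\<^sub>F n in sequentially. norm (e n (real i / N)) < \<epsilon>/2"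
    proof
      fix i assume "i \<in> {..Suc k}"
      then have "real i / N \<in> {0..1}" using N by (auto simp: N_def divide_le_eq)
      from tendsto_norm_zero[OF lim[OF this]] show "\<forall>\<^sub>F n in sequentially. norm (e n (real i / N)) < \<epsilon>/2"
        using \<epsilon> by (intro order_tendstoD(2)[of _ 0]) auto
    qed
  qed simp
  then show ?thesis
  proof eventually_elim
    case (elim n)
    show ?case
    proof
      fix t :: real assume t: "t \<in> {0..1}"
      define i where "i = nat \<lfloor>t * N\<rfloor>"
      have i: "real i \<le> t * N" "t * N < real i + 1" using t N unfolding i_def by (simp_all add: of_nat_nat)
      have "t * N \<le> real (Suc k)" using t N by (simp add: N_def mult_left_le_one_le)
      then have "i \<in> {..Suc k}" using i(1) by simp
      then have "norm (e n (real i / N)) < \<epsilon>/2" using elim by blast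
      moreover have "norm (e n t - e n (real i / N)) < \<epsilon>/2"
      proof (rule close)
        show "real i / N \<le> t" using i(1) N by (simp add: divide_le_eq)
        have "t - real i / N \<le> 1 / N" using i(2) N by (simp add: pos_le_divide_eq left_diff_distrib)
        then show "t - real i / N < \<delta>" using k by (simp add: N_def)
      qed (use t N in auto)
      ultimately show "norm (e n t) < \<epsilon>" using norm_triangle_sub[of "e n t" "e n (real i / N)"] by linarith
    qed
  qed
qed

section \<open>Square integrable curves on the unit interval\<close>

abbreviation "unit_time \<equiv> lebesgue_on {0..1::real}"

lemma finite_measure_unit_time: "finite_measure unit_time"
  by (rule finite_measureI) (simp add: emeasure_restrict_space)

lemma measure_unit_time: "measure unit_time (space unit_time) = 1"
  by (simp add: measure_restrict_space)

text \<open>The energy is a Lebesgue integral while the flow equation is a gauge integral; these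
  facts convert between the two. The interval has mass \<open>1\<close>, so Cauchy-Schwarz carries
  no constant.\<close>

lemma L2_norm_integrable:
  fixes v :: "real \<Rightarrow> 'v::real_normed_vector"
  assumes "L2 unit_time v"
  shows "(\<lambda>s. norm (v s)) integrable_on {0..1}" and "(\<lambda>s. (norm (v s))\<^sup>2) integrable_on {0..1}"
    and "integral {0..1} (\<lambda>s. (norm (v s))\<^sup>2) = (L2_sq unit_time v)"
    and "(integral {0..1} (\<lambda>s. norm (v s)))\<^sup>2 \<le> (L2_sq unit_time v)"
proof -
  interpret finite_measure unit_time by (rule finite_measure_unit_time)
  have n: "(\<lambda>s. norm (v s)) \<in> borel_measurable unit_time"
    by (rule borel_measurable_continuous_on[OF _ L2_D[OF assms]]) (intro continuous_intros)
  have i2: "integrable unit_time (\<lambda>s. (norm (v s))\<^sup>2)" using assms by (simp add: L2_def)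
  note sq = square_integral_le[OF n i2]
  show "(\<lambda>s. norm (v s)) integrable_on {0..1}" by (rule integrable_on_lebesgue_on[OF sq(1)]) simp
  show "(\<lambda>s. (norm (v s))\<^sup>2) integrable_on {0..1}" by (rule integrable_on_lebesgue_on[OF i2]) simp
  show "integral {0..1} (\<lambda>s. (norm (v s))\<^sup>2) = (L2_sq unit_time v)"
    by (rule lebesgue_integral_eq_integral[OF i2, symmetric]) simp
  show "(integral {0..1} (\<lambda>s. norm (v s)))\<^sup>2 \<le> (L2_sq unit_time v)"
    using sq(2) lebesgue_integral_eq_integral[OF sq(1)] unfolding measure_unit_time by simp
qed

text \<open>Young's inequality \<open>r \<le> \<eta> * r\<^sup>2 + 1 / \<eta>\<close> under the
  integral. The free parameter makes the bound small on short intervals, uniformly over curves of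
  energy at most \<open>E\<close>; \<open>\<eta> = 1\<close> serves for the whole interval.\<close>

lemma L2_norm_integral_le:
  fixes v :: "real \<Rightarrow> 'v::real_normed_vector"
  assumes v: "L2 unit_time v" and E: "(L2_sq unit_time v) \<le> E"
    and \<eta>: "0 < \<eta>" and st: "0 \<le> s" "s \<le> t" "t \<le> 1"
  shows "integral {s..t} (\<lambda>s. norm (v s)) \<le> \<eta> * E + (t - s) / \<eta>"
proof -
  have sub: "f integrable_on {s..t}" if "f integrable_on {0..1}" for f :: "real \<Rightarrow> real"
    using integrable_on_subinterval[OF that, of s t] st by auto
  have "norm (v u) \<le> \<eta> * (norm (v u))\<^sup>2 + 1 / \<eta>" for u
  proof -
    have "0 \<le> (\<eta> * norm (v u) - 1)\<^sup>2" by simp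
    then have "2 * (\<eta> * norm (v u)) \<le> (\<eta> * norm (v u))\<^sup>2 + 1" by (simp add: power2_diff)
    moreover have "0 \<le> \<eta> * norm (v u)" using \<eta> by simp
    ultimately have "\<eta> * norm (v u) \<le> (\<eta> * norm (v u))\<^sup>2 + 1" by linarith
    then show ?thesis using \<eta> by (simp add: field_simps power2_eq_square)
  qed
  then have "integral {s..t} (\<lambda>s. norm (v s)) \<le> integral {s..t} (\<lambda>u. \<eta> * (norm (v u))\<^sup>2 + 1 / \<eta>)"
    by (intro integral_le sub L2_norm_integrable v Henstock_Kurzweil_Integration.integrable_add integrable_on_mult_right integrable_const_ivl)
  also have "\<dots> = \<eta> * integral {s..t} (\<lambda>u. (norm (v u))\<^sup>2) + (t - s) / \<eta>"
    using st \<eta>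
    by (subst Henstock_Kurzweil_Integration.integral_add)
      (simp_all add: integrable_on_mult_right sub L2_norm_integrable(2)[OF v] integrable_const_ivl)
  finally have "integral {s..t} (\<lambda>s. norm (v s)) \<le> \<eta> * integral {s..t} (\<lambda>u. (norm (v u))\<^sup>2) + (t - s) / \<eta>" .
  moreover have "integral {s..t} (\<lambda>u. (norm (v u))\<^sup>2) \<le> integral {0..1} (\<lambda>u. (norm (v u))\<^sup>2)"
    using st by (intro integral_subset_le sub L2_norm_integrable v) auto
  then have "integral {s..t} (\<lambda>u. (norm (v u))\<^sup>2) \<le> E" using L2_norm_integrable(3)[OF v] E by linarith
  then have "\<eta> * integral {s..t} (\<lambda>u. (norm (v u))\<^sup>2) \<le> \<eta> * E" using \<eta> by (intro mult_left_mono) auto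
  ultimately show ?thesis by linarith
qed

text \<open>\<open>h\<close> stands for a field, or its derivative, evaluated along a curve that
  stays fixed. The third claim is the bridge from weak convergence: tested against a vector, the
  time integral is a bounded functional of \<open>w\<close>.\<close>

lemma L2_time_functional:
  fixes h :: "real \<Rightarrow> 'v::real_normed_vector \<Rightarrow> 'a::euclidean_space"
  assumes meas: "\<And>w. L2 unit_time w \<Longrightarrow> (\<lambda>s. h s (w s)) \<in> borel_measurable unit_time"
    and lin: "\<And>s. linear (h s)" and bnd: "\<And>s w. s \<in> {0..1} \<Longrightarrow> norm (h s w) \<le> B * norm w"
    and B: "0 \<le> B"
  shows L2_time_integrable: "\<And>w s t. L2 unit_time w \<Longrightarrow> 0 \<le> s \<Longrightarrow> t \<le> 1 \<Longrightarrow> (\<lambda>s. h s (w s)) integrable_on {s..t}"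
    and L2_time_bound: "\<And>w s t. L2 unit_time w \<Longrightarrow> 0 \<le> s \<Longrightarrow> t \<le> 1 \<Longrightarrow>
      norm (integral {s..t} (\<lambda>s. h s (w s))) \<le> B * integral {s..t} (\<lambda>s. norm (w s))"
    and "\<And>t b. t \<in> {0..1} \<Longrightarrow> L2_functional unit_time (\<lambda>w. inner (integral {0..t} (\<lambda>s. h s (w s))) b)"
proof -
  let ?I = "\<lambda>s t w. integral {s..t} (\<lambda>s. h s (w s))"
  show int: "(\<lambda>s. h s (w s)) integrable_on {s..t}" if w: "L2 unit_time w" "0 \<le> s" "t \<le> 1" for w s t
  proof (rule integrable_on_subinterval)
    show "(\<lambda>s. h s (w s)) integrable_on {0..1}"
    proof (rule measurable_bounded_by_integrable_imp_integrable[OF meas[OF w(1)]])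
      show "(\<lambda>s. B * norm (w s)) integrable_on {0..1}"
        by (intro integrable_on_mult_right L2_norm_integrable w)
    qed (use bnd in auto)
  qed (use w in auto)
  show bound: "norm (?I s t w) \<le> B * integral {s..t} (\<lambda>s. norm (w s))"
    if w: "L2 unit_time w" "0 \<le> s" "t \<le> 1" for w s t
  proof -
    have nw: "(\<lambda>s. norm (w s)) integrable_on {s..t}"
      using integrable_on_subinterval[OF L2_norm_integrable(1)[OF w(1)], of s t] w by auto
    have "norm (?I s t w) \<le> integral {s..t} (\<lambda>s. B * norm (w s))"
      using w by (intro hk_integral_norm_bound_integral int
          integrable_on_mult_right nw bnd) auto
    then show ?thesis by simp
  qed
  show "L2_functional unit_time (\<lambda>w. inner (?I 0 t w) b)" if t: "t \<in> {0..1}" for t b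
    unfolding L2_functional_def
  proof (intro conjI allI impI exI[of _ "(B * norm b)\<^sup>2"])
    fix p q :: real and f g :: "real \<Rightarrow> 'v" assume fg: "L2 unit_time f" "L2 unit_time g"
    have "integral {0..t} (\<lambda>s. h s (p *\<^sub>R f s + q *\<^sub>R g s))
        = integral {0..t} (\<lambda>s. p *\<^sub>R h s (f s) + q *\<^sub>R h s (g s))"
      by (simp add: linear_add[OF lin] linear_scale[OF lin])
    also have "\<dots> = p *\<^sub>R ?I 0 t f + q *\<^sub>R ?I 0 t g"
      using t by (subst Henstock_Kurzweil_Integration.integral_add) (auto intro!: integrable_cmul int fg)
    finally show "inner (integral {0..t} (\<lambda>s. h s (p *\<^sub>R f s + q *\<^sub>R g s))) b
        = p * inner (?I 0 t f) b + q * inner (?I 0 t g) b"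
      by (simp add: inner_left_distrib)
  next
    fix w :: "real \<Rightarrow> 'v" assume w: "L2 unit_time w"
    have nw: "(\<lambda>s. norm (w s)) integrable_on {0..t}"
      using integrable_on_subinterval[OF L2_norm_integrable(1)[OF w], of 0 t] t by auto
    have "integral {0..t} (\<lambda>s. norm (w s)) \<le> integral {0..1} (\<lambda>s. norm (w s))"
      using t by (intro integral_subset_le nw L2_norm_integrable w) auto
    moreover have "norm (?I 0 t w) \<le> B * integral {0..t} (\<lambda>s. norm (w s))"
      using t by (intro bound w) auto
    ultimately have *: "norm (?I 0 t w) \<le> B * integral {0..1} (\<lambda>s. norm (w s))"
      using B by (meson mult_left_mono order_trans)
    have "\<bar>inner (?I 0 t w) b\<bar> \<le> norm (?I 0 t w) * norm b"
      by (rule Cauchy_Schwarz_ineq2)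
    also have "\<dots> \<le> B * integral {0..1} (\<lambda>s. norm (w s)) * norm b" by (intro mult_right_mono * norm_ge_zero)
    finally have "\<bar>inner (?I 0 t w) b\<bar>\<^sup>2 \<le> (B * integral {0..1} (\<lambda>s. norm (w s)) * norm b)\<^sup>2"
      by (intro power_mono) simp_all
    also have "\<dots> = (B * norm b)\<^sup>2 * (integral {0..1} (\<lambda>s. norm (w s)))\<^sup>2" by (simp add: power_mult_distrib)
    also have "\<dots> \<le> (B * norm b)\<^sup>2 * (L2_sq unit_time w)"
      by (intro mult_left_mono L2_norm_integrable(4) w) simp
    finally show "(inner (?I 0 t w) b)\<^sup>2 \<le> (B * norm b)\<^sup>2 * (L2_sq unit_time w)"
      by simp
  qed simp
qed

text \<open>Weak convergence makes the integrals over \<open>{0..t}\<close> converge for every \<open>t\<close>; the bound on the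
  energies makes them equicontinuous in \<open>t\<close>, hence the convergence is uniform.\<close>

lemma weakly_L2_time_integral_uniform:
  fixes h :: "real \<Rightarrow> 'v::real_normed_vector \<Rightarrow> 'a::euclidean_space"
  assumes meas: "\<And>w. L2 unit_time w \<Longrightarrow> (\<lambda>s. h s (w s)) \<in> borel_measurable unit_time"
    and lin: "\<And>s. linear (h s)" and bnd: "\<And>s w. s \<in> {0..1} \<Longrightarrow> norm (h s w) \<le> B * norm w" and B: "0 \<le> B"
    and V: "\<And>n. L2 unit_time (V n)" and v: "L2 unit_time v" and weak: "weakly_L2 unit_time V v"
    and EV: "\<And>n. (L2_sq unit_time (V n)) \<le> E" and Ev: "(L2_sq unit_time v) \<le> E"
    and \<epsilon>: "0 < \<epsilon>"
  shows "\<forall>\<^sub>F n in sequentially. \<forall>t\<in>{0..1}.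
    norm (integral {0..t} (\<lambda>s. h s (V n s)) - integral {0..t} (\<lambda>s. h s (v s))) < \<epsilon>"
proof (rule equicontinuous_uniform_null[OF _ _ \<epsilon>])
  let ?I = "\<lambda>s t w. integral {s..t} (\<lambda>s. h s (w s))"
  note H = L2_time_functional[of h B, OF meas lin bnd B]
  fix t :: real assume t: "t \<in> {0..1}"
  have "(\<lambda>n. ?I 0 t (V n)) \<longlonglongrightarrow> ?I 0 t v"
    by (subst tendsto_componentwise_iff) (auto intro!: weakly_L2_D[OF weak H(3)[OF _ _ t]])
  then show "(\<lambda>n. ?I 0 t (V n) - ?I 0 t v) \<longlonglongrightarrow> 0"
    by (simp add: LIM_zero)
next
  let ?I = "\<lambda>s t w. integral {s..t} (\<lambda>s. h s (w s))"
  note H = L2_time_functional[of h B, OF meas lin bnd B]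
  have E: "0 \<le> E" by (rule order_trans[OF _ Ev]) simp
  fix \<epsilon> :: real assume \<epsilon>: "0 < \<epsilon>"
  \<comment> \<open>After multiplication by \<open>B + 1\<close>, the terms
    \<open>\<eta> * (E + 1)\<close> and \<open>\<delta> / \<eta>\<close> are
    \<open>\<epsilon> / 4\<close> each; so \<open>V n\<close> and \<open>v\<close> contribute less
    than \<open>\<epsilon> / 2\<close> each. The added \<open>1\<close> keeps the denominators
    positive.\<close>
  define \<eta> where "\<eta> = \<epsilon> / (4 * (B + 1) * (E + 1))"
  have \<eta>: "0 < \<eta>" using \<epsilon> B E by (simp add: \<eta>_def)
  define \<delta> where "\<delta> = \<eta> * \<epsilon> / (4 * (B + 1))"
  have \<delta>: "0 < \<delta>" using \<epsilon> B \<eta> by (simp add: \<delta>_def)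
  have small: "B * integral {s..t} (\<lambda>s. norm (w s)) < \<epsilon> / 2"
    if w: "L2 unit_time w" "(L2_sq unit_time w) \<le> E" and st: "0 \<le> s" "s \<le> t" "t \<le> 1" "t - s < \<delta>" for w :: "real \<Rightarrow> 'v" and s t
  proof -
    have "B * integral {s..t} (\<lambda>s. norm (w s)) \<le> B * (\<eta> * E + (t - s) / \<eta>)"
      by (intro mult_left_mono L2_norm_integral_le w \<eta> st B)
    also have "\<dots> \<le> (B + 1) * (\<eta> * E + (t - s) / \<eta>)"
      using \<eta> E st by (intro mult_right_mono) auto
    also have "\<dots> < (B + 1) * (\<eta> * (E + 1) + \<delta> / \<eta>)"
      using \<eta> E st B by (intro mult_strict_left_mono add_strict_mono divide_strict_right_mono) auto
    also have "\<dots> = \<epsilon> / 2"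
    proof -
      have "\<eta> * (E + 1) = \<epsilon> / (4 * (B + 1))" using E B by (simp add: \<eta>_def field_simps add_nonneg_eq_0_iff)
      moreover have "\<delta> / \<eta> = \<epsilon> / (4 * (B + 1))" using \<eta> by (simp add: \<delta>_def)
      ultimately have "(B + 1) * (\<eta> * (E + 1) + \<delta> / \<eta>) = (B + 1) * (\<epsilon> / (4 * (B + 1)) + \<epsilon> / (4 * (B + 1)))"
        by (simp only:)
      also have "\<dots> = 2 * ((B + 1) * (\<epsilon> / (4 * (B + 1))))" by (simp only: distrib_left mult_2)
      also have "\<dots> = \<epsilon> / 2"
      proof -
        have half: "2 * (q * (\<epsilon> / (4 * q))) = \<epsilon> / 2" if "q \<noteq> 0" for q using that by simp
        show ?thesis by (rule half) (use B in linarith)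
      qed
      finally show ?thesis .
    qed
    finally show ?thesis .
  qed
  have "norm (?I 0 t (V n) - ?I 0 t v
      - (?I 0 s (V n) - ?I 0 s v)) < \<epsilon>"
    if st: "0 \<le> s" "s \<le> t" "t \<le> 1" "t - s < \<delta>" for n s t
  proof -
    have split: "?I 0 t w - ?I 0 s w = ?I s t w"
      if w: "L2 unit_time w" for w
      using hk_integral_combine[OF st(1,2) H(1)[OF _ _ w _ st(3)]] by (simp add: algebra_simps)
    have "norm (?I s t (V n) - ?I s t v)
        \<le> norm (?I s t (V n)) + norm (?I s t v)"
      by (rule norm_triangle_ineq4)
    also have "\<dots> < \<epsilon>"
      using H(2)[OF _ _ V[of n] st(1,3)] H(2)[OF _ _ v st(1,3)] small[OF V EV st, of n] small[OF v Ev st] by linarith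
    finally show ?thesis using split[OF V[of n]] split[OF v] by (simp add: algebra_simps)
  qed
  then show "\<exists>\<delta>>0. \<forall>n s t. 0 \<le> s \<longrightarrow> s \<le> t \<longrightarrow> t \<le> 1 \<longrightarrow> t - s < \<delta> \<longrightarrow>
      norm (?I 0 t (V n) - ?I 0 t v
        - (?I 0 s (V n) - ?I 0 s v)) < \<epsilon>"
    using \<delta> by blast
qed

text \<open>The estimates retained from the embedding are proportional to \<open>norm v\<close>, so
  constants depend on a curve through its energy. Linearity of \<open>D\<iota>\<close> in
  \<open>v\<close> lets weak convergence act on the linearized equation; \<open>taylor\<close> makes
  \<open>D\<iota> v x\<close> the derivative of \<open>\<iota> v\<close> at
  \<open>x\<close>.\<close>

locale field_space =
  fixes \<iota> :: "'v::{real_inner,complete_space} \<Rightarrow> 'a::euclidean_space \<Rightarrow> 'a"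
    and D\<iota> :: "'v \<Rightarrow> 'a \<Rightarrow> 'a \<Rightarrow> 'a" and C :: real
  assumes C: "0 \<le> C"
    and lin: "\<And>x. linear (\<lambda>v. \<iota> v x)"
    and D_lin: "\<And>x h. linear (\<lambda>v. D\<iota> v x h)"
    and D_linear: "\<And>v x. linear (D\<iota> v x)"
    and bound: "\<And>v x. norm (\<iota> v x) \<le> C * norm v"
    and D_bound: "\<And>v x h. norm (D\<iota> v x h) \<le> C * norm v * norm h"
    and lip: "\<And>v x y. norm (\<iota> v x - \<iota> v y) \<le> C * norm v * norm (x - y)"
    and D_lip: "\<And>v x y h. norm (D\<iota> v x h - D\<iota> v y h) \<le> C * norm v * norm (x - y) * norm h"
    and taylor: "\<And>v x y. norm (\<iota> v y - \<iota> v x - D\<iota> v x (y - x)) \<le> C * norm v * (norm (y - x))\<^sup>2"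
begin

text \<open>The points of the curve, in a Euclidean space, are the separable variable of the
  Caratheodory lemma; the vector \<open>w s\<close> is the other one.\<close>

lemma measurable_field:
  assumes c: "continuous_on {0..1} c" and w: "L2 unit_time w"
  shows "(\<lambda>s. \<iota> (w s) (c s)) \<in> borel_measurable unit_time"
proof -
  obtain Q :: "'a set" where Q: "countable Q" "closure Q = UNIV" by (rule countable_dense_closure)
  have cm: "c \<in> borel_measurable unit_time" by (rule continuous_imp_measurable_on_sets_lebesgue[OF c]) simp
  show ?thesis
  proof (rule borel_measurable_Caratheodory[OF Q cm L2_D[OF w], where h="\<lambda>x w. \<iota> w x"])
    show "continuous_on UNIV (\<iota> v)" for v
      by (rule lipschitz_on_continuous_on[of "C * norm v"], rule lipschitz_onI)
        (use C lip in \<open>auto simp: dist_norm\<close>)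
    show "continuous_on UNIV (\<lambda>w. \<iota> w x)" for x
    proof (rule linear_continuous_on, rule bounded_linear_intro[of _ C])
      show "norm (\<iota> w x) \<le> norm w * C" for w using bound[of w x] by (simp add: mult.commute)
    qed (simp_all add: linear_add[OF lin] linear_scale[OF lin])
  qed
qed

lemma measurable_D_field:
  assumes c: "continuous_on {0..1} c" and y: "continuous_on {0..1} y" and w: "L2 unit_time w"
  shows "(\<lambda>s. D\<iota> (w s) (c s) (y s)) \<in> borel_measurable unit_time"
proof -
  obtain Q :: "('a \<times> 'a) set" where Q: "countable Q" "closure Q = UNIV" by (rule countable_dense_closure)
  have cm: "(\<lambda>s. (c s, y s)) \<in> borel_measurable unit_time"
    by (rule continuous_imp_measurable_on_sets_lebesgue) (intro continuous_intros c y, simp)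
  have "(\<lambda>s. (\<lambda>p w. D\<iota> w (fst p) (snd p)) (c s, y s) (w s)) \<in> borel_measurable unit_time"
  proof (rule borel_measurable_Caratheodory[OF Q cm L2_D[OF w]])
    show "continuous_on UNIV (\<lambda>w. D\<iota> w (fst p) (snd p))" for p
    proof (rule linear_continuous_on, rule bounded_linear_intro[of _ "C * norm (snd p)"])
      show "norm (D\<iota> w (fst p) (snd p)) \<le> norm w * (C * norm (snd p))" for w
        using D_bound[of w "fst p" "snd p"] by (simp add: mult_ac)
    qed (simp_all add: linear_add[OF D_lin] linear_scale[OF D_lin])
    show "continuous_on UNIV (\<lambda>p. D\<iota> v (fst p) (snd p))" for v
      unfolding continuous_on_def
    proof
      fix p :: "'a \<times> 'a"
      have "((\<lambda>q. C * norm v * norm (fst q - fst p) * norm (snd q) + C * norm v * norm (snd q - snd p)) \<longlongrightarrow>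
          C * norm v * norm (fst p - fst p) * norm (snd p) + C * norm v * norm (snd p - snd p)) (at p)"
        by (intro tendsto_intros)
      then have lim: "((\<lambda>q. C * norm v * norm (fst q - fst p) * norm (snd q) + C * norm v * norm (snd q - snd p)) \<longlongrightarrow> 0) (at p)"
        by simp
      have "((\<lambda>q. D\<iota> v (fst q) (snd q) - D\<iota> v (fst p) (snd p)) \<longlongrightarrow> 0) (at p)"
      proof (rule Lim_null_comparison[OF always_eventually lim], rule allI)
        fix q
        have eq: "D\<iota> v (fst q) (snd q) - D\<iota> v (fst p) (snd p)
          = (D\<iota> v (fst q) (snd q) - D\<iota> v (fst p) (snd q)) + D\<iota> v (fst p) (snd q - snd p)"
          by (simp add: linear_diff[OF D_linear])
        show "norm (D\<iota> v (fst q) (snd q) - D\<iota> v (fst p) (snd p))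
          \<le> C * norm v * norm (fst q - fst p) * norm (snd q) + C * norm v * norm (snd q - snd p)"
          by (subst eq) (rule norm_triangle_mono[OF D_lip D_bound])
      qed
      then show "((\<lambda>q. D\<iota> v (fst q) (snd q)) \<longlongrightarrow> D\<iota> v (fst p) (snd p)) (at p within UNIV)"
        by (simp add: LIM_zero_iff)
    qed
  qed
  then show ?thesis by simp
qed

text \<open>Bounds the time integral of the Lipschitz constant \<open>C * norm (v s)\<close> when
  the energy is at most \<open>E\<close>, by Young's inequality with
  \<open>\<eta> = 1\<close>.\<close>

definition rate :: "real \<Rightarrow> real" where
  "rate E = C * (1 + E)"

definition amp :: "real \<Rightarrow> real" where
  "amp E = gron (rate E)"

lemma amp_ge_1: "1 \<le> amp E" unfolding amp_def by (rule gron_ge_1)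

section \<open>The flow of one curve and its differential\<close>

context
  fixes v :: "real \<Rightarrow> 'v" and E :: real
  assumes v: "L2 unit_time v" and E: "(L2_sq unit_time v) \<le> E"
begin

lemma speed: "(\<lambda>s. C * norm (v s)) integrable_on {0..1}" "integral {0..1} (\<lambda>s. C * norm (v s)) \<le> rate E"
proof -
  show "(\<lambda>s. C * norm (v s)) integrable_on {0..1}" by (intro integrable_on_mult_right L2_norm_integrable v)
  have "integral {0..1} (\<lambda>s. norm (v s)) \<le> 1 + E"
    using L2_norm_integral_le[OF v E, of 1 0 1] by simp
  then show "integral {0..1} (\<lambda>s. C * norm (v s)) \<le> rate E"
    using C by (simp add: rate_def mult_left_mono)
qed

lemma caratheodory_field: "caratheodory (\<lambda>s. \<iota> (v s)) (\<lambda>s. C * norm (v s)) (rate E)"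
  by unfold_locales (use speed C lip bound measurable_field[OF _ v] in \<open>auto\<close>)

text \<open>The base curve \<open>c\<close> is arbitrary: the comparison of differentials also
  linearizes \<open>v\<close> along a flow line of another curve of fields.\<close>

lemma caratheodory_D_field:
  assumes "continuous_on {0..1} c"
  shows "caratheodory (\<lambda>s. D\<iota> (v s) (c s)) (\<lambda>s. C * norm (v s)) (rate E)"
  by unfold_locales
    (use speed C D_bound measurable_D_field[OF assms _ v] in
      \<open>auto simp: linear_0[OF D_linear] simp flip: linear_diff[OF D_linear]\<close>)

text \<open>Uniqueness of solutions makes the definite description in \<open>flow\<close>
  meaningful.\<close>

lemma flow_eq:
  assumes c: "solves (\<lambda>s. \<iota> (v s)) x c" and t: "t \<in> {0..1}"
  shows "flow \<iota> v t x = c t"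
  unfolding flow_def
proof (rule the_equality)
  show "\<exists>c'. flow_curve \<iota> v x c' \<and> c' t = c t"
    using c unfolding flow_curve_def solves_def by blast
  fix y assume "\<exists>c'. flow_curve \<iota> v x c' \<and> c' t = y"
  then obtain c' where "solves (\<lambda>s. \<iota> (v s)) x c'" "c' t = y"
    unfolding flow_curve_def solves_def by blast
  then show "y = c t" using caratheodory.unique[OF caratheodory_field c _ t] by simp
qed

lemma ex_curve: "\<exists>c. solves (\<lambda>s. \<iota> (v s)) x c"
  by (rule caratheodory.solution_exists[OF caratheodory_field])

text \<open>The derivative of the flow is the solution of the linearized equation: by Taylor's formula
  the difference of two flow lines solves it up to a quadratic defect.\<close>

lemma flow_derivative:
  assumes c: "solves (\<lambda>s. \<iota> (v s)) x c"
  obtains L where "(flow \<iota> v 1 has_derivative L) (at x)" "inj L" "\<And>h. norm (L h) \<le> amp E * norm h"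
    "\<And>h y. solves (\<lambda>s. D\<iota> (v s) (c s)) h y \<Longrightarrow> L h = y 1"
proof -
  have cc: "continuous_on {0..1} c" by (rule solves_continuous[OF c])
  interpret F: caratheodory "\<lambda>s. \<iota> (v s)" "\<lambda>s. C * norm (v s)" "rate E" by (rule caratheodory_field)
  interpret D: caratheodory "\<lambda>s. D\<iota> (v s) (c s)" "\<lambda>s. C * norm (v s)" "rate E"
    by (rule caratheodory_D_field[OF cc])
  obtain Y where Y: "\<And>h. solves (\<lambda>s. D\<iota> (v s) (c s)) h (Y h)" using D.solution_exists by metis
  define L where "L h = Y h 1" for h
  have L_eq: "L h = y 1" if "solves (\<lambda>s. D\<iota> (v s) (c s)) h y" for h y
    unfolding L_def using D.unique[OF that Y, of 1] by simp
  \<comment> \<open>Combinations of solutions of the linearized equation solve it again; with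
    uniqueness this makes the time-one map \<open>L\<close> linear.\<close>
  have lincomb: "solves (\<lambda>s. D\<iota> (v s) (c s)) (a *\<^sub>R h + b *\<^sub>R k) (\<lambda>t. a *\<^sub>R Y h t + b *\<^sub>R Y k t)" for a b h k
    unfolding solves_def
  proof
    fix t :: real assume t: "t \<in> {0..1}"
    have "((\<lambda>s. a *\<^sub>R D\<iota> (v s) (c s) (Y h s) + b *\<^sub>R D\<iota> (v s) (c s) (Y k s)) has_integral
        (a *\<^sub>R (Y h t - h) + b *\<^sub>R (Y k t - k))) {0..t}"
      using Y[of h] Y[of k] t unfolding solves_def by (intro has_integral_add has_integral_cmul) auto
    then show "((\<lambda>s. D\<iota> (v s) (c s) (a *\<^sub>R Y h s + b *\<^sub>R Y k s)) has_integral
        (a *\<^sub>R Y h t + b *\<^sub>R Y k t - (a *\<^sub>R h + b *\<^sub>R k))) {0..t}"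
      by (simp add: linear_add[OF D_linear] linear_scale[OF D_linear] algebra_simps)
  qed
  have L_lin: "linear L"
  proof (rule linearI)
    show "L (h + k) = L h + L k" for h k using L_eq[OF lincomb[of 1 h 1 k]] by (simp add: L_def)
    show "L (a *\<^sub>R h) = a *\<^sub>R L h" for a h using L_eq[OF lincomb[of a h 0 h]] by (simp add: L_def)
  qed
  have zero: "solves (\<lambda>s. D\<iota> (v s) (c s)) 0 (\<lambda>_. 0)"
    unfolding solves_def by (simp add: linear_0[OF D_linear])
  have L_bound: "norm (L h) \<le> amp E * norm h" for h
    using D.stability_start[OF zero Y[of h], of 1] by (simp add: L_def amp_def)
  have L_inj: "inj L"
    unfolding linear_injective_0[OF L_lin]
  proof (intro allI impI)
    fix h assume "L h = 0"
    then show "h = 0"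
      by (intro solves_injective[OF F.m(1,2) _ Y[of h]]) (auto simp: L_def D_bound)
  qed
  \<comment> \<open>Flow lines starting \<open>h\<close> apart stay within
    \<open>amp E * norm h\<close>; the Taylor remainder integrates to at most \<open>rate E\<close>
    times the square of this, and stability multiplies the defect by another
    \<open>amp E\<close>.\<close>
  define B where "B = amp E * (rate E * (amp E)\<^sup>2)"
  have quad: "norm (flow \<iota> v 1 (x + h) - flow \<iota> v 1 x - L h) \<le> B * (norm h)\<^sup>2" for h
  proof -
    obtain c' where c': "solves (\<lambda>s. \<iota> (v s)) (x + h) c'" using ex_curve[of "x + h"] ..
    have cc': "continuous_on {0..1} c'" by (rule solves_continuous[OF c'])
    have near: "norm (c' t - c t) \<le> amp E * norm h" if "t \<in> {0..1}" for t
      using F.stability_start[OF c c' that] by (simp add: amp_def)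
    have cd: "continuous_on {0..1} (\<lambda>t. c' t - c t)" by (intro continuous_intros cc cc')
    have "norm ((c' 1 - c 1) - Y h 1) \<le> gron (rate E) * (rate E * (amp E * norm h)\<^sup>2)"
    proof (rule D.stability[OF Y cd])
      fix t :: real assume t: "t \<in> {0..1}"
      have i: "(\<lambda>s. \<iota> (v s) (c' s)) integrable_on {0..t}" "(\<lambda>s. \<iota> (v s) (c s)) integrable_on {0..t}"
        "(\<lambda>s. D\<iota> (v s) (c s) (c' s - c s)) integrable_on {0..t}"
        using t by (auto intro!: F.g_integrable D.g_integrable cc cc' cd)
      have "c' t - c t - h - integral {0..t} (\<lambda>s. D\<iota> (v s) (c s) (c' s - c s))
          = integral {0..t} (\<lambda>s. \<iota> (v s) (c' s) - \<iota> (v s) (c s) - D\<iota> (v s) (c s) (c' s - c s))"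
        using solves_eq[OF c t] solves_eq[OF c' t] i
        by (simp add: hk_integral_diff hk_integrable_diff)
      also have "norm \<dots> \<le> integral {0..t} (\<lambda>s. C * norm (v s) * (amp E * norm h)\<^sup>2)"
      proof (rule hk_integral_norm_bound_integral)
        show "(\<lambda>s. C * norm (v s) * (amp E * norm h)\<^sup>2) integrable_on {0..t}"
          using t by (intro integrable_on_mult_left F.m_sub) auto
        fix s assume "s \<in> {0..t}"
        then have "norm (c' s - c s) \<le> amp E * norm h" using near t by auto
        then have "C * norm (v s) * (norm (c' s - c s))\<^sup>2 \<le> C * norm (v s) * (amp E * norm h)\<^sup>2"
          using C by (intro mult_left_mono power_mono) auto
        then show "norm (\<iota> (v s) (c' s) - \<iota> (v s) (c s) - D\<iota> (v s) (c s) (c' s - c s))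
            \<le> C * norm (v s) * (amp E * norm h)\<^sup>2"
          using taylor[of "v s" "c' s" "c s"] by linarith
      qed (use i in \<open>auto intro!: hk_integrable_diff\<close>)
      also have "\<dots> = integral {0..t} (\<lambda>s. C * norm (v s)) * (amp E * norm h)\<^sup>2" by simp
      also have "\<dots> \<le> rate E * (amp E * norm h)\<^sup>2"
        by (intro mult_right_mono F.m_integral_le t) simp
      finally show "norm (c' t - c t - h - integral {0..t} (\<lambda>s. D\<iota> (v s) (c s) (c' s - c s)))
          \<le> rate E * (amp E * norm h)\<^sup>2" .
    qed (use F.R_nonneg in auto)
    then show ?thesis
      using flow_eq[OF c, of 1] flow_eq[OF c', of 1]
      by (simp add: L_def B_def amp_def power_mult_distrib mult_ac)
  qed
  have "(flow \<iota> v 1 has_derivative L) (at x)"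
    unfolding has_derivative_at
  proof
    show "bounded_linear L" using L_lin by (simp add: linear_conv_bounded_linear)
    have lim: "((\<lambda>h. B * norm h) \<longlongrightarrow> 0) (at (0::'a))"
      by (intro tendsto_mult_right_zero tendsto_norm_zero tendsto_ident_at)
    show "(\<lambda>h. norm (flow \<iota> v 1 (x + h) - flow \<iota> v 1 x - L h) / norm h) \<midarrow>0\<rightarrow> 0"
    proof (rule Lim_null_comparison[OF always_eventually lim], rule allI)
      fix h
      show "norm (norm (flow \<iota> v 1 (x + h) - flow \<iota> v 1 x - L h) / norm h) \<le> B * norm h"
        using quad[of h] by (cases "h = 0") (simp_all add: divide_le_eq power2_eq_square mult_ac)
    qed
  qed
  then show ?thesis by (rule that[of L, OF _ L_inj L_bound]) (rule L_eq)
qed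

end

text \<open>Both claims insert the limit solution into the equation of \<open>V n\<close> and
  estimate its defect. For the linearized equation the defect splits at
  \<open>D\<iota> (V n s) (c s) (y s)\<close>: the part with changing field is small by weak
  convergence, the part with changing base curve by \<open>D_lip\<close> and the uniform convergence
  of flow lines.\<close>

lemma flow_weakly_continuous:
  assumes V: "\<And>n. L2 unit_time (V n)" and v: "L2 unit_time v" and weak: "weakly_L2 unit_time V v"
    and EV: "\<And>n. (L2_sq unit_time (V n)) \<le> E" and Ev: "(L2_sq unit_time v) \<le> E"
  shows "(\<lambda>n. flow \<iota> (V n) 1 x) \<longlonglongrightarrow> flow \<iota> v 1 x"
    and "(\<lambda>n. frechet_derivative (flow \<iota> (V n) 1) (at x) h) \<longlonglongrightarrow> frechet_derivative (flow \<iota> v 1) (at x) h"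
proof -
  obtain c where c: "solves (\<lambda>s. \<iota> (v s)) x c" using ex_curve[OF v Ev, of x] ..
  have "\<forall>n. \<exists>c. solves (\<lambda>s. \<iota> (V n s)) x c" using ex_curve[OF V EV] by simp
  from choice[OF this] obtain cn where "\<forall>n. solves (\<lambda>s. \<iota> (V n s)) x (cn n)" ..
  then have cn: "solves (\<lambda>s. \<iota> (V n s)) x (cn n)" for n ..
  have cc: "continuous_on {0..1} c" by (rule solves_continuous[OF c])
  have ccn: "continuous_on {0..1} (cn n)" for n by (rule solves_continuous[OF cn])
  interpret F: caratheodory "\<lambda>s. \<iota> (v s)" "\<lambda>s. C * norm (v s)" "rate E" by (rule caratheodory_field[OF v Ev])
  interpret Fn: caratheodory "\<lambda>s. \<iota> (V n s)" "\<lambda>s. C * norm (V n s)" "rate E" for n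
    by (rule caratheodory_field[OF V EV])
  interpret D: caratheodory "\<lambda>s. D\<iota> (v s) (c s)" "\<lambda>s. C * norm (v s)" "rate E"
    by (rule caratheodory_D_field[OF v Ev cc])
  interpret Dn: caratheodory "\<lambda>s. D\<iota> (V n s) (cn n s)" "\<lambda>s. C * norm (V n s)" "rate E" for n
    by (rule caratheodory_D_field[OF V EV ccn])
  interpret Dc: caratheodory "\<lambda>s. D\<iota> (V n s) (c s)" "\<lambda>s. C * norm (V n s)" "rate E" for n
    by (rule caratheodory_D_field[OF V EV cc])
  have amp: "0 < amp E" using amp_ge_1[of E] by linarith
  have curves: "\<forall>\<^sub>F n in sequentially. \<forall>t\<in>{0..1}. norm (c t - cn n t) \<le> \<epsilon>" if \<epsilon>: "0 < \<epsilon>" for \<epsilon>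
  proof -
    have "\<forall>\<^sub>F n in sequentially. \<forall>t\<in>{0..1}.
        norm (integral {0..t} (\<lambda>s. \<iota> (V n s) (c s)) - integral {0..t} (\<lambda>s. \<iota> (v s) (c s))) < \<epsilon> / amp E"
      by (rule weakly_L2_time_integral_uniform[where h="\<lambda>s w. \<iota> w (c s)",
            OF measurable_field[OF cc] lin bound C V v weak EV Ev])
        (use \<epsilon> amp in auto)
    then show ?thesis
    proof eventually_elim
      case (elim n)
      show ?case
      proof
        fix t :: real assume t: "t \<in> {0..1}"
        have "norm (c t - cn n t) \<le> gron (rate E) * (\<epsilon> / amp E)"
        proof (rule Fn.stability[OF cn cc _ _ t])
          fix t :: real assume t: "t \<in> {0..1}"
          have "c t - x - integral {0..t} (\<lambda>s. \<iota> (V n s) (c s))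
              = integral {0..t} (\<lambda>s. \<iota> (v s) (c s)) - integral {0..t} (\<lambda>s. \<iota> (V n s) (c s))"
            using solves_eq[OF c t] by simp
          then show "norm (c t - x - integral {0..t} (\<lambda>s. \<iota> (V n s) (c s))) \<le> \<epsilon> / amp E"
            using elim t by (simp add: norm_minus_commute less_imp_le)
        qed (use \<epsilon> amp in auto)
        then show "norm (c t - cn n t) \<le> \<epsilon>" using amp by (simp add: amp_def)
      qed
    qed
  qed
  show "(\<lambda>n. flow \<iota> (V n) 1 x) \<longlonglongrightarrow> flow \<iota> v 1 x"
  proof (rule tendstoI)
    fix \<epsilon> :: real assume "0 < \<epsilon>"
    then have "\<forall>\<^sub>F n in sequentially. \<forall>t\<in>{0..1}. norm (c t - cn n t) \<le> \<epsilon>/2" by (intro curves) simp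
    then show "\<forall>\<^sub>F n in sequentially. dist (flow \<iota> (V n) 1 x) (flow \<iota> v 1 x) < \<epsilon>"
    proof eventually_elim
      case (elim n)
      then have "norm (c 1 - cn n 1) \<le> \<epsilon>/2" by simp
      then show ?case using \<open>0 < \<epsilon>\<close> flow_eq[OF V EV cn, of 1] flow_eq[OF v Ev c, of 1]
        by (simp add: dist_norm norm_minus_commute)
    qed
  qed
  obtain y where y: "solves (\<lambda>s. D\<iota> (v s) (c s)) h y" using D.solution_exists[of h] ..
  have "\<forall>n. \<exists>y. solves (\<lambda>s. D\<iota> (V n s) (cn n s)) h y" using Dn.solution_exists by simp
  from choice[OF this] obtain yn where "\<forall>n. solves (\<lambda>s. D\<iota> (V n s) (cn n s)) h (yn n)" ..
  then have yn: "solves (\<lambda>s. D\<iota> (V n s) (cn n s)) h (yn n)" for n ..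
  have cy: "continuous_on {0..1} y" by (rule solves_continuous[OF y])
  obtain B where B: "\<forall>s\<in>{0..1}. norm (y s) \<le> B" using bounded_on_unit_interval[OF cy] by blast
  have B0: "0 \<le> B" by (rule order_trans[OF norm_ge_zero B[rule_format, of 0]]) simp
  have deriv: "frechet_derivative (flow \<iota> v 1) (at x) h = y 1"
  proof (rule flow_derivative[OF v Ev c])
    fix L assume "(flow \<iota> v 1 has_derivative L) (at x)"
      and "\<And>h y. solves (\<lambda>s. D\<iota> (v s) (c s)) h y \<Longrightarrow> L h = y 1"
    then show ?thesis using frechet_derivative_at[of "flow \<iota> v 1" L x] y by simp
  qed
  have derivn: "frechet_derivative (flow \<iota> (V n) 1) (at x) h = yn n 1" for n
  proof (rule flow_derivative[OF V EV cn])
    fix L assume "(flow \<iota> (V n) 1 has_derivative L) (at x)"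
      and "\<And>h y. solves (\<lambda>s. D\<iota> (V n s) (cn n s)) h y \<Longrightarrow> L h = y 1"
    then show ?thesis using frechet_derivative_at[of "flow \<iota> (V n) 1" L x] yn[of n] by simp
  qed
  have near: "\<forall>\<^sub>F n in sequentially. norm (y 1 - yn n 1) \<le> \<epsilon>" if \<epsilon>: "0 < \<epsilon>" for \<epsilon>
  proof -
    \<comment> \<open>Each of the two parts of the defect is to be at most \<open>e1\<close>, so
      that the factor \<open>amp E\<close> returns \<open>\<epsilon>\<close>; \<open>e2\<close> is
      the closeness of flow lines that achieves this for the part with changing base curve.\<close>
    define e1 where "e1 = \<epsilon> / (2 * amp E)"
    have e': "0 < e1" using \<epsilon> amp by (simp add: e1_def)
    define e2 where "e2 = e1 / (rate E * B + 1)"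
    have rB: "0 \<le> rate E * B" using F.R_nonneg B0 by simp
    have e'': "0 < e2" using e' rB by (simp add: e2_def)
    have e3: "rate E * e2 * B \<le> e1"
      using rB e' by (simp add: e2_def divide_le_eq)
    have Dy: "norm (D\<iota> w (c s) (y s)) \<le> C * B * norm w" if "s \<in> {0..1}" for s w
    proof -
      have "C * norm w * norm (y s) \<le> C * norm w * B" using B that C by (intro mult_left_mono) auto
      then show ?thesis using D_bound[of w "c s" "y s"] by (simp add: mult_ac)
    qed
    let ?I = "\<lambda>u e t. integral {0..t} (\<lambda>s. D\<iota> (u s) (e s) (y s))"
    have "\<forall>\<^sub>F n in sequentially. \<forall>t\<in>{0..1}.
        norm (?I (V n) c t - ?I v c t) < e1"
      by (rule weakly_L2_time_integral_uniform[where h="\<lambda>s w. D\<iota> w (c s) (y s)",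
            OF measurable_D_field[OF cc cy] D_lin Dy _ V v weak EV Ev e'])
        (use C B0 in auto)
    with curves[OF e''] show ?thesis
    proof eventually_elim
      case (elim n)
      have "norm (y 1 - yn n 1) \<le> gron (rate E) * (2 * e1)"
      proof (rule Dn.stability[OF yn cy])
        fix t :: real assume t: "t \<in> {0..1}"
        have i: "(\<lambda>s. D\<iota> (V n s) (c s) (y s)) integrable_on {0..t}"
          "(\<lambda>s. D\<iota> (V n s) (cn n s) (y s)) integrable_on {0..t}"
          using t by (auto intro!: Dc.g_integrable Dn.g_integrable cy)
        have "norm (?I (V n) c t - ?I (V n) (cn n) t)
          = norm (integral {0..t} (\<lambda>s. D\<iota> (V n s) (c s) (y s) - D\<iota> (V n s) (cn n s) (y s)))"
          using i by (simp add: hk_integral_diff)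
        also have "\<dots> \<le> integral {0..t} (\<lambda>s. C * norm (V n s) * (e2 * B))"
        proof (rule hk_integral_norm_bound_integral)
          show "(\<lambda>s. C * norm (V n s) * (e2 * B)) integrable_on {0..t}"
            using t by (intro integrable_on_mult_left Fn.m_sub) auto
          fix s assume "s \<in> {0..t}"
          then have s: "s \<in> {0..1}" using t by auto
          have "norm (D\<iota> (V n s) (c s) (y s) - D\<iota> (V n s) (cn n s) (y s))
              \<le> C * norm (V n s) * norm (c s - cn n s) * norm (y s)" by (rule D_lip)
          also have "\<dots> \<le> C * norm (V n s) * e2 * B"
            using elim(1) s B C e'' by (intro mult_mono mult_left_mono) auto
          finally show "norm (D\<iota> (V n s) (c s) (y s) - D\<iota> (V n s) (cn n s) (y s)) \<le> C * norm (V n s) * (e2 * B)"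
            by (simp add: mult.assoc)
        qed (use i in \<open>auto intro!: hk_integrable_diff\<close>)
        also have "\<dots> = integral {0..t} (\<lambda>s. C * norm (V n s)) * (e2 * B)" by simp
        also have "\<dots> \<le> rate E * (e2 * B)"
          using e'' B0 by (intro mult_right_mono Fn.m_integral_le t) auto
        also have "\<dots> \<le> e1" using e3 by (simp add: mult.assoc)
        finally have 1: "norm (?I (V n) c t
          - ?I (V n) (cn n) t) \<le> e1" .
        have 2: "norm (?I v c t - ?I (V n) c t) \<le> e1"
          using elim(2) t by (simp add: norm_minus_commute less_imp_le)
        have "y t - h - ?I (V n) (cn n) t
            = (?I v c t - ?I (V n) c t)
             + (?I (V n) c t - ?I (V n) (cn n) t)"
          using solves_eq[OF y t] by simp
        then show "norm (y t - h - ?I (V n) (cn n) t) \<le> 2 * e1"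
          using norm_triangle_mono[OF 2 1] by simp
      qed (use e' in auto)
      then show ?case using amp by (simp add: amp_def e1_def)
    qed
  qed
  have "(\<lambda>n. yn n 1) \<longlonglongrightarrow> y 1"
  proof (rule tendstoI)
    fix \<epsilon> :: real assume \<epsilon>: "0 < \<epsilon>"
    then have "\<forall>\<^sub>F n in sequentially. norm (y 1 - yn n 1) \<le> \<epsilon>/2" by (intro near) simp
    then show "\<forall>\<^sub>F n in sequentially. dist (yn n 1) (y 1) < \<epsilon>"
      by eventually_elim (use \<epsilon> in \<open>simp add: dist_norm norm_minus_commute\<close>)
  qed
  then show "(\<lambda>n. frechet_derivative (flow \<iota> (V n) 1) (at x) h) \<longlonglongrightarrow> frechet_derivative (flow \<iota> v 1) (at x) h"
    unfolding deriv derivn .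
qed

end

section \<open>The Cauchy-Binet formula and the oriented Grassmannian\<close>

abbreviation mdet :: "nat \<Rightarrow> (nat \<Rightarrow> nat \<Rightarrow> real) \<Rightarrow> real" where
  "mdet d F \<equiv> Determinant.det (Matrix.mat d d (\<lambda>(i, j). F i j))"

lemma mdet_Leibniz: "mdet d F = (\<Sum>p | p permutes {0..<d}. of_int (sign p) * (\<Prod>i=0..<d. F i (p i)))"
proof -
  have "mdet d F = (\<Sum>p | p permutes {0..<d}. of_int (sign p) * (\<Prod>i=0..<d. Matrix.mat d d (\<lambda>(i, j). F i j) $$ (i, p i)))"
    by (rule det_def') simp
  also have "\<dots> = (\<Sum>p | p permutes {0..<d}. of_int (sign p) * (\<Prod>i=0..<d. F i (p i)))"
  proof (rule sum.cong[OF refl])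
    fix p assume "p \<in> {p. p permutes {0..<d}}"
    then have "p i < d" if "i < d" for i using permutes_in_image[of p "{0..<d}" i] that by auto
    then show "of_int (sign p) * (\<Prod>i=0..<d. Matrix.mat d d (\<lambda>(i, j). F i j) $$ (i, p i))
        = of_int (sign p) * (\<Prod>i=0..<d. F i (p i))"
      by simp
  qed
  finally show ?thesis .
qed

lemma mdet_cong: "(\<And>i j. i < d \<Longrightarrow> j < d \<Longrightarrow> F i j = G i j) \<Longrightarrow> mdet d F = mdet d G"
  by (rule arg_cong[of _ _ Determinant.det]) (auto intro!: eq_matI)

lemma mdet_transpose: "mdet d (\<lambda>i j. F j i) = mdet d F"
proof -
  have "mdet d (\<lambda>i j. F j i) = Determinant.det (transpose_mat (Matrix.mat d d (\<lambda>(i, j). F i j)))"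
    by (rule arg_cong[of _ _ Determinant.det]) (auto intro!: eq_matI)
  then show ?thesis by (simp add: det_transpose[of _ d])
qed

lemma mdet_permute: "p permutes {0..<d} \<Longrightarrow> mdet d (\<lambda>i j. F (p i) j) = of_int (sign p) * mdet d F"
proof -
  assume p: "p permutes {0..<d}"
  have "mdet d (\<lambda>i j. F (p i) j) = mdet d (\<lambda>i j. Matrix.mat d d (\<lambda>(i, j). F i j) $$ (p i, j))"
    using permutes_in_image[OF p] by (intro mdet_cong) auto
  then show ?thesis using det_permute_rows[OF _ p, of "Matrix.mat d d (\<lambda>(i, j). F i j)"] by simp
qed

lemma mdet_eq_0: "\<not> inj_on f {0..<d} \<Longrightarrow> mdet d (\<lambda>i. Y (f i)) = 0"
proof -
  assume "\<not> inj_on f {0..<d}"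
  then obtain i j where "i \<noteq> j" "i < d" "j < d" "f i = f j" by (auto simp: inj_on_def)
  then show ?thesis
    by (intro det_identical_rows[of _ d i j]) (auto intro!: eq_vecI)
qed

lemma mdet_mult: "mdet d (\<lambda>i j. \<Sum>k<d. F i k * G k j) = mdet d F * mdet d G"
proof -
  have "mdet d (\<lambda>i j. \<Sum>k<d. F i k * G k j)
      = Determinant.det (Matrix.mat d d (\<lambda>(i, j). F i j) * Matrix.mat d d (\<lambda>(i, j). G i j))"
    by (rule arg_cong[of _ _ Determinant.det]) (auto intro!: eq_matI simp: scalar_prod_def lessThan_atLeast0)
  then show ?thesis by (simp add: det_mult[of _ d])
qed

abbreviation enum :: "'n::finite set \<Rightarrow> nat \<Rightarrow> 'n" where
  "enum \<equiv> from_nat_into"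

lemma enum_bij: "card (J::'n::finite set) = d \<Longrightarrow> bij_betw (enum J) {0..<d} J"
  using bij_betw_from_nat_into_finite[of J] by (simp add: lessThan_atLeast0)

text \<open>Multiplying out the sums over \<open>a\<close> produces all maps \<open>f\<close> from
  row indices to \<open>UNIV\<close>. A noninjective one repeats a row of \<open>Y\<close> and
  contributes zero; an injective one is uniquely \<open>enum J\<close> after a permutation, with
  \<open>J\<close> its image. For fixed \<open>J\<close> the sum over permutations is the Leibniz
  formula for the minor of \<open>X\<close>.\<close>

lemma Cauchy_Binet:
  fixes X :: "nat \<Rightarrow> 'n::finite \<Rightarrow> real"
  shows "mdet d (\<lambda>i j. \<Sum>a\<in>UNIV. X i a * Y a j)
    = (\<Sum>J | card J = d. mdet d (\<lambda>i k. X i (enum J k)) * mdet d (\<lambda>k j. Y (enum J k) j))"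
proof -
  let ?N = "{0..<d}" and ?P = "{p. p permutes {0..<d}}"
  let ?G = "\<lambda>f. (\<Prod>i\<in>?N. X i (f i)) * mdet d (\<lambda>i. Y (f i))"
  let ?c = "\<lambda>(J :: 'n set, p). restrict (enum J \<circ> p) ?N"
  have "mdet d (\<lambda>i j. \<Sum>a\<in>UNIV. X i a * Y a j)
      = (\<Sum>p\<in>?P. of_int (sign p) * (\<Sum>f\<in>?N \<rightarrow>\<^sub>E UNIV. \<Prod>i\<in>?N. X i (f i) * Y (f i) (p i)))"
    unfolding mdet_Leibniz by (simp add: prod_sum_PiE)
  also have "\<dots> = (\<Sum>f\<in>?N \<rightarrow>\<^sub>E UNIV. \<Sum>p\<in>?P. (\<Prod>i\<in>?N. X i (f i)) * (of_int (sign p) * (\<Prod>i\<in>?N. Y (f i) (p i))))"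
    by (subst sum.swap) (simp add: sum_distrib_left prod.distrib mult_ac)
  also have "\<dots> = (\<Sum>f\<in>?N \<rightarrow>\<^sub>E UNIV. ?G f)"
    unfolding mdet_Leibniz by (simp add: sum_distrib_left)
  also have "\<dots> = (\<Sum>f\<in>{f \<in> ?N \<rightarrow>\<^sub>E UNIV. inj_on f ?N}. ?G f)"
    by (rule sum.mono_neutral_right) (auto intro!: finite_PiE simp: mdet_eq_0)
  also have "\<dots> = (\<Sum>x\<in>{J. card J = d} \<times> ?P. ?G (?c x))"
  proof (rule sum.reindex_bij_betw[symmetric], rule bij_betw_byWitness)
    let ?J = "\<lambda>f. f ` ?N"
    \<comment> \<open>The inverse sends \<open>f\<close> to its image and to the permutation
      comparing \<open>f\<close> with the enumeration of that image; \<open>restrict\<close> in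
      \<open>?c\<close> and the identity outside \<open>?N\<close> make both compositions exact
      equalities of functions.\<close>
    let ?w = "\<lambda>f :: nat \<Rightarrow> 'n. (?J f, \<lambda>i. if i \<in> ?N then the_inv_into ?N (enum (?J f)) (f i) else i)"
    have inv: "the_inv_into ?N (enum J) a \<in> ?N" "enum J (the_inv_into ?N (enum J) a) = a"
      if "card J = d" "a \<in> J" for J a
    proof -
      have e: "inj_on (enum J) ?N" "enum J ` ?N = J" using enum_bij[OF that(1)] by (auto simp: bij_betw_def)
      show "the_inv_into ?N (enum J) a \<in> ?N" by (rule the_inv_into_into[OF e(1)]) (use e(2) that(2) in simp_all)
      show "enum J (the_inv_into ?N (enum J) a) = a" by (rule f_the_inv_into_f[OF e(1)]) (use e(2) that(2) in simp)
    qed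
    have im: "?c (J, p) ` ?N = J" if "card J = d" "p permutes ?N" for J p
    proof -
      have "?c (J, p) ` ?N = enum J ` p ` ?N" by (auto simp: image_image)
      then show ?thesis
        using bij_betw_imp_surj_on[OF enum_bij[OF that(1)]] permutes_image[OF that(2)] by simp
    qed
    show "\<forall>x\<in>{J. card J = d} \<times> ?P. ?w (?c x) = x"
    proof
      fix x assume "x \<in> {J :: 'n set. card J = d} \<times> ?P"
      then obtain J p where x: "x = (J, p)" and Jp: "card J = d" "p permutes ?N" by (cases x) simp
      have "(if i \<in> ?N then the_inv_into ?N (enum (?J (?c (J, p)))) (?c (J, p) i) else i) = p i" for i
        using permutes_not_in[OF Jp(2), of i] permutes_in_image[OF Jp(2), of i]
          the_inv_into_f_f[of "enum J" ?N "p i"] enum_bij[OF Jp(1)]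
        unfolding im[OF Jp] by (auto simp: bij_betw_def)
      then show "?w (?c x) = x" unfolding x using im[OF Jp] by (auto simp: fun_eq_iff)
    qed
    show "\<forall>f\<in>{f \<in> ?N \<rightarrow>\<^sub>E UNIV. inj_on f ?N}. ?c (?w f) = f"
    proof
      fix f :: "nat \<Rightarrow> 'n" assume "f \<in> {f \<in> ?N \<rightarrow>\<^sub>E UNIV. inj_on f ?N}"
      then have f: "f \<in> ?N \<rightarrow>\<^sub>E UNIV" "inj_on f ?N" by simp_all
      have c: "card (f ` ?N) = d" using card_image[OF f(2)] by simp
      show "?c (?w f) = f"
      proof
        fix i show "?c (?w f) i = f i"
        proof (cases "i \<in> ?N")
          case True
          then show ?thesis using inv(2)[OF c imageI] by simp
        next
          case False
          then show ?thesis using PiE_arb[OF f(1)] by simp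
        qed
      qed
    qed
    show "?c ` ({J. card J = d} \<times> ?P) \<subseteq> {f \<in> ?N \<rightarrow>\<^sub>E UNIV. inj_on f ?N}"
    proof (rule image_subsetI)
      fix x assume "x \<in> {J :: 'n set. card J = d} \<times> ?P"
      then obtain J p where x: "x = (J, p)" and Jp: "card J = d" "p permutes ?N" by (cases x) simp
      have "inj_on (enum J \<circ> p) ?N"
        using enum_bij[OF Jp(1)] permutes_image[OF Jp(2)] permutes_inj_on[OF Jp(2)]
        by (intro comp_inj_on) (auto simp: bij_betw_def)
      then show "?c x \<in> {f \<in> ?N \<rightarrow>\<^sub>E UNIV. inj_on f ?N}"
        unfolding x by (auto simp: inj_on_def)
    qed
    show "?w ` {f \<in> ?N \<rightarrow>\<^sub>E UNIV. inj_on f ?N} \<subseteq> {J. card J = d} \<times> ?P"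
    proof (rule image_subsetI)
      fix f :: "nat \<Rightarrow> 'n" assume "f \<in> {f \<in> ?N \<rightarrow>\<^sub>E UNIV. inj_on f ?N}"
      then have f: "inj_on f ?N" by simp
      have c: "card (f ` ?N) = d" using card_image[OF f] by simp
      let ?p = "\<lambda>i. if i \<in> ?N then the_inv_into ?N (enum (f ` ?N)) (f i) else i"
      have e: "enum (f ` ?N) (?p i) = f i" if "i \<in> ?N" for i
        using inv(2)[OF c imageI[OF that]] that by simp
      have inj: "inj_on ?p ?N"
      proof (rule inj_onI)
        fix i j assume ij: "i \<in> ?N" "j \<in> ?N" "?p i = ?p j"
        then have "f i = f j" using e[OF ij(1)] e[OF ij(2)] by (simp only:)
        then show "i = j" using f ij by (auto dest: inj_onD)
      qed
      have "?p ` ?N \<subseteq> ?N" using inv(1)[OF c] by auto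
      then have "?p ` ?N = ?N" by (intro endo_inj_surj inj) simp_all
      with inj have "bij_betw ?p ?N ?N" by (rule bij_betw_imageI)
      then have "?p permutes ?N" by (rule bij_imp_permutes) auto
      then show "?w f \<in> {J. card J = d} \<times> ?P" using c by simp
    qed
  qed
  also have "\<dots> = (\<Sum>J | card J = d. \<Sum>p\<in>?P. ?G (?c (J, p)))"
    by (simp only: sum.cartesian_product split_def fst_conv snd_conv)
  also have "\<dots> = (\<Sum>J | card J = d. mdet d (\<lambda>i k. X i (enum J k)) * mdet d (\<lambda>k j. Y (enum J k) j))"
  proof (rule sum.cong[OF refl])
    fix J :: "'n set"
    have G: "?G (?c (J, p)) = of_int (sign p) * (\<Prod>i\<in>?N. X i (enum J (p i))) * mdet d (\<lambda>k j. Y (enum J k) j)"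
      if p: "p permutes ?N" for p
    proof -
      have "mdet d (\<lambda>i. Y (?c (J, p) i)) = mdet d (\<lambda>i. Y (enum J (p i)))" by (rule mdet_cong) simp
      also have "\<dots> = of_int (sign p) * mdet d (\<lambda>k j. Y (enum J k) j)"
        using mdet_permute[OF p, of "\<lambda>k. Y (enum J k)"] by simp
      finally show ?thesis by simp
    qed
    have "(\<Sum>p\<in>?P. ?G (?c (J, p)))
        = (\<Sum>p\<in>?P. of_int (sign p) * (\<Prod>i\<in>?N. X i (enum J (p i))) * mdet d (\<lambda>k j. Y (enum J k) j))"
      by (rule sum.cong[OF refl], rule G) simp
    then show "(\<Sum>p\<in>?P. ?G (?c (J, p))) = mdet d (\<lambda>i k. X i (enum J k)) * mdet d (\<lambda>k j. Y (enum J k) j)"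
      unfolding mdet_Leibniz[of d "\<lambda>i k. X i (enum J k)"] by (simp only: sum_distrib_right)
  qed
  finally show ?thesis .
qed

text \<open>The \<open>d\<close>-th exterior power of \<open>A\<close> in coordinates (compound
  matrix): its entries are the \<open>d\<close> by \<open>d\<close> minors of \<open>A\<close>. It
  acts on all \<open>d\<close>-vectors, so no frame appears.\<close>

definition wedge_map :: "nat \<Rightarrow> real^'n^'n \<Rightarrow> real^('n::finite set) \<Rightarrow> real^('n set)" where
  "wedge_map d A U = (\<chi> I. if card I = d
     then \<Sum>J | card J = d. mdet d (\<lambda>i k. A $ enum I i $ enum J k) * U $ J else 0)"

text \<open>Cauchy-Binet for the rows of \<open>A\<close> in \<open>I\<close> times the matrix with
  columns \<open>u j\<close>.\<close>

lemma wedge_matrix: "wedge d (\<lambda>j. A *v u j) = wedge_map d A (wedge d u)"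
proof -
  have "mdet d (\<lambda>i j. (A *v u j) $ enum I i)
      = (\<Sum>J | card J = d. mdet d (\<lambda>i k. A $ enum I i $ enum J k) * mdet d (\<lambda>k j. u j $ enum J k))" for I
    unfolding matrix_vector_mult_def
    using Cauchy_Binet[of d "\<lambda>i a. A $ enum I i $ a" "\<lambda>a j. u j $ a"] by simp
  then show ?thesis unfolding wedge_def wedge_map_def by (simp add: Finite_Cartesian_Product.vec_eq_iff)
qed

text \<open>Cauchy-Binet for a matrix and its transpose: the Gram determinant is the sum of squared
  minors, which are the coordinates of the \<open>d\<close>-vector.\<close>

lemma gram_det: "mdet d (\<lambda>i j. inner (w i) (w j)) = (norm (wedge d (w :: nat \<Rightarrow> real^'n)))\<^sup>2"
proof -
  have "mdet d (\<lambda>i j. inner (w i) (w j)) = mdet d (\<lambda>i j. \<Sum>a\<in>UNIV. w i $ a * w j $ a)"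
    by (simp add: inner_vec_def)
  also have "\<dots> = (\<Sum>J | card J = d. mdet d (\<lambda>i k. w i $ enum J k) * mdet d (\<lambda>k j. w j $ enum J k))"
    by (rule Cauchy_Binet)
  also have "\<dots> = (\<Sum>J | card J = d. (wedge d w $ J)\<^sup>2)"
  proof (rule sum.cong[OF refl])
    fix J :: "'n set" assume "J \<in> {J. card J = d}"
    then show "mdet d (\<lambda>i k. w i $ enum J k) * mdet d (\<lambda>k j. w j $ enum J k) = (wedge d w $ J)\<^sup>2"
      using mdet_transpose[of d "\<lambda>k j. w j $ enum J k"] by (simp add: wedge_def power2_eq_square)
  qed
  also have "\<dots> = (\<Sum>J\<in>UNIV. (wedge d w $ J)\<^sup>2)"
    by (rule sum.mono_neutral_left) (auto simp: wedge_def)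
  also have "\<dots> = (norm (wedge d w))\<^sup>2" unfolding power2_norm_eq_inner inner_vec_def by (simp add: power2_eq_square)
  finally show ?thesis .
qed

section \<open>Oriented subspaces as unit simple d-vectors\<close>

lemma norm_wedge_orthonormal:
  assumes "orthonormal_frame d (u :: nat \<Rightarrow> real^'n)" shows "norm (wedge d u) = 1"
proof -
  have "mdet d (\<lambda>i j. inner (u i) (u j)) = Determinant.det (1\<^sub>m d)"
    using assms by (intro arg_cong[of _ _ Determinant.det] eq_matI) (auto simp: orthonormal_frame_def)
  then have "(norm (wedge d u))\<^sup>2 = 1" using gram_det[of d u] by simp
  then show ?thesis by (simp add: abs_square_eq_1)
qed

lemma wedge_map_scale: "wedge_map d A (s *\<^sub>R U) = s *\<^sub>R wedge_map d A U"
  by (simp add: wedge_map_def Finite_Cartesian_Product.vec_eq_iff sum_distrib_left mult_ac)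

text \<open>Exposes the frame picked by \<open>SOME\<close> in \<open>jac\<close> and
  \<open>orient_image\<close>. The formulas proved through it mention \<open>U\<close> only, which
  also shows independence of the frame.\<close>

lemma ograss_frame:
  assumes "U \<in> ograss d"
  obtains s u where "(SOME p. orient_frame d U p) = (s, u)" "s \<in> {1, -1}" "orthonormal_frame d u" "U = s *\<^sub>R wedge d u"
proof -
  obtain s u where p: "(SOME p. orient_frame d U p) = (s, u)" by (rule prod.exhaust)
  have "orient_frame d U (SOME p. orient_frame d U p)"
    by (rule someI_ex) (use assms in \<open>simp add: ograss_def\<close>)
  then have "s \<in> {1, -1}" "orthonormal_frame d u" "U = s *\<^sub>R wedge d u"
    unfolding p by (simp_all add: orient_frame_def)
  with p show ?thesis by (rule that)
qed

lemma norm_ograss: "U \<in> ograss d \<Longrightarrow> norm U = 1"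
  by (auto simp: ograss_def orient_frame_def norm_wedge_orthonormal)

lemma jac_eq:
  assumes U: "U \<in> ograss d" and L: "linear L"
  shows "jac d L U = norm (wedge_map d (matrix L) U)"
proof (rule ograss_frame[OF U])
  fix s u assume p: "(SOME p. orient_frame d U p) = (s, u)" "s \<in> {1, -1}" "U = s *\<^sub>R wedge d u"
  have "jac d L U = sqrt ((norm (wedge d (\<lambda>i. L (u i))))\<^sup>2)"
    unfolding jac_def p(1) using gram_det[of d "\<lambda>i. L (u i)"] by simp
  also have "\<dots> = norm (wedge_map d (matrix L) (wedge d u))"
    using wedge_matrix[of d "matrix L" u] matrix_vector_mul(2)[OF L] by (simp add: fun_eq_iff)
  also have "\<dots> = norm (wedge_map d (matrix L) U)"
    using p(2) unfolding p(3) wedge_map_scale by auto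
  finally show ?thesis .
qed

lemma orient_image_eq:
  assumes U: "U \<in> ograss d" and L: "linear L"
  shows "orient_image d L U = sgn (wedge_map d (matrix L) U)"
proof (rule ograss_frame[OF U])
  fix s u assume p: "(SOME p. orient_frame d U p) = (s, u)" "s \<in> {1, -1}" "U = s *\<^sub>R wedge d u"
  have "orient_image d L U = s *\<^sub>R sgn (wedge_map d (matrix L) (wedge d u))"
    unfolding orient_image_def p(1)
    using wedge_matrix[of d "matrix L" u] matrix_vector_mul(2)[OF L] by (simp add: fun_eq_iff)
  also have "\<dots> = sgn (wedge_map d (matrix L) U)"
    using p(2) unfolding p(3) wedge_map_scale by (auto simp: sgn_scaleR sgn_minus)
  finally show ?thesis .
qed

text \<open>A linear left inverse of \<open>L\<close> induces a map on \<open>d\<close>-vectors that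
  recovers \<open>wedge d u\<close>, of norm \<open>1\<close>.\<close>

lemma wedge_map_nonzero:
  assumes U: "U \<in> ograss d" and L: "linear L" "inj L"
  shows "wedge_map d (matrix L) U \<noteq> 0"
proof (rule ograss_frame[OF U])
  fix s u assume p: "s \<in> {1, -1}" "U = s *\<^sub>R wedge d u" and u: "orthonormal_frame d u"
  obtain M where M: "linear M" "M \<circ> L = id" using linear_injective_left_inverse[OF L] by blast
  have "wedge d u = wedge d (\<lambda>i. matrix M *v (matrix L *v u i))"
    using matrix_vector_mul(2)[OF L(1)] matrix_vector_mul(2)[OF M(1)] M(2)
    by (simp add: fun_eq_iff)
  also have "\<dots> = wedge_map d (matrix M) (wedge_map d (matrix L) (wedge d u))"
    by (simp add: wedge_matrix)
  finally have "wedge_map d (matrix M) (wedge_map d (matrix L) (wedge d u)) \<noteq> 0"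
    using norm_wedge_orthonormal[OF u] by force
  moreover have "wedge_map d (matrix M) 0 = 0" using wedge_map_scale[of d "matrix M" 0 0] by simp
  ultimately have "wedge_map d (matrix L) (wedge d u) \<noteq> 0" by auto
  then show ?thesis using p by (auto simp: wedge_map_scale)
qed

text \<open>The images of the frame are expanded in an orthonormal basis \<open>e\<close> of their
  span, which has dimension \<open>d\<close> by injectivity. Multiplicativity of the determinant
  gives \<open>wedge d w = c *\<^sub>R wedge d e\<close>, and normalizing leaves a sign, which
  \<open>orient_frame\<close> absorbs.\<close>

lemma sgn_wedge_map_in_ograss:
  assumes U: "U \<in> ograss d" and L: "linear L" "inj (L :: real^'n \<Rightarrow> real^'n)"
  shows "sgn (wedge_map d (matrix L) U) \<in> ograss d"
proof (rule ograss_frame[OF U])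
  fix s u assume p: "s \<in> {1, -1}" "U = s *\<^sub>R wedge d u" and u: "orthonormal_frame d u"
  have uu: "inner (u i) (u j) = (if i = j then 1 else 0)" if "i < d" "j < d" for i j
    using u that by (simp add: orthonormal_frame_def)
  define w where "w i = L (u i)" for i
  have inj: "inj_on u {..<d}"
  proof (rule inj_onI)
    fix i j assume "i \<in> {..<d}" "j \<in> {..<d}" "u i = u j"
    then show "i = j" using uu[of i i] uu[of i j] by (auto split: if_splits)
  qed
  have "independent (u ` {..<d})"
  proof (rule pairwise_orthogonal_independent)
    show "pairwise real_inner_class.orthogonal (u ` {..<d})" using uu by (auto simp: pairwise_def real_inner_class.orthogonal_def)
    show "0 \<notin> u ` {..<d}" using uu by fastforce
  qed
  then have "independent (L ` u ` {..<d})"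
    using L by (intro linear_independent_injective_image) (auto intro: inj_on_subset)
  then have "dim (span (L ` u ` {..<d})) = card (L ` u ` {..<d})" by (rule dim_span_eq_card_independent)
  also have "\<dots> = d" using L(2) inj by (simp add: card_image inj_on_subset)
  finally have dim: "dim (span (L ` u ` {..<d})) = d" .
  obtain B where B: "pairwise real_inner_class.orthogonal B" "\<And>x. x \<in> B \<Longrightarrow> norm x = 1" "independent B"
      "card B = dim (span (L ` u ` {..<d}))" "span B = span (L ` u ` {..<d})"
    by (rule orthonormal_basis_subspace[OF subspace_span[of "L ` u ` {..<d}"]]) auto
  have fB: "finite B" by (rule independent_imp_finite[OF B(3)])
  obtain e where e: "bij_betw e {0..<d} B" using ex_bij_betw_nat_finite[OF fB] unfolding B(4) dim by (rule exE)
  have eB: "e i \<in> B" if "i < d" for i using e that by (auto simp: bij_betw_def)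
  have frame: "orthonormal_frame d e"
    unfolding orthonormal_frame_def
  proof (intro allI impI)
    fix i j assume ij: "i < d" "j < d"
    show "inner (e i) (e j) = (if i = j then 1 else 0)"
    proof (cases "i = j")
      case True
      then show ?thesis using B(2)[OF eB[OF ij(1)]] by (simp add: norm_eq_1)
    next
      case False
      then have "e i \<noteq> e j" using e ij by (auto simp: bij_betw_def inj_on_def)
      then show ?thesis using B(1) eB[OF ij(1)] eB[OF ij(2)] False by (auto simp: pairwise_def real_inner_class.orthogonal_def)
    qed
  qed
  define c where "c = mdet d (\<lambda>k j. inner (w j) (e k))"
  have expand: "w j = (\<Sum>k<d. inner (w j) (e k) *\<^sub>R e k)" if "j < d" for j
  proof -
    have "w j \<in> span B" unfolding B(5) w_def using that by (intro span_base) auto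
    then have "(\<Sum>b\<in>B. inner (w j) b *\<^sub>R b) = w j" by (intro orthonormal_basis_expand B(1,2) fB)
    then show ?thesis
      using sum.reindex_bij_betw[OF e, of "\<lambda>b. inner (w j) b *\<^sub>R b"] by (simp add: lessThan_atLeast0)
  qed
  have w: "wedge d w = c *\<^sub>R wedge d e"
  proof -
    have "mdet d (\<lambda>i j. w j $ enum I i) = mdet d (\<lambda>i k. e k $ enum I i) * c" for I
    proof -
      have "mdet d (\<lambda>i j. w j $ enum I i) = mdet d (\<lambda>i j. \<Sum>k<d. e k $ enum I i * inner (w j) (e k))"
        by (rule mdet_cong, subst expand) (simp_all add: mult.commute)
      then show ?thesis unfolding c_def by (simp only: mdet_mult)
    qed
    then show ?thesis by (simp add: wedge_def Finite_Cartesian_Product.vec_eq_iff)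
  qed
  have "wedge_map d (matrix L) U = s *\<^sub>R wedge d w"
    unfolding p(2) wedge_map_scale wedge_matrix[symmetric] w_def
    using matrix_vector_mul(2)[OF L(1)] by (simp add: fun_eq_iff)
  then have Uw: "wedge_map d (matrix L) U = (s * c) *\<^sub>R wedge d e" using w by simp
  then have "s * c \<noteq> 0" using wedge_map_nonzero[OF U L] by auto
  have "sgn (wedge_map d (matrix L) U) = sgn (s * c) *\<^sub>R wedge d e"
    unfolding Uw sgn_scaleR using norm_wedge_orthonormal[OF frame] by (simp add: sgn_div_norm)
  moreover have "sgn (s * c) \<in> {1, -1}" using \<open>s * c \<noteq> 0\<close> by (auto simp: sgn_if)
  ultimately show ?thesis using frame unfolding ograss_def orient_frame_def by auto
qed

lemma continuous_on_mdet:
  assumes "\<And>i j. i < d \<Longrightarrow> j < d \<Longrightarrow> continuous_on S (\<lambda>x. F x i j)"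
  shows "continuous_on S (\<lambda>x. mdet d (F x))"
  unfolding mdet_Leibniz
proof (intro continuous_intros)
  fix p i assume "p \<in> {p. p permutes {0..<d}}" "i \<in> {0..<d}"
  then show "continuous_on S (\<lambda>x. F x i (p i))"
    using permutes_in_image[of p "{0..<d}" i] by (intro assms) auto
qed

lemma continuous_on_wedge_map: "continuous_on S (\<lambda>x. wedge_map d (fst x) (snd x))"
  unfolding wedge_map_def
proof (intro continuous_on_vec_lambda)
  fix I :: "'a set"
  show "continuous_on S (\<lambda>x. if card I = d
    then \<Sum>J | card J = d. mdet d (\<lambda>i k. fst x $ enum I i $ enum J k) * snd x $ J else 0)"
    by (cases "card I = d") (auto intro!: continuous_intros continuous_on_mdet)
qed

section \<open>From the embedding to the estimates of \<open>field_space\<close>\<close>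

lemma field_space_if_C2_0_embedded:
  assumes emb: "C2_0_embedded (\<iota> :: 'v::{real_inner,complete_space} \<Rightarrow> 'a::euclidean_space \<Rightarrow> 'a)"
  shows "\<exists>D\<iota> C. field_space \<iota> D\<iota> C"
proof -
  have lin: "linear (\<lambda>v. \<iota> v x)" for x using emb unfolding C2_0_embedded_def by blast
  obtain C0 where "\<forall>v. \<exists>f' f''. C2_0 (\<iota> v) f' f'' \<and>
      (\<forall>x. norm (\<iota> v x) \<le> C0 * norm v \<and> norm (f' x) \<le> C0 * norm v \<and> norm (f'' x) \<le> C0 * norm v)"
    using emb unfolding C2_0_embedded_def by blast
  from choice[OF this] obtain f' where "\<forall>v. \<exists>f''. C2_0 (\<iota> v) (f' v) f'' \<and>
      (\<forall>x. norm (\<iota> v x) \<le> C0 * norm v \<and> norm (f' v x) \<le> C0 * norm v \<and> norm (f'' x) \<le> C0 * norm v)" ..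
  from choice[OF this] obtain f'' where f: "\<forall>v. C2_0 (\<iota> v) (f' v) (f'' v) \<and>
      (\<forall>x. norm (\<iota> v x) \<le> C0 * norm v \<and> norm (f' v x) \<le> C0 * norm v \<and> norm (f'' v x) \<le> C0 * norm v)" ..
  \<comment> \<open>\<open>C0\<close> could be negative if \<open>V\<close> is trivial;
    \<open>field_space\<close> asks for a nonnegative constant.\<close>
  define C where "C = max C0 0"
  have C: "C0 * norm v \<le> C * norm v" for v :: 'v unfolding C_def by (intro mult_right_mono) auto
  have C0: "0 \<le> C" by (simp add: C_def)
  have d1: "(\<iota> v has_derivative blinfun_apply (f' v x)) (at x)"
    and d2: "(f' v has_derivative blinfun_apply (f'' v x)) (at x)" for v x
    using f unfolding C2_0_def by blast+
  have b0: "norm (\<iota> v x) \<le> C * norm v" and b1: "norm (f' v x) \<le> C * norm v" and b2: "norm (f'' v x) \<le> C * norm v" for v x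
    using f C[of v] by (meson order_trans)+
  define D where "D v x = blinfun_apply (f' v x)" for v x
  have D1: "(\<iota> v has_derivative D v x) (at x)" for v x using d1 by (simp add: D_def)
  have f'_lip: "norm (f' v x - f' v y) \<le> C * norm v * norm (x - y)" for v x y
    by (rule differentiable_bound[of UNIV "f' v" "\<lambda>x. blinfun_apply (f'' v x)"])
      (use d2 b2 in \<open>auto simp: norm_blinfun.rep_eq[symmetric]\<close>)
  have "field_space \<iota> D C"
  proof (rule field_space.intro)
    show "0 \<le> C" by (rule C0)
    show "linear (\<lambda>v. \<iota> v x)" for x by (rule lin)
    \<comment> \<open>The embedding supplies a derivative for each \<open>v\<close> separately;
      linearity in \<open>v\<close> follows from uniqueness of derivatives.\<close>
    show "linear (\<lambda>v. D v x h)" for x h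
    proof (rule linearI)
      fix v w
      have "\<iota> (v + w) = (\<lambda>x. \<iota> v x + \<iota> w x)" by (simp add: fun_eq_iff linear_add[OF lin])
      then have "(\<iota> (v + w) has_derivative (\<lambda>h. D v x h + D w x h)) (at x)"
        using has_derivative_add[OF D1 D1] by simp
      from has_derivative_unique[OF D1 this] show "D (v + w) x h = D v x h + D w x h" by simp
    next
      fix r v
      have "\<iota> (r *\<^sub>R v) = (\<lambda>x. r *\<^sub>R \<iota> v x)" by (simp add: fun_eq_iff linear_scale[OF lin])
      then have "(\<iota> (r *\<^sub>R v) has_derivative (\<lambda>h. r *\<^sub>R D v x h)) (at x)"
        using has_derivative_scaleR_right[OF D1] by simp
      from has_derivative_unique[OF D1 this] show "D (r *\<^sub>R v) x h = r *\<^sub>R D v x h" by simp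
    qed
    show "linear (D v x)" for v x unfolding D_def by (rule bounded_linear.linear[OF blinfun.bounded_linear_right])
    show "norm (\<iota> v x) \<le> C * norm v" for v x by (rule b0)
    show "norm (D v x h) \<le> C * norm v * norm h" for v x h
      using norm_blinfun[of "f' v x" h] mult_right_mono[OF b1[of v x] norm_ge_zero[of h]]
      unfolding D_def by linarith
    show "norm (\<iota> v x - \<iota> v y) \<le> C * norm v * norm (x - y)" for v x y
      by (rule differentiable_bound[of UNIV "\<iota> v" "\<lambda>x. blinfun_apply (f' v x)"])
        (use d1 b1 in \<open>auto simp: norm_blinfun.rep_eq[symmetric]\<close>)
    show "norm (D v x h - D v y h) \<le> C * norm v * norm (x - y) * norm h" for v x y h
      using norm_blinfun[of "f' v x - f' v y" h] mult_right_mono[OF f'_lip[of v x y] norm_ge_zero[of h]]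
      unfolding D_def by (simp add: blinfun.diff_left)
    show "norm (\<iota> v y - \<iota> v x - D v x (y - x)) \<le> C * norm v * (norm (y - x))\<^sup>2" for v x y
    proof -
      \<comment> \<open>Mean value inequality on the segment for \<open>\<iota> v\<close> minus its
        linearization at \<open>x\<close>, whose derivative is small by the Lipschitz bound on
        \<open>f' v\<close>. No factor \<open>1/2\<close> is gained, and \<open>taylor\<close> is
        stated accordingly.\<close>
      have "norm ((\<iota> v y - D v x y) - (\<iota> v x - D v x x)) \<le> C * norm v * norm (y - x) * norm (y - x)"
      proof (rule differentiable_bound[of "closed_segment x y" "\<lambda>z. \<iota> v z - D v x z" "\<lambda>z. blinfun_apply (f' v z - f' v x)"])
        fix z assume z: "z \<in> closed_segment x y"
        have "((\<lambda>z. \<iota> v z - D v x z) has_derivative (\<lambda>h. blinfun_apply (f' v z) h - blinfun_apply (f' v x) h)) (at z within closed_segment x y)"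
          unfolding D_def by (intro derivative_intros has_derivative_at_withinI[OF d1] bounded_linear_imp_has_derivative blinfun.bounded_linear_right)
        moreover have "(\<lambda>h. blinfun_apply (f' v z) h - blinfun_apply (f' v x) h) = blinfun_apply (f' v z - f' v x)"
          by (simp add: fun_eq_iff blinfun.diff_left)
        ultimately show "((\<lambda>z. \<iota> v z - D v x z) has_derivative blinfun_apply (f' v z - f' v x)) (at z within closed_segment x y)"
          by (simp only:)
        have "norm (z - x) \<le> norm (y - x)" using z segment_bound(1) by blast
        then have "norm (f' v z - f' v x) \<le> C * norm v * norm (y - x)"
          using f'_lip[of v z x] C0 mult_left_mono[of "norm (z - x)" "norm (y - x)" "C * norm v"] by simp
        then show "onorm (blinfun_apply (f' v z - f' v x)) \<le> C * norm v * norm (y - x)"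
          by (simp add: norm_blinfun.rep_eq)
      qed auto
      then show ?thesis unfolding D_def by (simp add: blinfun.diff_right power2_eq_square algebra_simps)
    qed
  qed
  then show ?thesis by blast
qed

section \<open>Push-forward of varifolds\<close>

text \<open>Records of the flow at a fixed time an injective differential at every point, bounded by
  \<open>K\<close> uniformly in space. The limit flow and all flows of the sequence are instances
  with the same \<open>K\<close>.\<close>

locale nonsingular_map =
  fixes \<phi> :: "real^'n \<Rightarrow> real^'n::finite" and K :: real
  assumes deriv: "\<And>x. \<exists>L. (\<phi> has_derivative L) (at x) \<and> inj L \<and> (\<forall>h. norm (L h) \<le> K * norm h)"
begin

abbreviation "d\<phi> x \<equiv> frechet_derivative \<phi> (at x)"

definition Jacobian :: "real^'n \<Rightarrow> real^'n^'n" where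
  "Jacobian x = matrix (d\<phi> x)"

lemma frechet:
  shows has_frechet: "(\<phi> has_derivative d\<phi> x) (at x)"
    and linear_frechet: "linear (d\<phi> x)"
    and inj_frechet: "inj (d\<phi> x)"
    and frechet_bound: "norm (d\<phi> x h) \<le> K * norm h"
proof -
  obtain L where L: "(\<phi> has_derivative L) (at x)" "inj L" "\<forall>h. norm (L h) \<le> K * norm h"
    using deriv[of x] by blast
  have eq: "d\<phi> x = L" by (rule frechet_derivative_at[OF L(1), symmetric])
  show "(\<phi> has_derivative d\<phi> x) (at x)" "inj (d\<phi> x)"
    "norm (d\<phi> x h) \<le> K * norm h"
    unfolding eq using L by auto
  show "linear (d\<phi> x)" unfolding eq by (rule has_derivative_linear[OF L(1)])
qed

lemma continuous_map: "continuous_on UNIV \<phi>"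
  using has_frechet by (intro continuous_at_imp_continuous_on ballI has_derivative_continuous)

lemma Jacobian_nth: "Jacobian x $ i $ j = d\<phi> x (axis j 1) $ i"
  by (simp add: Jacobian_def matrix_def)

text \<open>The entries are limits of difference quotients with step \<open>1 / real (Suc n)\<close>
  along the coordinate axes, each continuous in \<open>x\<close>.\<close>

lemma borel_measurable_Jacobian: "Jacobian \<in> borel_measurable borel"
proof (rule borel_measurable_LIMSEQ_metric)
  define A where "A n x = (\<chi> i j. (real (Suc n) *\<^sub>R (\<phi> (x + (1 / real (Suc n)) *\<^sub>R axis j 1) - \<phi> x)) $ i)" for n x
  show "A n \<in> borel_measurable borel" for n
    unfolding A_def
    by (intro borel_measurable_continuous_onI continuous_on_vec_lambda continuous_intros
        continuous_on_compose2[OF continuous_map]) auto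
  fix x
  show "(\<lambda>n. A n x) \<longlonglongrightarrow> Jacobian x"
  proof (intro vec_tendstoI)
    fix i j :: 'n
    let ?L = "d\<phi> x"
    define q where "q h = norm (\<phi> (x + h) - \<phi> x - ?L h) / norm h" for h
    define h where "h n = (1 / real (Suc n)) *\<^sub>R axis j (1::real)" for n
    have "h \<longlonglongrightarrow> 0 *\<^sub>R axis j 1"
      unfolding h_def by (intro tendsto_scaleR LIMSEQ_Suc[OF lim_1_over_n] tendsto_const)
    then have h0: "filterlim h (at 0) sequentially" by (simp add: filterlim_at h_def axis_eq_0_iff)
    have "q \<midarrow>0\<rightarrow> 0" using has_frechet[of x] unfolding has_derivative_at q_def by blast
    then have "(\<lambda>n. q (h n)) \<longlonglongrightarrow> 0" by (rule filterlim_compose[OF _ h0])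
    moreover have "q (h n) = norm (real (Suc n) *\<^sub>R (\<phi> (x + h n) - \<phi> x) - ?L (axis j 1))" for n
    proof -
      have "norm (h n) = 1 / real (Suc n)" by (simp add: h_def)
      then have "q (h n) = norm (real (Suc n) *\<^sub>R (\<phi> (x + h n) - \<phi> x - ?L (h n)))"
        by (simp add: q_def del: of_nat_Suc)
      also have "real (Suc n) *\<^sub>R (\<phi> (x + h n) - \<phi> x - ?L (h n))
          = real (Suc n) *\<^sub>R (\<phi> (x + h n) - \<phi> x) - ?L (axis j 1)"
        by (simp add: scaleR_diff_right h_def linear_scale[OF linear_frechet] del: of_nat_Suc)
      finally show ?thesis .
    qed
    ultimately have "(\<lambda>n. real (Suc n) *\<^sub>R (\<phi> (x + h n) - \<phi> x)) \<longlonglongrightarrow> ?L (axis j 1)"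
      by (simp add: tendsto_norm_zero_iff LIM_zero_iff del: of_nat_Suc)
    from tendsto_vec_nth[OF this, of i] show "(\<lambda>n. A n x $ i $ j) \<longlonglongrightarrow> Jacobian x $ i $ j"
      by (simp add: A_def h_def Jacobian_nth del: of_nat_Suc)
  qed
qed

definition image_vector :: "nat \<Rightarrow> 'n opoint \<Rightarrow> real^('n set)" where
  "image_vector d z = wedge_map d (Jacobian (fst z)) (snd z)"

lemma borel_measurable_image: "image_vector d \<in> borel_measurable borel"
proof -
  have "(\<lambda>z. (Jacobian (fst z), snd z)) \<in> borel_measurable (borel :: 'n opoint measure)"
    by (intro borel_measurable_Pair measurable_compose[OF _ borel_measurable_Jacobian]
        borel_measurable_continuous_onI continuous_intros)
  from borel_measurable_continuous_on[OF continuous_on_wedge_map this] show ?thesis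
    unfolding image_vector_def by simp
qed

lemma measurable_norm_image: "(\<lambda>z. norm (image_vector d z)) \<in> borel_measurable borel"
  by (rule borel_measurable_continuous_on[OF _ borel_measurable_image]) (intro continuous_intros)

section \<open>Measurability and change of variables\<close>

context
  fixes d :: nat
begin

lemma push_jac_eq: "z \<in> obundle d \<Longrightarrow> push_jac d \<phi> z = norm (image_vector d z)"
  by (auto simp: obundle_def push_jac_def jac_eq[OF _ linear_frechet] image_vector_def Jacobian_def)

lemma push_map_eq: "z \<in> obundle d \<Longrightarrow> push_map d \<phi> z = (\<phi> (fst z), sgn (image_vector d z))"
  by (auto simp: obundle_def push_map_def orient_image_eq[OF _ linear_frechet] image_vector_def Jacobian_def)

lemma image_nonzero: "z \<in> obundle d \<Longrightarrow> image_vector d z \<noteq> 0"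
  by (auto simp: obundle_def image_vector_def Jacobian_def wedge_map_nonzero[OF _ linear_frechet inj_frechet])

lemma push_map_in: "z \<in> obundle d \<Longrightarrow> push_map d \<phi> z \<in> obundle d"
  using sgn_wedge_map_in_ograss[OF _ linear_frechet inj_frechet]
  by (auto simp: push_map_eq) (auto simp: obundle_def image_vector_def Jacobian_def)

lemma measurable_push_map: "push_map d \<phi> \<in> measurable (obundle_borel d) (obundle_borel d)"
proof -
  have "(\<lambda>z. (\<phi> (fst z), sgn (image_vector d z))) \<in> borel_measurable borel"
  proof (rule borel_measurable_Pair)
    show "(\<lambda>z. \<phi> (fst z)) \<in> borel_measurable (borel :: 'n opoint measure)"
      by (intro borel_measurable_continuous_onI continuous_on_compose2[OF continuous_map] continuous_intros) auto
    \<comment> \<open>\<open>sgn\<close> is discontinuous at zero, but the reciprocal of the norm is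
      Borel everywhere with the convention that zero has inverse zero.\<close>
    have "(\<lambda>z. inverse (norm (image_vector d z))) \<in> borel_measurable borel"
      by (intro borel_measurable_inverse measurable_norm_image)
    then show "(\<lambda>z. sgn (image_vector d z)) \<in> borel_measurable borel"
      unfolding sgn_div_norm by (rule borel_measurable_scaleR) (rule borel_measurable_image)
  qed
  then have "(\<lambda>z. (\<phi> (fst z), sgn (image_vector d z))) \<in> borel_measurable (obundle_borel d)"
    unfolding obundle_borel_def by (rule measurable_restrict_space1)
  then have "push_map d \<phi> \<in> borel_measurable (obundle_borel d)"
    by (rule measurable_cong[THEN iffD1, rotated]) (simp add: obundle_borel_def space_restrict_space push_map_eq)
  then show ?thesis
    unfolding obundle_borel_def[of d]
    by (intro measurable_restrict_space2) (auto simp: space_restrict_space push_map_in)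
qed

lemma measurable_push_jac: "push_jac d \<phi> \<in> borel_measurable (obundle_borel d)"
proof -
  have "(\<lambda>z. norm (image_vector d z)) \<in> borel_measurable (obundle_borel d)"
    unfolding obundle_borel_def by (intro measurable_restrict_space1 measurable_norm_image)
  then show ?thesis
    by (rule measurable_cong[THEN iffD1, rotated]) (simp add: obundle_borel_def space_restrict_space push_jac_eq)
qed

text \<open>Both densities and the map are moved back to \<open>\<mu>\<close>, which separates the
  integrand into \<open>\<alpha>\<close> at the base point and a factor free of
  \<open>\<alpha>\<close>; the limit passage treats the first weakly and the second
  pointwise.\<close>

lemma integral_pushforward_rescale:
  assumes \<mu>: "varifold d \<mu>" and \<alpha>: "\<alpha> \<in> borel_measurable borel" "AE x in weight \<mu>. 0 \<le> \<alpha> x"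
    and \<omega>: "\<omega> \<in> borel_measurable (obundle_borel d)"
  shows "(\<integral>z. \<omega> z \<partial>pushforward d \<phi> (rescale \<alpha> \<mu>)) = (\<integral>z. \<alpha> (fst z) * (\<omega> (push_map d \<phi> z) * push_jac d \<phi> z) \<partial>\<mu>)"
proof -
  have sets: "sets \<mu> = sets (obundle_borel d)" using \<mu> by (simp add: varifold_def)
  have space: "space \<mu> = obundle d"
    using sets_eq_imp_space_eq[OF sets] by (simp add: obundle_borel_def space_restrict_space)
  have rs: "sets (rescale \<alpha> \<mu>) = sets (obundle_borel d)" "space (rescale \<alpha> \<mu>) = obundle d"
    by (simp_all add: rescale_def sets space)
  have fstm: "fst \<in> measurable \<mu> borel"
    unfolding measurable_cong_sets[OF sets refl] obundle_borel_def
    by (intro measurable_restrict_space1 borel_measurable_continuous_onI continuous_intros)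
  have am: "(\<lambda>z. \<alpha> (fst z)) \<in> borel_measurable \<mu>" by (rule measurable_compose[OF fstm \<alpha>(1)])
  have "(\<integral>z. \<omega> z \<partial>pushforward d \<phi> (rescale \<alpha> \<mu>)) = (\<integral>z. \<omega> (push_map d \<phi> z) * push_jac d \<phi> z \<partial>rescale \<alpha> \<mu>)"
  proof (rule integral_pushforward[OF _ _ _ \<omega>])
    show "push_map d \<phi> \<in> measurable (rescale \<alpha> \<mu>) (obundle_borel d)"
      unfolding measurable_cong_sets[OF rs(1) refl] by (rule measurable_push_map)
    show "push_jac d \<phi> \<in> borel_measurable (rescale \<alpha> \<mu>)"
      unfolding measurable_cong_sets[OF rs(1) refl] by (rule measurable_push_jac)
    show "0 \<le> push_jac d \<phi> z" if "z \<in> space (rescale \<alpha> \<mu>)" for z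
      using that unfolding rs by (simp add: push_jac_eq)
  qed
  also have "\<dots> = (\<integral>z. \<alpha> (fst z) *\<^sub>R (\<omega> (push_map d \<phi> z) * push_jac d \<phi> z) \<partial>\<mu>)"
    unfolding rescale_def split_def
  proof (rule integral_density)
    show "(\<lambda>z. \<omega> (push_map d \<phi> z) * push_jac d \<phi> z) \<in> borel_measurable \<mu>"
      unfolding measurable_cong_sets[OF sets refl]
      by (intro borel_measurable_times measurable_push_jac measurable_compose[OF measurable_push_map \<omega>])
    show "AE z in \<mu>. 0 \<le> \<alpha> (fst z)"
      using \<alpha> unfolding weight_def by (subst (asm) AE_distr_iff[OF fstm]) auto
  qed (rule am)
  finally show ?thesis by simp
qed

end
end

text \<open>The pairs in question lie in a product of two closed balls, on which a continuous map is
  bounded. The radius comes from bounding each matrix entry by \<open>K\<close>, then rows and the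
  matrix by sums over \<open>CARD('n)\<close> indices.\<close>

lemma wedge_map_bounded:
  "\<exists>B. \<forall>L U. linear L \<longrightarrow> (\<forall>h. norm (L h :: real^'n) \<le> K * norm h) \<longrightarrow> U \<in> ograss d \<longrightarrow>
    norm (wedge_map d (matrix L) (U :: real^('n::finite set))) \<le> B"
proof -
  define r where "r = real CARD('n) * (real CARD('n) * K)"
  have "compact (cball (0 :: real^'n^'n) r \<times> cball (0 :: real^('n set)) 1)" by (intro compact_Times compact_cball)
  then have "bounded ((\<lambda>x. wedge_map d (fst x) (snd x)) ` (cball (0 :: real^'n^'n) r \<times> cball (0 :: real^('n set)) 1))"
    by (intro compact_imp_bounded compact_continuous_image continuous_on_wedge_map)
  then obtain B where B: "\<forall>x\<in>cball (0 :: real^'n^'n) r \<times> cball (0 :: real^('n set)) 1. norm (wedge_map d (fst x) (snd x)) \<le> B"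
    unfolding bounded_iff by auto
  have "norm (wedge_map d (matrix L) U) \<le> B"
    if L: "linear L" "\<forall>h. norm (L h :: real^'n) \<le> K * norm h" and U: "U \<in> ograss d" for L U
  proof -
    have "\<bar>matrix L $ i $ j\<bar> \<le> K" for i j
      using component_le_norm_cart[of "L (axis j 1)" i] L(2)[rule_format, of "axis j 1"] by (simp add: matrix_def)
    then have "norm (matrix L $ i) \<le> real CARD('n) * K" for i
      using order_trans[OF norm_le_l1_cart sum_bounded_above[of UNIV "\<lambda>j. \<bar>matrix L $ i $ j\<bar>" K]] by simp
    then have "(\<Sum>i\<in>UNIV. norm (matrix L $ i)) \<le> r"
      unfolding r_def using sum_bounded_above[of UNIV "\<lambda>i. norm (matrix L $ i)" "real CARD('n) * K"] by simp
    moreover have "norm (matrix L) \<le> (\<Sum>i\<in>UNIV. norm (matrix L $ i))"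
      unfolding norm_vec_def by (rule L2_set_le_sum) simp
    ultimately show ?thesis using B[rule_format, of "(matrix L, U)"] norm_ograss[OF U] by simp
  qed
  then show ?thesis by blast
qed

section \<open>Weak lower semicontinuity of the matching energy\<close>

lemma L2_compose_distr:
  assumes f: "f \<in> measurable M N" and h: "L2 (distr M N f) (h :: _ \<Rightarrow> real)"
  shows "L2 M (\<lambda>z. h (f z))" and "(\<integral>z. (norm (h (f z)))\<^sup>2 \<partial>M) = (L2_sq (distr M N f) h)"
proof -
  have hm: "h \<in> borel_measurable N" using L2_D[OF h] by simp
  have "integrable (distr M N f) (\<lambda>x. (norm (h x))\<^sup>2)" using h by (simp add: L2_def)
  then have "integrable M (\<lambda>z. (norm (h (f z)))\<^sup>2)"
    by (subst (asm) integrable_distr_eq[OF f]) (use hm in auto)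
  then show "L2 M (\<lambda>z. h (f z))" using measurable_compose[OF f hm] by (simp add: L2_def)
  show "(\<integral>z. (norm (h (f z)))\<^sup>2 \<partial>M) = (L2_sq (distr M N f) h)"
    by (rule integral_distr[OF f, symmetric]) (use hm in auto)
qed

text \<open>Replacing \<open>g n\<close> by \<open>g0\<close> costs an error that vanishes by
  Cauchy-Schwarz and dominated convergence; what remains is affine in \<open>\<beta> n\<close>.
  Although \<open>g0 z\<close> need not be a function of \<open>f z\<close>, integration against it
  is a bounded functional on \<open>L2 (distr M N f)\<close>, so weak convergence of
  \<open>\<beta>\<close> applies and disintegration is avoided.\<close>

lemma (in finite_measure) weak_product_tendsto:
  fixes \<beta> :: "nat \<Rightarrow> 'b \<Rightarrow> real" and g :: "nat \<Rightarrow> 'a \<Rightarrow> real"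
  assumes f: "f \<in> measurable M N"
    and \<beta>: "\<And>n. L2 (distr M N f) (\<beta> n)" and B: "\<And>n. (L2_sq (distr M N f) (\<beta> n)) \<le> B"
    and b: "L2 (distr M N f) b" and weak: "weakly_L2 (distr M N f) \<beta> b"
    and gm: "\<And>n. g n \<in> borel_measurable M" and g0m: "g0 \<in> borel_measurable M"
    and gb: "\<And>n z. z \<in> space M \<Longrightarrow> \<bar>g n z\<bar> \<le> G"
    and lim: "\<And>z. z \<in> space M \<Longrightarrow> (\<lambda>n. g n z) \<longlonglongrightarrow> g0 z"
  shows "(\<lambda>n. \<integral>z. (\<beta> n (f z) + 1) * g n z \<partial>M) \<longlonglongrightarrow> (\<integral>z. (b (f z) + 1) * g0 z \<partial>M)"
proof -
  obtain Q :: "real set" where Q: "countable Q" "closure Q = UNIV" by (rule countable_dense_closure)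
  note CS = L2_Cauchy_Schwarz[OF Q] and LI = L2_inner_integrable[OF Q] and LC = L2_lincomb[OF Q]
  have g0b: "\<bar>g0 z\<bar> \<le> G" if "z \<in> space M" for z
    using LIMSEQ_le_const2[OF tendsto_rabs[OF lim[OF that]]] gb[OF that] by blast
  have L2_bdd: "L2 M h" if "h \<in> borel_measurable M" "\<And>z. z \<in> space M \<Longrightarrow> \<bar>h z\<bar> \<le> c" for h :: "'a \<Rightarrow> real" and c
    unfolding L2_def
  proof
    show "integrable M (\<lambda>z. (norm (h z))\<^sup>2)"
    proof (rule integrable_const_bound[of _ "c\<^sup>2"])
      show "AE z in M. norm ((norm (h z))\<^sup>2) \<le> c\<^sup>2"
        using that(2) by (intro AE_I2) (auto simp: abs_le_square_iff[symmetric] intro: order_trans abs_ge_self)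
      show "(\<lambda>z. (norm (h z))\<^sup>2) \<in> borel_measurable M" using that(1) by measurable
    qed
  qed fact
  have Lg0: "L2 M g0" by (rule L2_bdd[OF g0m g0b])
  have Ld: "L2 M (\<lambda>z. g n z - g0 z)" for n
  proof (rule L2_bdd)
    show "(\<lambda>z. g n z - g0 z) \<in> borel_measurable M" using gm g0m by measurable
    show "\<bar>g n z - g0 z\<bar> \<le> 2 * G" if "z \<in> space M" for z using gb[OF that, of n] g0b[OF that] by linarith
  qed
  have L1: "L2 M (\<lambda>_. 1 :: real)" by (rule L2_bdd[of "\<lambda>_. 1" 1]) auto
  note L\<beta> = L2_compose_distr(1)[OF f \<beta>] and Lb = L2_compose_distr(1)[OF f b]
  have La: "L2 M (\<lambda>z. \<beta> n (f z) + 1)" for n using LC[OF L\<beta>[of n] L1, of 1 1] by simp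
  define m where "m = measure M (space M)"
  have a_bound: "(\<integral>z. (norm (\<beta> n (f z) + 1))\<^sup>2 \<partial>M) \<le> 2 * B + 2 * m" for n
  proof -
    have "(\<integral>z. (norm (\<beta> n (f z) + 1))\<^sup>2 \<partial>M) \<le> (\<integral>z. 2 * (norm (\<beta> n (f z)))\<^sup>2 + 2 \<partial>M)"
      using La[of n] L\<beta>[of n] norm_sum_squares[of "\<beta> n (f z)" 1 for z]
      by (intro integral_mono) (auto simp: L2_def)
    also have "\<dots> = 2 * (\<integral>z. (norm (\<beta> n (f z)))\<^sup>2 \<partial>M) + 2 * m"
      using L\<beta>[of n] by (subst Bochner_Integration.integral_add) (auto simp: L2_def m_def)
    finally show ?thesis using B[of n] L2_compose_distr(2)[OF f \<beta>[of n]] by simp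
  qed
  have "(\<lambda>n. \<integral>z. (norm (g n z - g0 z))\<^sup>2 \<partial>M) \<longlonglongrightarrow> (\<integral>z. 0 \<partial>M)"
  proof (rule integral_dominated_convergence[where w="\<lambda>_. (2 * G)\<^sup>2"])
    show "AE z in M. (\<lambda>n. (norm (g n z - g0 z))\<^sup>2) \<longlonglongrightarrow> 0"
    proof (rule AE_I2)
      fix z assume "z \<in> space M"
      then have "(\<lambda>n. g n z - g0 z) \<longlonglongrightarrow> 0" using lim by (simp add: LIM_zero)
      from tendsto_power[OF tendsto_norm[OF this], of 2] show "(\<lambda>n. (norm (g n z - g0 z))\<^sup>2) \<longlonglongrightarrow> 0" by simp
    qed
    show "AE z in M. norm ((norm (g n z - g0 z))\<^sup>2) \<le> (2 * G)\<^sup>2" for n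
    proof (rule AE_I2)
      fix z assume z: "z \<in> space M"
      have "norm (g n z - g0 z) \<le> 2 * G" using gb[OF z, of n] g0b[OF z] by simp
      then have "(norm (g n z - g0 z))\<^sup>2 \<le> (2 * G)\<^sup>2" by (intro power_mono) auto
      then show "norm ((norm (g n z - g0 z))\<^sup>2) \<le> (2 * G)\<^sup>2" by simp
    qed
  qed (use gm g0m in auto)
  then have gl: "(\<lambda>n. \<integral>z. (norm (g n z - g0 z))\<^sup>2 \<partial>M) \<longlonglongrightarrow> 0" by simp
  let ?e = "\<lambda>n. \<integral>z. (norm (g n z - g0 z))\<^sup>2 \<partial>M" and ?c = "\<integral>z. g0 z \<partial>M"
    and ?p = "\<lambda>n. \<integral>z. (\<beta> n (f z) + 1) * (g n z - g0 z) \<partial>M" and ?q = "\<lambda>n. \<integral>z. \<beta> n (f z) * g0 z \<partial>M"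
  have first: "(\<lambda>n. ?p n) \<longlonglongrightarrow> 0"
  proof -
    have "(\<lambda>n. (?p n)\<^sup>2) \<longlonglongrightarrow> 0"
    proof (rule tendsto_sandwich[OF _ _ tendsto_const])
      show "(\<lambda>n. (2 * B + 2 * m) * ?e n) \<longlonglongrightarrow> 0"
        using tendsto_mult_left[OF gl, of "2 * B + 2 * m"] by simp
      have "(?p n)\<^sup>2 \<le> (2 * B + 2 * m) * ?e n" for n
        using CS[OF La[of n] Ld[of n]] mult_right_mono[OF a_bound[of n], of "?e n"]
        by simp
      then show "\<forall>\<^sub>F n in sequentially. (?p n)\<^sup>2
          \<le> (2 * B + 2 * m) * ?e n" by simp
    qed simp
    then have "(\<lambda>n. sqrt ((?p n)\<^sup>2)) \<longlonglongrightarrow> sqrt 0" by (rule tendsto_real_sqrt)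
    then show ?thesis by (simp add: tendsto_rabs_zero_iff)
  qed
  have "L2_functional (distr M N f) (\<lambda>h :: 'b \<Rightarrow> real. \<integral>z. h (f z) * g0 z \<partial>M)"
    unfolding L2_functional_def
  proof (intro conjI allI impI exI[of _ "\<integral>z. (norm (g0 z))\<^sup>2 \<partial>M"])
    fix p q :: real and h k :: "'b \<Rightarrow> real" assume "L2 (distr M N f) h" "L2 (distr M N f) k"
    then have "integrable M (\<lambda>z. h (f z) * g0 z)" "integrable M (\<lambda>z. k (f z) * g0 z)"
      using LI[OF L2_compose_distr(1)[OF f, of h] Lg0] LI[OF L2_compose_distr(1)[OF f, of k] Lg0] by simp_all
    then show "(\<integral>z. (p *\<^sub>R h (f z) + q *\<^sub>R k (f z)) * g0 z \<partial>M)
        = p * (\<integral>z. h (f z) * g0 z \<partial>M) + q * (\<integral>z. k (f z) * g0 z \<partial>M)"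
      by (simp add: distrib_right mult.assoc)
  next
    fix h :: "'b \<Rightarrow> real" assume h: "L2 (distr M N f) h"
    show "(\<integral>z. h (f z) * g0 z \<partial>M)\<^sup>2 \<le> (L2_sq M g0) * (L2_sq (distr M N f) h)"
      using CS[OF L2_compose_distr(1)[OF f h] Lg0] L2_compose_distr(2)[OF f h] by (simp add: mult.commute)
  qed simp
  from weakly_L2_D[OF weak this] have second: "(\<lambda>n. \<integral>z. \<beta> n (f z) * g0 z \<partial>M) \<longlonglongrightarrow> (\<integral>z. b (f z) * g0 z \<partial>M)" .
  have ig0: "integrable M g0" using LI[OF L1 Lg0] by simp
  have split: "(\<integral>z. (\<beta> n (f z) + 1) * g n z \<partial>M)
      = ?p n + (?q n + ?c)" for n
  proof -
    have i: "integrable M (\<lambda>z. (\<beta> n (f z) + 1) * (g n z - g0 z))" "integrable M (\<lambda>z. \<beta> n (f z) * g0 z)"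
      using LI[OF La[of n] Ld[of n]] LI[OF L\<beta>[of n] Lg0] by simp_all
    have "(\<integral>z. (\<beta> n (f z) + 1) * g n z \<partial>M)
        = (\<integral>z. (\<beta> n (f z) + 1) * (g n z - g0 z) + (\<beta> n (f z) * g0 z + g0 z) \<partial>M)"
      by (simp add: algebra_simps)
    also have "\<dots> = ?p n + (\<integral>z. \<beta> n (f z) * g0 z + g0 z \<partial>M)"
      by (rule Bochner_Integration.integral_add[OF i(1)]) (intro Bochner_Integration.integrable_add i ig0)
    also have "(\<integral>z. \<beta> n (f z) * g0 z + g0 z \<partial>M) = ?q n + ?c"
      by (rule Bochner_Integration.integral_add[OF i(2) ig0])
    finally show ?thesis .
  qed
  have "(\<integral>z. (b (f z) + 1) * g0 z \<partial>M) = (\<integral>z. b (f z) * g0 z + g0 z \<partial>M)" by (simp add: algebra_simps)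
  also have "\<dots> = (\<integral>z. b (f z) * g0 z \<partial>M) + ?c"
    using LI[OF Lb Lg0] by (intro Bochner_Integration.integral_add ig0) simp
  finally have eq: "(\<integral>z. (b (f z) + 1) * g0 z \<partial>M) = 0 + ((\<integral>z. b (f z) * g0 z \<partial>M) + ?c)" by simp
  show ?thesis unfolding split eq by (intro tendsto_add first second tendsto_const)
qed

text \<open>The indicator of the set where \<open>b x + 1 < 0\<close> is a test function: the limit
  of nonnegative integrals over that set is nonnegative, while the integrand is negative on
  it.\<close>

lemma (in finite_measure) weakly_L2_AE_nonneg:
  fixes \<beta> :: "nat \<Rightarrow> 'a \<Rightarrow> real"
  assumes \<beta>: "\<And>n. L2 M (\<beta> n)" and b: "L2 M b" and weak: "weakly_L2 M \<beta> b"
    and nn: "\<And>n. AE x in M. 0 \<le> \<beta> n x + 1"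
  shows "AE x in M. 0 \<le> b x + 1"
proof -
  obtain Q :: "real set" where Q: "countable Q" "closure Q = UNIV" by (rule countable_dense_closure)
  note LI = L2_inner_integrable[OF Q]
  define S where "S = {x \<in> space M. b x + 1 < 0}"
  have S: "S \<in> sets M" unfolding S_def using L2_D[OF b] by measurable
  define i where "i = (indicator S :: 'a \<Rightarrow> real)"
  have im: "i \<in> borel_measurable M" using S by (simp add: i_def)
  have i2: "(norm (i x))\<^sup>2 = i x" for x by (simp add: i_def indicator_def)
  have ii: "integrable M i" unfolding i_def using S by (simp add: integrable_real_indicator less_top[symmetric])
  have Li: "L2 M i" unfolding L2_def i2 using im ii by simp
  have int: "integrable M (\<lambda>x. i x * \<beta> n x)" "integrable M (\<lambda>x. i x * b x)" for n
    using LI[OF Li \<beta>[of n]] LI[OF Li b] by simp_all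
  let ?i = "\<integral>x. i x \<partial>M" and ?b = "\<integral>x. i x * b x \<partial>M" and ?c = "\<lambda>n. \<integral>x. i x * \<beta> n x \<partial>M"
  have "0 \<le> ?b + ?i"
  proof (rule LIMSEQ_le_const)
    show "(\<lambda>n. ?c n + ?i) \<longlonglongrightarrow> ?b + ?i"
      using weakly_L2_D[OF weak L2_functional_inner[OF Q Li]] by (intro tendsto_add tendsto_const) simp
    have *: "0 \<le> (\<integral>x. i x * \<beta> n x + i x \<partial>M)" for n
    proof (rule integral_nonneg_AE)
      show "AE x in M. 0 \<le> i x * \<beta> n x + i x"
        using nn[of n] by eventually_elim (simp add: i_def indicator_def)
    qed
    have "0 \<le> ?c n + ?i" for n
      using *[of n] Bochner_Integration.integral_add[OF int(1) ii, of n] by simp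
    then show "\<exists>N. \<forall>n\<ge>N. 0 \<le> ?c n + ?i" by blast
  qed
  also have "\<dots> = (\<integral>x. i x * b x + i x \<partial>M)" by (rule Bochner_Integration.integral_add[OF int(2) ii, symmetric])
  finally have ge: "0 \<le> (\<integral>x. i x * b x + i x \<partial>M)" .
  have nonneg: "AE x in M. 0 \<le> - (i x * b x + i x)"
    by (intro AE_I2) (auto simp: i_def indicator_def S_def)
  have "integrable M (\<lambda>x. - (i x * b x + i x))" using int(2) ii by simp
  moreover have "(\<integral>x. - (i x * b x + i x) \<partial>M) = 0"
    using ge integral_nonneg_AE[OF nonneg] Bochner_Integration.integral_minus[of M "\<lambda>x. i x * b x + i x"]
    by linarith
  ultimately have "AE x in M. - (i x * b x + i x) = 0"
    using integral_nonneg_eq_0_iff_AE[OF _ nonneg] by blast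
  moreover have "AE x in M. x \<in> space M" by (rule AE_space)
  ultimately show ?thesis
  proof eventually_elim
    fix x assume "- (i x * b x + i x) = 0" "x \<in> space M"
    then show "0 \<le> b x + 1" by (cases "x \<in> S") (auto simp: i_def S_def)
  qed
qed

section \<open>The variational problem\<close>

locale matching = field_space \<iota> D\<iota> C
  for \<iota> :: "'v::{real_inner,complete_space} \<Rightarrow> real^'n \<Rightarrow> real^'n::finite" and D\<iota> C +
  fixes d :: nat and \<gamma> lam :: real and \<mu> \<mu>' :: "('n opoint) measure"
    and ev :: "'w::{real_inner,complete_space} \<Rightarrow> 'n opoint \<Rightarrow> real" and Q :: "'v set" and Ce :: real
  assumes Q: "countable Q" "closure Q = UNIV"
    and pos: "0 < \<gamma>" "0 < lam"
    and \<mu>: "varifold d \<mu>" and \<mu>': "varifold d \<mu>'"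
    and ev_cont: "\<And>w. continuous_on (obundle d) (ev w)"
    and ev_0: "\<And>z. z \<in> obundle d \<Longrightarrow> ev 0 z = 0"
    and ev_bound: "\<And>w z. z \<in> obundle d \<Longrightarrow> \<bar>ev w z\<bar> \<le> Ce * norm w"
begin

abbreviation "kinetic v \<equiv> \<integral>t. (norm (v t))\<^sup>2 \<partial>unit_time"

abbreviation "mismatch v \<alpha> \<equiv> dual_dist ev (pushforward d (flow \<iota> v 1) (rescale \<alpha> \<mu>)) \<mu>'"

abbreviation "deviation \<alpha> \<equiv> \<integral>x. (\<alpha> x - 1)\<^sup>2 \<partial>weight \<mu>"

definition pairing :: "(real \<Rightarrow> 'v) \<Rightarrow> 'w \<Rightarrow> 'n opoint \<Rightarrow> real" where
  "pairing v w z = ev w (push_map d (flow \<iota> v 1) z) * push_jac d (flow \<iota> v 1) z"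

text \<open>The quantity whose supremum over the unit ball is the dual distance, pulled back to
  \<open>\<mu>\<close>. At fixed \<open>w\<close> it passes to the limit along the minimizing
  sequence.\<close>

definition excess :: "(real \<Rightarrow> 'v) \<Rightarrow> (real^'n \<Rightarrow> real) \<Rightarrow> 'w \<Rightarrow> real" where
  "excess v \<alpha> w = (\<integral>z. \<alpha> (fst z) * pairing v w z \<partial>\<mu>) - (\<integral>z. ev w z \<partial>\<mu>')"

lemma varifold_space:
  assumes "varifold d \<nu>"
  shows "sets \<nu> = sets (obundle_borel d)" "space \<nu> = obundle d" "finite_measure \<nu>"
proof -
  show s: "sets \<nu> = sets (obundle_borel d)" and "finite_measure \<nu>" using assms by (simp_all add: varifold_def)
  show "space \<nu> = obundle d"
    using sets_eq_imp_space_eq[OF s] by (simp add: obundle_borel_def space_restrict_space)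
qed

lemma fst_measurable: "fst \<in> measurable \<mu> borel"
  unfolding measurable_cong_sets[OF varifold_space(1)[OF \<mu>] refl] obundle_borel_def
  by (intro measurable_restrict_space1 borel_measurable_continuous_onI continuous_intros)

lemma finite_weight: "finite_measure (weight \<mu>)"
  unfolding weight_def by (rule finite_measure.finite_measure_distr[OF varifold_space(3)[OF \<mu>] fst_measurable])

lemma ev_measurable: "ev w \<in> borel_measurable (obundle_borel d)"
  unfolding obundle_borel_def by (rule borel_measurable_continuous_on_restrict[OF ev_cont])

lemma flow_nonsingular:
  assumes v: "L2 unit_time v" "kinetic v \<le> E"
  shows "nonsingular_map (flow \<iota> v 1) (amp E)"
proof
  fix x
  obtain c where "solves (\<lambda>s. \<iota> (v s)) x c" using ex_curve[OF v, of x] ..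
  then show "\<exists>L. (flow \<iota> v 1 has_derivative L) (at x) \<and> inj L \<and> (\<forall>h. norm (L h) \<le> amp E * norm h)"
    by (rule flow_derivative[OF v]) blast
qed

lemma pairing_measurable:
  assumes v: "L2 unit_time v" shows "pairing v w \<in> borel_measurable \<mu>"
proof -
  interpret nonsingular_map "flow \<iota> v 1" "amp (kinetic v)" by (rule flow_nonsingular[OF v order_refl])
  show ?thesis
    unfolding pairing_def measurable_cong_sets[OF varifold_space(1)[OF \<mu>] refl]
    by (intro borel_measurable_times measurable_push_jac measurable_compose[OF measurable_push_map ev_measurable])
qed

text \<open>\<open>G\<close> depends on \<open>v\<close> only through \<open>E\<close>: the flow
  differentials are bounded by \<open>amp E\<close>, and with them the induced maps on
  \<open>d\<close>-vectors. This is the majorant along the minimizing sequence.\<close>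

lemma pairing_bounded:
  "\<exists>G. \<forall>v w z. L2 unit_time v \<longrightarrow> kinetic v \<le> E \<longrightarrow> norm w \<le> 1 \<longrightarrow> z \<in> obundle d \<longrightarrow> \<bar>pairing v w z\<bar> \<le> G"
proof -
  obtain B where B: "\<forall>L U. linear L \<longrightarrow> (\<forall>h. norm (L h :: real^'n) \<le> amp E * norm h) \<longrightarrow> U \<in> ograss d \<longrightarrow>
    norm (wedge_map d (matrix L) (U :: real^('n set))) \<le> B"
    using wedge_map_bounded[of "amp E" d] ..
  have "\<bar>pairing v w z\<bar> \<le> \<bar>Ce\<bar> * \<bar>B\<bar>"
    if v: "L2 unit_time v" "kinetic v \<le> E" and w: "norm w \<le> 1" and z: "z \<in> obundle d" for v w z
  proof -
    interpret nonsingular_map "flow \<iota> v 1" "amp E" by (rule flow_nonsingular[OF v])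
    have U: "snd z \<in> ograss d" using z by (auto simp: obundle_def)
    have "norm (wedge_map d (matrix (frechet_derivative (flow \<iota> v 1) (at (fst z)))) (snd z)) \<le> B"
      using B linear_frechet frechet_bound U by blast
    then have j: "\<bar>push_jac d (flow \<iota> v 1) z\<bar> \<le> \<bar>B\<bar>"
      unfolding push_jac_eq[OF z] image_vector_def Jacobian_def by simp
    have "Ce * norm w \<le> \<bar>Ce\<bar> * norm w" by (rule mult_right_mono) auto
    also have "\<dots> \<le> \<bar>Ce\<bar> * 1" by (rule mult_left_mono[OF w]) simp
    finally have "\<bar>ev w (push_map d (flow \<iota> v 1) z)\<bar> \<le> \<bar>Ce\<bar>"
      using ev_bound[OF push_map_in[OF z], of w] by linarith
    then show ?thesis unfolding pairing_def abs_mult using j by (intro mult_mono) auto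
  qed
  then show ?thesis by blast
qed

lemma pairing_tendsto:
  assumes V: "\<And>n. L2 unit_time (V n)" and v: "L2 unit_time v" and weak: "weakly_L2 unit_time V v"
    and EV: "\<And>n. kinetic (V n) \<le> E" and Ev: "kinetic v \<le> E" and z: "z \<in> obundle d"
  shows "(\<lambda>n. pairing (V n) w z) \<longlonglongrightarrow> pairing v w z"
proof -
  interpret N: nonsingular_map "flow \<iota> v 1" "amp E" by (rule flow_nonsingular[OF v Ev])
  interpret Nn: nonsingular_map "flow \<iota> (V n) 1" "amp E" for n by (rule flow_nonsingular[OF V EV])
  note lim = flow_weakly_continuous[OF V v weak EV Ev]
  have "(\<lambda>n. Nn.Jacobian n (fst z)) \<longlonglongrightarrow> N.Jacobian (fst z)"
    by (intro vec_tendstoI) (simp add: N.Jacobian_nth Nn.Jacobian_nth tendsto_vec_nth lim(2))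
  then have "(\<lambda>n. (Nn.Jacobian n (fst z), snd z)) \<longlonglongrightarrow> (N.Jacobian (fst z), snd z)"
    by (intro tendsto_Pair tendsto_const)
  from continuous_on_tendsto_compose[OF continuous_on_wedge_map this, of UNIV d]
  have G: "(\<lambda>n. Nn.image_vector n d z) \<longlonglongrightarrow> N.image_vector d z" by (simp add: N.image_vector_def Nn.image_vector_def)
  \<comment> \<open>\<open>sgn\<close> is continuous only away from zero; injectivity of the limit
    differential keeps the limit \<open>d\<close>-vector nonzero.\<close>
  have "(\<lambda>n. push_map d (flow \<iota> (V n) 1) z) \<longlonglongrightarrow> push_map d (flow \<iota> v 1) z"
    unfolding N.push_map_eq[OF z] Nn.push_map_eq[OF z]
    by (intro tendsto_Pair lim(1) tendsto_sgn G N.image_nonzero z)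
  then have "(\<lambda>n. ev w (push_map d (flow \<iota> (V n) 1) z)) \<longlonglongrightarrow> ev w (push_map d (flow \<iota> v 1) z)"
    by (rule continuous_on_tendsto_compose[OF ev_cont]) (simp_all add: N.push_map_in Nn.push_map_in z)
  moreover have "(\<lambda>n. push_jac d (flow \<iota> (V n) 1) z) \<longlonglongrightarrow> push_jac d (flow \<iota> v 1) z"
    unfolding N.push_jac_eq[OF z] Nn.push_jac_eq[OF z] by (intro tendsto_norm G)
  ultimately show ?thesis unfolding pairing_def by (rule tendsto_mult)
qed

lemma mismatch_eq:
  assumes adm: "admissible \<mu> v \<alpha>"
  shows "mismatch v \<alpha> = (SUP w\<in>{w. norm w \<le> 1}. excess v \<alpha> w)"
proof -
  have v: "L2 unit_time v" and \<alpha>: "\<alpha> \<in> borel_measurable borel" "AE x in weight \<mu>. 0 \<le> \<alpha> x"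
    using adm by (simp_all add: admissible_def L2_def weight_def)
  interpret nonsingular_map "flow \<iota> v 1" "amp (kinetic v)" by (rule flow_nonsingular[OF v order_refl])
  show ?thesis
    unfolding dual_dist_def excess_def pairing_def
    by (simp add: integral_pushforward_rescale[OF \<mu> \<alpha> ev_measurable])
qed

text \<open>A real supremum is meaningful only over a set bounded above, so this precedes the use of
  \<open>mismatch\<close> as an upper bound. On a finite measure \<open>\<alpha>\<close> is
  integrable, and \<open>pairing\<close> is bounded.\<close>

lemma excess_bdd_above:
  assumes adm: "admissible \<mu> v \<alpha>"
  shows "bdd_above (excess v \<alpha> ` {w. norm w \<le> 1})"
proof -
  have v: "L2 unit_time v" and \<alpha>: "L2 (weight \<mu>) \<alpha>" using adm by (simp_all add: admissible_def)
  interpret finite_measure \<mu> by (rule varifold_space(3)[OF \<mu>])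
  interpret F': finite_measure \<mu>' by (rule varifold_space(3)[OF \<mu>'])
  obtain G where G: "\<forall>u w z. L2 unit_time u \<longrightarrow> kinetic u \<le> kinetic v \<longrightarrow> norm w \<le> 1 \<longrightarrow> z \<in> obundle d \<longrightarrow> \<bar>pairing u w z\<bar> \<le> G"
    using pairing_bounded[of "kinetic v"] ..
  have a: "L2 \<mu> (\<lambda>z. \<alpha> (fst z))" using \<alpha> unfolding weight_def by (rule L2_compose_distr(1)[OF fst_measurable])
  then have ai: "integrable \<mu> (\<lambda>z. \<alpha> (fst z))" using square_integral_le(1)[OF L2_D[OF a]] by (simp add: L2_def)
  have "excess v \<alpha> w \<le> (\<integral>z. \<bar>\<alpha> (fst z)\<bar> * G \<partial>\<mu>) + (\<integral>z. \<bar>Ce\<bar> \<partial>\<mu>')" if w: "norm w \<le> 1" for w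
  proof -
    have p: "\<bar>\<alpha> (fst z) * pairing v w z\<bar> \<le> \<bar>\<alpha> (fst z)\<bar> * G" if "z \<in> space \<mu>" for z
      unfolding abs_mult
      by (rule mult_left_mono[OF G[rule_format, OF v order_refl w that[unfolded varifold_space(2)[OF \<mu>]]]]) simp
    have Gi: "integrable \<mu> (\<lambda>z. \<bar>\<alpha> (fst z)\<bar> * G)" using ai by simp
    have "(\<integral>z. \<alpha> (fst z) * pairing v w z \<partial>\<mu>) \<le> (\<integral>z. \<bar>\<alpha> (fst z)\<bar> * G \<partial>\<mu>)"
    proof (rule integral_mono)
      show "integrable \<mu> (\<lambda>z. \<alpha> (fst z) * pairing v w z)"
        by (rule Bochner_Integration.integrable_bound[OF Gi])
          (use p pairing_measurable[OF v, of w] L2_D[OF a] in \<open>auto intro!: AE_I2 borel_measurable_times order_trans[OF _ abs_ge_self]\<close>)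
    qed (use p Gi in \<open>auto dest: abs_le_D1\<close>)
    moreover have "- (\<integral>z. ev w z \<partial>\<mu>') \<le> (\<integral>z. \<bar>Ce\<bar> \<partial>\<mu>')"
    proof -
      have e: "\<bar>ev w z\<bar> \<le> \<bar>Ce\<bar>" if "z \<in> space \<mu>'" for z
      proof -
        have "Ce * norm w \<le> \<bar>Ce\<bar> * norm w" by (rule mult_right_mono) auto
        also have "\<dots> \<le> \<bar>Ce\<bar> * 1" by (rule mult_left_mono[OF w]) simp
        finally show ?thesis using ev_bound[of z w] that varifold_space(2)[OF \<mu>'] by simp
      qed
      have "ev w \<in> borel_measurable \<mu>'"
        unfolding measurable_cong_sets[OF varifold_space(1)[OF \<mu>'] refl] by (rule ev_measurable)
      then have "integrable \<mu>' (ev w)"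
        by (intro F'.integrable_const_bound[of _ "\<bar>Ce\<bar>"] AE_I2) (use e in auto)
      then have "(\<integral>z. - ev w z \<partial>\<mu>') \<le> (\<integral>z. \<bar>Ce\<bar> \<partial>\<mu>')"
        by (intro integral_mono) (use e in \<open>auto dest: abs_le_D2\<close>)
      then show ?thesis by simp
    qed
    ultimately show ?thesis unfolding excess_def by linarith
  qed
  then show ?thesis by (auto intro!: bdd_aboveI2)
qed

lemma mismatch_ge: "admissible \<mu> v \<alpha> \<Longrightarrow> norm w \<le> 1 \<Longrightarrow> excess v \<alpha> w \<le> mismatch v \<alpha>"
  unfolding mismatch_eq by (rule cSUP_upper) (auto intro: excess_bdd_above)

text \<open>The zero element of the unit ball contributes the value \<open>0\<close>. Nonnegativity
  later allows an upper bound on the mismatch to be squared.\<close>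

lemma mismatch_nonneg:
  assumes adm: "admissible \<mu> v \<alpha>" shows "0 \<le> mismatch v \<alpha>"
proof -
  have v: "L2 unit_time v" using adm by (simp add: admissible_def)
  interpret nonsingular_map "flow \<iota> v 1" "amp (kinetic v)" by (rule flow_nonsingular[OF v order_refl])
  have "(\<integral>z. \<alpha> (fst z) * pairing v 0 z \<partial>\<mu>) = (\<integral>z. 0 \<partial>\<mu>)"
    by (rule Bochner_Integration.integral_cong[OF refl]) (simp add: varifold_space(2)[OF \<mu>] pairing_def ev_0 push_map_in)
  moreover have "(\<integral>z. ev 0 z \<partial>\<mu>') = (\<integral>z. 0 \<partial>\<mu>')"
    by (rule Bochner_Integration.integral_cong[OF refl]) (simp add: varifold_space(2)[OF \<mu>'] ev_0)
  ultimately have "excess v \<alpha> 0 = 0" by (simp add: excess_def)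
  then show ?thesis using mismatch_ge[OF adm, of 0] by simp
qed

section \<open>Existence of a minimizer\<close>

abbreviation "J \<equiv> energy d \<gamma> lam \<iota> ev \<mu> \<mu>'"

lemma energy_eq: "J v \<alpha> = 1/2 * kinetic v + \<gamma>/2 * deviation \<alpha> + lam/2 * (mismatch v \<alpha>)\<^sup>2"
  by (rule energy_def)

lemma energy_parts:
  "kinetic v \<le> 2 * J v \<alpha>" "deviation \<alpha> \<le> 2 / \<gamma> * J v \<alpha>"
  "(mismatch v \<alpha>)\<^sup>2 \<le> 2 / lam * J v \<alpha>" "0 \<le> J v \<alpha>"
proof -
  have nn: "0 \<le> 1/2 * kinetic v" "0 \<le> \<gamma>/2 * deviation \<alpha>" "0 \<le> lam/2 * (mismatch v \<alpha>)\<^sup>2"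
    using pos by simp_all
  show "0 \<le> J v \<alpha>" unfolding energy_eq by (intro add_nonneg_nonneg nn)
  have "k \<le> 2 * (1/2 * k + x + y)" if "0 \<le> x" "0 \<le> y" for k x y :: real using that by simp
  from this[OF nn(2,3)] show "kinetic v \<le> 2 * J v \<alpha>" unfolding energy_eq .
  have "\<gamma>/2 * deviation \<alpha> \<le> J v \<alpha>" "lam/2 * (mismatch v \<alpha>)\<^sup>2 \<le> J v \<alpha>"
    using nn unfolding energy_eq by linarith+
  then show "deviation \<alpha> \<le> 2 / \<gamma> * J v \<alpha>" "(mismatch v \<alpha>)\<^sup>2 \<le> 2 / lam * J v \<alpha>"
    using pos by (simp_all add: field_simps)
qed

theorem minimizer_exists:
  "\<exists>v \<alpha>. admissible \<mu> v \<alpha> \<and> J v \<alpha> = (INF (v', \<alpha>')\<in>{(v', \<alpha>'). admissible \<mu> v' \<alpha>'}. J v' \<alpha>')"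
proof -
  let ?A = "{(v', \<alpha>'). admissible \<mu> v' \<alpha>'}" and ?J = "\<lambda>(v', \<alpha>'). J v' \<alpha>'"
  interpret W: finite_measure "weight \<mu>" by (rule finite_weight)
  interpret T: finite_measure unit_time by (rule finite_measure_unit_time)
  obtain QR :: "real set" where QR: "countable QR" "closure QR = UNIV" by (rule countable_dense_closure)
  define I where "I = Inf (?J ` ?A)"
  have bdd: "bdd_below (?J ` ?A)" using energy_parts(4) by (auto intro!: bdd_belowI2[of _ 0])
  \<comment> \<open>Fields identically zero and no rescaling: a competitor that makes the admissible
    set nonempty.\<close>
  have "admissible \<mu> (\<lambda>_. 0) (\<lambda>_. 1)" by (simp add: admissible_def L2_def)
  then have ne: "?A \<noteq> {}" by blast
  have I_le: "I \<le> J v \<alpha>" if "admissible \<mu> v \<alpha>" for v \<alpha>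
    unfolding I_def using cINF_lower[OF bdd, of "(v, \<alpha>)"] that by simp
  have "\<forall>n. \<exists>p. admissible \<mu> (fst p) (snd p) \<and> J (fst p) (snd p) < I + 1 / real (Suc n)"
  proof
    fix n
    have "\<exists>p\<in>?A. ?J p < I + 1 / real (Suc n)"
      using cINF_less_iff[OF ne bdd, of "I + 1 / real (Suc n)"] unfolding I_def by simp
    then show "\<exists>p. admissible \<mu> (fst p) (snd p) \<and> J (fst p) (snd p) < I + 1 / real (Suc n)" by auto
  qed
  from choice[OF this] obtain P where
    P: "\<forall>n. admissible \<mu> (fst (P n)) (snd (P n)) \<and> J (fst (P n)) (snd (P n)) < I + 1 / real (Suc n)" ..
  define V where "V n = fst (P n)" for n
  define \<alpha> where "\<alpha> n = snd (P n)" for n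
  have adm: "admissible \<mu> (V n) (\<alpha> n)" and less: "J (V n) (\<alpha> n) < I + 1 / real (Suc n)" for n
    using P by (simp_all add: V_def \<alpha>_def)
  have V: "L2 unit_time (V n)" and \<alpha>: "L2 (weight \<mu>) (\<alpha> n)" and nn: "AE x in weight \<mu>. 0 \<le> \<alpha> n x" for n
    using adm[of n] by (simp_all add: admissible_def)
  have J_le: "J (V n) (\<alpha> n) \<le> I + 1" for n
  proof -
    have "1 / real (Suc n) \<le> 1" by simp
    then show ?thesis using less[of n] by linarith
  qed
  have J_lim: "(\<lambda>n. J (V n) (\<alpha> n)) \<longlonglongrightarrow> I"
  proof (rule tendsto_sandwich[OF _ _ tendsto_const])
    show "(\<lambda>n. I + 1 / real (Suc n)) \<longlonglongrightarrow> I"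
      using tendsto_add[OF tendsto_const[of I] LIMSEQ_Suc[OF lim_1_over_n]] by simp
  qed (simp_all add: I_le adm less_imp_le[OF less] del: of_nat_Suc)
  define \<beta> where "\<beta> n x = \<alpha> n x - 1" for n x
  have one: "L2 (weight \<mu>) (\<lambda>_. 1 :: real)" by (simp add: L2_def)
  have \<beta>: "L2 (weight \<mu>) (\<beta> n)" for n
    using W.L2_lincomb[OF QR \<alpha>[of n] one, of 1 "-1"] by (simp add: \<beta>_def[abs_def])
  define E where "E = 2 * (I + 1)"
  define B where "B = 2 / \<gamma> * (I + 1)"
  have EV: "kinetic (V n) \<le> E" for n
    unfolding E_def by (rule order_trans[OF energy_parts(1)[of "V n" "\<alpha> n"] mult_left_mono[OF J_le]]) simp
  have B\<beta>: "(L2_sq (weight \<mu>) (\<beta> n)) \<le> B" for n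
    using energy_parts(2)[of "\<alpha> n" "V n"] mult_left_mono[OF J_le[of n], of "2 / \<gamma>"] pos
    unfolding B_def \<beta>_def by simp
  have Dn: "0 \<le> mismatch (V n) (\<alpha> n)" "mismatch (V n) (\<alpha> n) \<le> sqrt (2 / lam * (I + 1))" for n
  proof -
    show "0 \<le> mismatch (V n) (\<alpha> n)" by (rule mismatch_nonneg[OF adm])
    show "mismatch (V n) (\<alpha> n) \<le> sqrt (2 / lam * (I + 1))"
      using energy_parts(3)[of "V n" "\<alpha> n"] mult_left_mono[OF J_le[of n], of "2 / lam"] pos
      by (intro real_le_rsqrt) simp
  qed
  \<comment> \<open>The three parts of the energy form a bounded sequence in a Euclidean space, so
    one extraction makes each converge, as \<open>L2_weak_lsc\<close> asks; their weighted limits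
    add up to \<open>I\<close>.\<close>
  define S where "S n = (kinetic (V n), \<integral>x. (norm (\<beta> n x))\<^sup>2 \<partial>weight \<mu>, mismatch (V n) (\<alpha> n))" for n
  have "range S \<subseteq> {0..E} \<times> {0..B} \<times> {0..sqrt (2 / lam * (I + 1))}"
    unfolding S_def using EV B\<beta> Dn by auto
  moreover have "bounded ({0..E} \<times> {0..B} \<times> {0..sqrt (2 / lam * (I + 1))})" by (intro bounded_Times bounded_closed_interval)
  ultimately have "bounded (range S)" by (rule bounded_subset[rotated])
  from bounded_imp_convergent_subsequence[OF this]
  obtain l r0 where r0: "strict_mono (r0 :: nat \<Rightarrow> nat)" and Sl: "(S \<circ> r0) \<longlonglongrightarrow> l" by blast
  obtain a b \<delta> where l: "l = (a, b, \<delta>)" by (rule prod_cases3)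
  have "\<exists>v r. L2 unit_time v \<and> strict_mono r \<and> weakly_L2 unit_time (\<lambda>n. V (r0 (r n))) v"
    using T.L2_weakly_compact[OF Q, of "\<lambda>n. V (r0 n)", OF V EV] .
  then obtain v r1 where v: "L2 unit_time v" and r1: "strict_mono (r1 :: nat \<Rightarrow> nat)"
    and weak1: "weakly_L2 unit_time (\<lambda>n. V (r0 (r1 n))) v" by (elim exE conjE)
  have "\<exists>\<eta> r. L2 (weight \<mu>) \<eta> \<and> strict_mono r \<and> weakly_L2 (weight \<mu>) (\<lambda>n. \<beta> (r0 (r1 (r n)))) \<eta>"
    using W.L2_weakly_compact[OF QR, of "\<lambda>n. \<beta> (r0 (r1 n))", OF \<beta> B\<beta>] .
  then obtain \<eta> r2 where \<eta>: "L2 (weight \<mu>) \<eta>" and r2: "strict_mono (r2 :: nat \<Rightarrow> nat)"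
    and weak2: "weakly_L2 (weight \<mu>) (\<lambda>n. \<beta> (r0 (r1 (r2 n)))) \<eta>" by (elim exE conjE)
  define r where "r n = r0 (r1 (r2 n))" for n
  have r12: "strict_mono (r1 \<circ> r2)" using r1 r2 by (rule strict_mono_o)
  have r: "strict_mono r" using strict_mono_o[OF r0 r12] by (simp add: r_def[abs_def] o_def)
  have weakV: "weakly_L2 unit_time (\<lambda>n. V (r n)) v"
    unfolding weakly_L2_def r_def using weakly_L2_D[OF weak1, THEN LIMSEQ_subseq_LIMSEQ, OF _ r2] by (simp add: o_def)
  have weak\<beta>: "weakly_L2 (weight \<mu>) (\<lambda>n. \<beta> (r n)) \<eta>" using weak2 by (simp add: r_def)
  have "(\<lambda>n. S (r n)) \<longlonglongrightarrow> (a, b, \<delta>)"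
    using LIMSEQ_subseq_LIMSEQ[OF Sl r12] by (simp add: o_def r_def l)
  from tendsto_fst[OF this] tendsto_fst[OF tendsto_snd[OF this]] tendsto_snd[OF tendsto_snd[OF this]]
  have lims: "(\<lambda>n. kinetic (V (r n))) \<longlonglongrightarrow> a" "(\<lambda>n. \<integral>x. (norm (\<beta> (r n) x))\<^sup>2 \<partial>weight \<mu>) \<longlonglongrightarrow> b"
    "(\<lambda>n. mismatch (V (r n)) (\<alpha> (r n))) \<longlonglongrightarrow> \<delta>"
    by (simp_all add: S_def)
  have "(\<lambda>n. J (V (r n)) (\<alpha> (r n))) \<longlonglongrightarrow> 1/2 * a + \<gamma>/2 * b + lam/2 * \<delta>\<^sup>2"
    unfolding energy_eq using lims by (auto simp: \<beta>_def intro!: tendsto_intros)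
  moreover have "(\<lambda>n. J (V (r n)) (\<alpha> (r n))) \<longlonglongrightarrow> I"
    using LIMSEQ_subseq_LIMSEQ[OF J_lim r] by (simp add: o_def)
  ultimately have I_eq: "I = 1/2 * a + \<gamma>/2 * b + lam/2 * \<delta>\<^sup>2" using LIMSEQ_unique by blast
  have a: "kinetic v \<le> a" by (rule T.L2_weak_lsc[OF Q V v weakV lims(1)])
  have b: "(L2_sq (weight \<mu>) \<eta>) \<le> b" by (rule W.L2_weak_lsc[OF QR \<beta> \<eta> weak\<beta> lims(2)])
  have aE: "a \<le> E" by (rule LIMSEQ_le_const2[OF lims(1)]) (use EV in blast)
  \<comment> \<open>The limit obeys the same energy bound as the sequence, so the uniform constants
    apply to it as well.\<close>
  have Ev: "kinetic v \<le> E" by (rule order_trans[OF a aE])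
  define \<alpha>' where "\<alpha>' x = \<eta> x + 1" for x
  have nn': "AE x in weight \<mu>. 0 \<le> \<alpha>' x"
    unfolding \<alpha>'_def by (rule W.weakly_L2_AE_nonneg[OF \<beta> \<eta> weak\<beta>]) (simp add: \<beta>_def nn)
  have "L2 (weight \<mu>) \<alpha>'" using W.L2_lincomb[OF QR \<eta> one, of 1 1] by (simp add: \<alpha>'_def[abs_def])
  then have adm': "admissible \<mu> v \<alpha>'" using v nn' by (simp add: admissible_def)
  have ex_lim: "(\<lambda>n. excess (V (r n)) (\<alpha> (r n)) w) \<longlonglongrightarrow> excess v \<alpha>' w" if w: "norm w \<le> 1" for w
  proof -
    interpret M: finite_measure \<mu> by (rule varifold_space(3)[OF \<mu>])
    obtain G where G: "\<forall>v w z. L2 unit_time v \<longrightarrow> kinetic v \<le> E \<longrightarrow> norm w \<le> 1 \<longrightarrow> z \<in> obundle d \<longrightarrow> \<bar>pairing v w z\<bar> \<le> G"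
      using pairing_bounded[of E] ..
    have "(\<lambda>n. \<integral>z. (\<beta> (r n) (fst z) + 1) * pairing (V (r n)) w z \<partial>\<mu>) \<longlonglongrightarrow> (\<integral>z. (\<eta> (fst z) + 1) * pairing v w z \<partial>\<mu>)"
    proof (rule M.weak_product_tendsto[OF fst_measurable, where B=B])
      show "L2 (distr \<mu> borel fst) (\<beta> (r n))" for n using \<beta>[of "r n"] by (simp only: weight_def)
      show "(L2_sq (distr \<mu> borel fst) (\<beta> (r n))) \<le> B" for n
        using B\<beta>[of "r n"] by (simp only: weight_def)
      show "L2 (distr \<mu> borel fst) \<eta>" using \<eta> by (simp only: weight_def)
      show "weakly_L2 (distr \<mu> borel fst) (\<lambda>n. \<beta> (r n)) \<eta>" using weak\<beta> by (simp only: weight_def)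
      show "pairing (V (r n)) w \<in> borel_measurable \<mu>" "pairing v w \<in> borel_measurable \<mu>" for n
        by (rule pairing_measurable[OF V] pairing_measurable[OF v])+
      show "\<bar>pairing (V (r n)) w z\<bar> \<le> G" if "z \<in> space \<mu>" for n z
        using G V EV w that unfolding varifold_space(2)[OF \<mu>] by blast
      show "(\<lambda>n. pairing (V (r n)) w z) \<longlonglongrightarrow> pairing v w z" if "z \<in> space \<mu>" for z
        using that unfolding varifold_space(2)[OF \<mu>] by (rule pairing_tendsto[OF V v weakV EV Ev])
    qed
    then show ?thesis unfolding excess_def by (intro tendsto_diff tendsto_const) (simp add: \<beta>_def \<alpha>'_def)
  qed
  \<comment> \<open>Lower semicontinuity of a supremum: every single \<open>excess\<close> of the
    limit is at most the limit \<open>\<delta>\<close> of the suprema.\<close>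
  have "mismatch v \<alpha>' \<le> \<delta>"
    unfolding mismatch_eq[OF adm']
  proof (rule cSUP_least)
    show "{w :: 'w. norm w \<le> 1} \<noteq> {}" by (auto intro!: exI[of _ 0])
    fix w :: 'w assume "w \<in> {w. norm w \<le> 1}"
    then have w: "norm w \<le> 1" by simp
    show "excess v \<alpha>' w \<le> \<delta>"
      by (rule LIMSEQ_le[OF ex_lim[OF w] lims(3)]) (use mismatch_ge[OF adm w] in blast)
  qed
  then have "(mismatch v \<alpha>')\<^sup>2 \<le> \<delta>\<^sup>2" using mismatch_nonneg[OF adm'] by (intro power_mono)
  then have "lam/2 * (mismatch v \<alpha>')\<^sup>2 \<le> lam/2 * \<delta>\<^sup>2" using pos by (intro mult_left_mono) auto
  moreover have "\<gamma>/2 * (\<integral>x. (\<alpha>' x - 1)\<^sup>2 \<partial>weight \<mu>) \<le> \<gamma>/2 * b"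
    using b pos by (intro mult_left_mono) (auto simp: \<alpha>'_def)
  moreover have "1/2 * kinetic v \<le> 1/2 * a" using a by (intro mult_left_mono) auto
  ultimately have "J v \<alpha>' \<le> I" unfolding energy_eq I_eq by (intro add_mono)
  then have "J v \<alpha>' = I" using I_le[OF adm'] by linarith
  then show ?thesis using adm' unfolding I_def by blast
qed

end

theorem theorem3:
  fixes d :: nat and \<gamma> lam :: real
    and \<mu> \<mu>' :: "('n::finite opoint) measure"
    and \<iota> :: "'v::{real_inner,complete_space} \<Rightarrow> real^'n \<Rightarrow> real^'n"
    and kpos :: "real^'n \<Rightarrow> real^'n \<Rightarrow> real"
    and kG :: "real^('n set) \<Rightarrow> real^('n set) \<Rightarrow> real"
    and ev :: "'w::{real_inner,complete_space} \<Rightarrow> 'n opoint \<Rightarrow> real"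
    and K :: "('n opoint) set"
  assumes "CARD('n) \<ge> 2" and "d \<le> CARD('n)"
    and "\<gamma> > 0" and "lam > 0"
    and "C2_0_embedded \<iota>"
    and "pos_def_kernel UNIV kpos" and "continuous_on UNIV (\<lambda>(x, x'). kpos x x')"
    and "\<And>x. C0_on UNIV (kpos x)"
    and "pos_def_kernel (ograss d) kG"
    and "continuous_on (ograss d \<times> ograss d) (\<lambda>(U, U'). kG U U')"
    and "rkhs (obundle d) (prod_kernel kpos kG) ev"
    and "C0_universal (obundle d) ev"
    and "C1_0_embedded (obundle d) ev"
    and "varifold d \<mu>" and "varifold d \<mu>'"
    and "compact K" and "K \<subseteq> obundle d" and "msupp \<mu> \<subseteq> K"
  shows "\<exists>v \<alpha>. admissible \<mu> v \<alpha> \<and>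
    energy d \<gamma> lam \<iota> ev \<mu> \<mu>' v \<alpha> =
      (INF (v', \<alpha>')\<in>{(v', \<alpha>'). admissible \<mu> v' \<alpha>'}. energy d \<gamma> lam \<iota> ev \<mu> \<mu>' v' \<alpha>')"
proof -
  obtain D\<iota> C where F: "field_space \<iota> D\<iota> C" using field_space_if_C2_0_embedded[OF assms(5)] by blast
  interpret F: field_space \<iota> D\<iota> C by (rule F)
  have "continuous_on UNIV (\<iota> v)" for v
    using assms(5) unfolding C2_0_embedded_def C2_0_def C0_on_def by blast
  moreover have "inj \<iota>" using assms(5) unfolding C2_0_embedded_def by blast
  \<comment> \<open>Separability of \<open>V\<close> follows from the embedding; the dense set
    \<open>Q\<close> feeds the weak compactness of curves.\<close>
  ultimately have "\<exists>Q :: 'v set. countable Q \<and> closure Q = UNIV"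
    using F.lin F.bound by (intro separable_if_evaluations_continuous)
  then obtain Q :: "'v set" where Q: "countable Q" "closure Q = UNIV" by blast
  \<comment> \<open>The embedding of \<open>W\<close> supplies continuity of the test functions and
    a uniform bound on their values by the norm.\<close>
  obtain Ce where Ce: "\<forall>w. \<exists>f'. C1_0_on (obundle d) (ev w) f' \<and>
      (\<forall>z\<in>obundle d. \<bar>ev w z\<bar> \<le> Ce * norm w \<and> norm (f' z) \<le> Ce * norm w)"
    using assms(13) unfolding C1_0_embedded_def by blast
  interpret matching \<iota> D\<iota> C d \<gamma> lam \<mu> \<mu>' ev Q Ce
  proof
    show "continuous_on (obundle d) (ev w)" for w
      using Ce unfolding C1_0_on_def C0_on_def by blast
    show "\<bar>ev w z\<bar> \<le> Ce * norm w" if "z \<in> obundle d" for w z using Ce that by blast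
    show "ev 0 z = 0" if "z \<in> obundle d" for z
    proof -
      have "linear (\<lambda>w. ev w z)" using assms(11) that unfolding rkhs_def by blast
      from linear_0[OF this] show ?thesis .
    qed
  qed (use Q assms in auto)
  show ?thesis by (rule minimizer_exists)
qed

end
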